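(* Consider the reach-avoid game described in the context, with speed ratio $\alpha=v_E/v_P\in(0,1)$. Assume all players have pairwise distinct initial positions, the pursuers' initial positions lie in $\Omega_{\rm play}\cup\mathcal T$, and the evaders' initial positions lie in $\Omega_{\rm play}$. Let $k$ be any pursuit coalition, with members $P_{m_1},\dots,P_{m_{n_k}}$ and joint initial position $\mathcal X_k^0$. For each $i$ let $$\mathcal T_1^{(i)}=\mathcal T\cap\bigcap_{j\ne i}\big\{\mathbf z\in\mathbb R^2:\|\mathbf z-\mathbf x^0_{P_{m_i}}\|_2<\|\mathbf z-\mathbf x^0_{P_{m_j}}\|_2\big\},$$ and let $\bar{\mathcal X}_k^0$ be the set of those $\mathbf x^0_{P_{m_i}}$ with $\mathcal T_1^{(i)}\neq\emptyset$, and $\bar n_k$ its cardinality. Then $\bar{\mathcal X}_k^0$ is the largest full-active pursuit subcoalition of $k$, and the barriers against one evader satisfy $$\mathcal B^{n_k}(\mathcal X_k^0)=\mathcal B^{\bar n_k}(\bar{\mathcal X}_k^0),$$ where, listing the elements of $\bar{\mathcal X}_k^0$ as $\bm h_1,\dots,\bm h_{\bar n_k}$ in order of increasing $x$-coordinate, $\mathcal B^{\bar n_k}(\bar{\mathcal X}_k^0)=\Phi_{\bar n_k}(\bm h_1,\dots,\bm h_{\bar n_k})\cap\Omega_{\rm play}$, with $\Phi_n$ the explicit curves defined in the context.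
   Context: Domain. $\Omega\subset\mathbb R^2$ is a bounded convex domain. A straight segment $\mathcal T\subset\Omega$ (the target line) with endpoints $\bm m=(0,0)$ and $\bm n=(l,0)$, $l>0$, both on $\partial\Omega$, cuts $\Omega$ into the compact target region $\Omega_{\rm tar}\supset\mathcal T$ (the part in $y\ge 0$) and the play region $\Omega_{\rm play}=\Omega\setminus\Omega_{\rm tar}$ (the part in $y<0$). Players. There are pursuers $P_1,\dots,P_{N_p}$ and evaders $E_1,\dots,E_{N_e}$, which are points moving in $\Omega$ with $\dot{\mathbf x}_{P_i}=v_P\mathbf u_{P_i}$, $\dot{\mathbf x}_{E_j}=v_E\mathbf u_{E_j}$, controls in $\mathcal U=\{\mathbf u\in\mathbb R^2:\|\mathbf u\|_2=1\}$, and initial positions $\mathbf x^0_{P_i},\mathbf x^0_{E_j}$; $\alpha=v_E/v_P$. An evader is captured when its position in $\Omega_{\rm play}$ coincides with that of a pursuer; once it enters $\Omega_{\rm tar}$ it can no longer be captured. Information structure: the evader uses state feedback; the pursuit team uses state feedback together with the evader's current input (non-anticipative strategies). Winning regions and barrier. A pursuit coalition $k$ is a nonempty set of $n_k$ pursuers with joint initial position $\mathcal X_k^0$. For a game between coalition $k$ and one evader: $\mathcal W_P^{n_k}(\mathcal X_k^0)\subset\Omega_{\rm play}$ is the set of initial evader positions from which the coalition can guarantee capture before the evader enters $\Omega_{\rm tar}$, whatever the evader does; $\mathcal W_E^{n_k}(\mathcal X_k^0)\subset\Omega_{\rm play}$ is the set of initial evader positions from which the evader can guarantee entering $\Omega_{\rm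 tar}$ without being captured, whatever the coalition does. The barrier $\mathcal B^{n_k}(\mathcal X_k^0)\subset\Omega_{\rm play}$ is the curve separating these two regions, i.e. the set of positions from which neither side can guarantee its own winning (under optimal play capture and arrival at $\mathcal T$ happen simultaneously), with $\mathcal B^{n_k}\cup\mathcal W_P^{n_k}\cup\mathcal W_E^{n_k}=\Omega_{\rm play}$. Active pursuers. A pursuer $P_i$ of coalition $k$ is active in $k$ if some point of $\mathcal T$ is reached by $P_i$ before all other pursuers of $k$, i.e. there is $\bm p\in\mathcal T$ with $\|\mathbf x^0_{P_i}-\bm p\|_2<\|\mathbf x^0_{P_j}-\bm p\|_2$ for every other $P_j$ in $k$; otherwise inactive. A coalition is full-active if all its members are active in it. The largest full-active pursuit subcoalition of $k$ is the subcoalition consisting of all pursuers that are active in $k$. (Members of a full-active coalition have pairwise different $x$-coordinates.) Base curves. Let $\bm h_i=(x_i,y_i)$, $y_i\le0$, $x_1<x_2<x_3$, and write $\mathbf z=(x,y)\in\mathbb R^2$. One pursuer: with $k_1=\alpha^2x_1$, $k_2=(1-\alpha^2)l+\alpha^2x_1$, $$F^1_1(\bm h_1)=\{\mathbf z:\|\mathbf z-\bm m\|_2=\alpha\|\bm h_1-\bm m\|_2,\ x\le k_1,\ y<0\},$$ $$F^1_2(\bm h_1)=\{\mathbf z:(x-x_1)^2+(1-1/\alpha^2)y^2+(1-\alpha^2)y_1^2=0,\ x\in(k_1,k_2),\ y<0\},$$ $$F^1_3(\bm h_1)=\{\mathbf z:\|\mathbf z-\bm n\|_2=\alpha\|\bm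 h_1-\bm n\|_2,\ x\ge k_2,\ y<0\}.$$ Two pursuers: let $\bm p_c=(x_c,0)$ be the unique point of the $x$-axis with $\|\bm p_c-\bm h_1\|_2=\|\bm p_c-\bm h_2\|_2$, $k_3=\alpha^2x_1$, $k_4=(1-\alpha^2)x_c+\alpha^2x_1$, $k_5=(1-\alpha^2)x_c+\alpha^2x_2$, $k_6=(1-\alpha^2)l+\alpha^2x_2$; $$F^2_1(\bm h_1,\bm h_2)=F^1_1(\bm h_1),\qquad F^2_5(\bm h_1,\bm h_2)=F^1_3(\bm h_2),$$ $$F^2_2(\bm h_1,\bm h_2)=\{\mathbf z:(x-x_1)^2+(1-1/\alpha^2)y^2+(1-\alpha^2)y_1^2=0,\ x\in(k_3,k_4),\ y<0\},$$ $$F^2_3(\bm h_1,\bm h_2)=\{\mathbf z:\|\mathbf z-\bm p_c\|_2=\alpha\|\bm h_1-\bm p_c\|_2,\ x\in[k_4,k_5],\ y<0\},$$ $$F^2_4(\bm h_1,\bm h_2)=\{\mathbf z:(x-x_2)^2+(1-1/\alpha^2)y^2+(1-\alpha^2)y_2^2=0,\ x\in(k_5,k_6),\ y<0\}.$$ Three pursuers: let $\bm p_{c1}=(x_{c1},0)$, $\bm p_{c2}=(x_{c2},0)$ satisfy $\|\bm h_1-\bm p_{c1}\|_2=\|\bm h_2-\bm p_{c1}\|_2$ and $\|\bm h_2-\bm p_{c2}\|_2=\|\bm h_3-\bm p_{c2}\|_2$, $k_7=(1-\alpha^2)x_{c1}+\alpha^2x_2$, $k_8=(1-\alpha^2)x_{c2}+\alpha^2x_2$;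 $$F^3(\bm h_1,\bm h_2,\bm h_3)=\{\mathbf z:(x-x_2)^2+(1-1/\alpha^2)y^2+(1-\alpha^2)y_2^2=0,\ x\in(k_7,k_8),\ y<0\}.$$ Curves $\Phi_n$, for $\bm h_1,\dots,\bm h_n$ with increasing $x$-coordinates: $\Phi_1=\bigcup_{s=1}^3F^1_s(\bm h_1)$, $\Phi_2=\bigcup_{s=1}^5F^2_s(\bm h_1,\bm h_2)$, and for $n\ge3$ $$\Phi_n=\bigcup_{i=1}^2F^2_i(\bm h_1,\bm h_2)\cup\bigcup_{i=1}^{n-1}F^2_3(\bm h_i,\bm h_{i+1})\cup\bigcup_{i=2}^{n-1}F^3(\bm h_{i-1},\bm h_i,\bm h_{i+1})\cup\bigcup_{i=4}^5F^2_i(\bm h_{n-1},\bm h_n).$$ *)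

theory Defs
  imports "HOL-Analysis.Analysis"
begin

type_synonym point = "real \<times> real"

definition target_line :: "real \<Rightarrow> point set" where
  "target_line l = closed_segment (0, 0) (l, 0)"

definition target_region :: "point set \<Rightarrow> point set" where
  "target_region \<Omega> = {z \<in> \<Omega>. snd z \<ge> 0}"

definition play_region :: "point set \<Rightarrow> point set" where
  "play_region \<Omega> = \<Omega> - target_region \<Omega>"

text \<open>A bounded convex domain containing a segment with end points on its boundary is not open, and
  it need not be closed either: only the target region is required to be compact.  That the
  segment cuts the domain into the parts above and below it means that it is the whole
  intersection of the domain with the horizontal axis.\<close>

definition reach_avoid_domain :: "point set \<Rightarrow> real \<Rightarrow> bool" where
  "reach_avoid_domain \<Omega> l \<longleftrightarrow>
     convex \<Omega> \<and> bounded \<Omega> \<and> interior \<Omega> \<noteq> {} \<and> 0 < l \<and>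
     {z \<in> \<Omega>. snd z = 0} = target_line l \<and>
     (0, 0) \<in> frontier \<Omega> \<and> (l, 0) \<in> frontier \<Omega> \<and>
     compact (target_region \<Omega>)"

definition control_signal :: "(real \<Rightarrow> point) \<Rightarrow> bool" where
  "control_signal u \<longleftrightarrow> u \<in> borel_measurable (lebesgue_on {0..}) \<and> (\<forall>t\<ge>0. norm (u t) = 1)"

text \<open>The Caratheodory solution of \<open>x' = v u\<close>, \<open>x(0) = x0\<close>.\<close>

definition trajectory :: "real \<Rightarrow> point \<Rightarrow> (real \<Rightarrow> point) \<Rightarrow> real \<Rightarrow> point" where
  "trajectory v x0 u t = x0 + v *\<^sub>R integral {0..t} u"

definition admissible_control :: "point set \<Rightarrow> real \<Rightarrow> point \<Rightarrow> (real \<Rightarrow> point) \<Rightarrow> bool" where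
  "admissible_control \<Omega> v x0 u \<longleftrightarrow> control_signal u \<and> (\<forall>t\<ge>0. trajectory v x0 u t \<in> \<Omega>)"

text \<open>\<open>XP i\<close> for \<open>i \<in> K\<close> are the paths of the members of a coalition \<open>K\<close>, and \<open>XE\<close> is the path of
  the evader.  If a pursuer meets the evader exactly at the first instant at which the evader is in the
  target region, then neither side has won; this is what makes the barrier the locus of
  simultaneous capture and arrival.\<close>

definition pursuers_win ::
    "point set \<Rightarrow> nat set \<Rightarrow> (nat \<Rightarrow> real \<Rightarrow> point) \<Rightarrow> (real \<Rightarrow> point) \<Rightarrow> bool" where
  "pursuers_win \<Omega> K XP XE \<longleftrightarrow>
     (\<exists>t\<ge>0. (\<exists>i\<in>K. XP i t = XE t) \<and> (\<forall>s\<in>{0..t}. XE s \<in> play_region \<Omega>))"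

definition evader_wins ::
    "point set \<Rightarrow> nat set \<Rightarrow> (nat \<Rightarrow> real \<Rightarrow> point) \<Rightarrow> (real \<Rightarrow> point) \<Rightarrow> bool" where
  "evader_wins \<Omega> K XP XE \<longleftrightarrow>
     (\<exists>t\<ge>0. XE t \<in> target_region \<Omega> \<and> (\<forall>s\<in>{0..t}. \<forall>i\<in>K. XP i s \<noteq> XE s))"

definition undecided ::
    "point set \<Rightarrow> nat set \<Rightarrow> (nat \<Rightarrow> real \<Rightarrow> point) \<Rightarrow> (real \<Rightarrow> point) \<Rightarrow> real \<Rightarrow> bool" where
  "undecided \<Omega> K XP XE t \<longleftrightarrow>
     (\<forall>s\<in>{0..t}. XE s \<in> play_region \<Omega> \<and> (\<forall>i\<in>K. XP i s \<noteq> XE s))"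

text \<open>A strategy of the pursuit team maps the evader's control signal to the pursuers' controls
  and is non-anticipative: the pursuers' inputs up to time \<open>t\<close> only depend on the
  evader's inputs up to and including time \<open>t\<close>.  Since the initial state is fixed, these determine the state.\<close>

definition pursuit_strategy ::
    "point set \<Rightarrow> real \<Rightarrow> real \<Rightarrow> nat set \<Rightarrow> (nat \<Rightarrow> point) \<Rightarrow> point \<Rightarrow>
     ((real \<Rightarrow> point) \<Rightarrow> nat \<Rightarrow> real \<Rightarrow> point) \<Rightarrow> bool" where
  "pursuit_strategy \<Omega> vP vE K xP z \<gamma> \<longleftrightarrow>
     (\<forall>uE. admissible_control \<Omega> vE z uE \<longrightarrow>
        (\<forall>i\<in>K. admissible_control \<Omega> vP (xP i) (\<gamma> uE i))) \<and>
     (\<forall>uE uE' t. admissible_control \<Omega> vE z uE \<longrightarrow> admissible_control \<Omega> vE z uE' \<longrightarrow>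
        (\<forall>s\<in>{0..t}. uE s = uE' s) \<longrightarrow> (\<forall>i\<in>K. \<forall>s\<in>{0..t}. \<gamma> uE i s = \<gamma> uE' i s))"

definition pursuit_winning_region ::
    "point set \<Rightarrow> real \<Rightarrow> real \<Rightarrow> nat set \<Rightarrow> (nat \<Rightarrow> point) \<Rightarrow> point set" where
  "pursuit_winning_region \<Omega> vP vE K xP =
     {z \<in> play_region \<Omega>. \<exists>\<gamma>. pursuit_strategy \<Omega> vP vE K xP z \<gamma> \<and>
        (\<forall>uE. admissible_control \<Omega> vE z uE \<longrightarrow>
           pursuers_win \<Omega> K (\<lambda>i. trajectory vP (xP i) (\<gamma> uE i)) (trajectory vE z uE))}"

text \<open>A play in which the evader applies the state feedback \<open>\<beta>\<close> (a function of the positions of the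
  coalition members and its own position) for as long as the game is undecided, while the
  pursuers apply arbitrary controls \<open>uP\<close>.\<close>

definition feedback_play ::
    "point set \<Rightarrow> real \<Rightarrow> real \<Rightarrow> nat set \<Rightarrow> (nat \<Rightarrow> point) \<Rightarrow> point \<Rightarrow>
     ((nat \<Rightarrow> point) \<Rightarrow> point \<Rightarrow> point) \<Rightarrow> (nat \<Rightarrow> real \<Rightarrow> point) \<Rightarrow> (real \<Rightarrow> point) \<Rightarrow> bool" where
  "feedback_play \<Omega> vP vE K xP z \<beta> uP uE \<longleftrightarrow>
     (\<forall>i\<in>K. admissible_control \<Omega> vP (xP i) (uP i)) \<and> admissible_control \<Omega> vE z uE \<and>
     (AE t in lebesgue_on {0..}.
        undecided \<Omega> K (\<lambda>i. trajectory vP (xP i) (uP i)) (trajectory vE z uE) t \<longrightarrow>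
        uE t = \<beta> (\<lambda>i\<in>K. trajectory vP (xP i) (uP i) t) (trajectory vE z uE t))"

text \<open>Besides taking values in the unit circle, a feedback must be implementable: from every
  state and against all admissible controls of the pursuers the closed loop has a solution.
  Otherwise a feedback without solutions would win vacuously.\<close>

definition evader_feedback ::
    "point set \<Rightarrow> real \<Rightarrow> real \<Rightarrow> nat set \<Rightarrow> ((nat \<Rightarrow> point) \<Rightarrow> point \<Rightarrow> point) \<Rightarrow> bool" where
  "evader_feedback \<Omega> vP vE K \<beta> \<longleftrightarrow>
     (\<forall>X \<in> K \<rightarrow>\<^sub>E \<Omega>. \<forall>e \<in> play_region \<Omega>. norm (\<beta> X e) = 1) \<and>
     (\<forall>X \<in> K \<rightarrow>\<^sub>E \<Omega>. \<forall>e \<in> play_region \<Omega>. \<forall>uP.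
        (\<forall>i\<in>K. admissible_control \<Omega> vP (X i) (uP i)) \<longrightarrow>
        (\<exists>uE. feedback_play \<Omega> vP vE K X e \<beta> uP uE))"

definition evasion_winning_region ::
    "point set \<Rightarrow> real \<Rightarrow> real \<Rightarrow> nat set \<Rightarrow> (nat \<Rightarrow> point) \<Rightarrow> point set" where
  "evasion_winning_region \<Omega> vP vE K xP =
     {z \<in> play_region \<Omega>. \<exists>\<beta>. evader_feedback \<Omega> vP vE K \<beta> \<and>
        (\<forall>uP uE. feedback_play \<Omega> vP vE K xP z \<beta> uP uE \<longrightarrow>
           evader_wins \<Omega> K (\<lambda>i. trajectory vP (xP i) (uP i)) (trajectory vE z uE))}"

definition barrier ::
    "point set \<Rightarrow> real \<Rightarrow> real \<Rightarrow> nat set \<Rightarrow> (nat \<Rightarrow> point) \<Rightarrow> point set" where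
  "barrier \<Omega> vP vE K xP =
     play_region \<Omega> - (pursuit_winning_region \<Omega> vP vE K xP \<union> evasion_winning_region \<Omega> vP vE K xP)"

definition active :: "real \<Rightarrow> (nat \<Rightarrow> point) \<Rightarrow> nat set \<Rightarrow> nat \<Rightarrow> bool" where
  "active l xP K i \<longleftrightarrow>
     i \<in> K \<and> (\<exists>p \<in> target_line l. \<forall>j \<in> K - {i}. norm (xP i - p) < norm (xP j - p))"

definition full_active :: "real \<Rightarrow> (nat \<Rightarrow> point) \<Rightarrow> nat set \<Rightarrow> bool" where
  "full_active l xP K \<longleftrightarrow> (\<forall>i\<in>K. active l xP K i)"

text \<open>``Largest'' does not refer to inclusion or cardinality among all full-active subcoalitions
  (every singleton is full-active); it refers to the set of all pursuers active in the whole coalition.\<close>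

definition largest_full_active_subcoalition ::
    "real \<Rightarrow> (nat \<Rightarrow> point) \<Rightarrow> nat set \<Rightarrow> nat set \<Rightarrow> bool" where
  "largest_full_active_subcoalition l xP K S \<longleftrightarrow>
     S \<noteq> {} \<and> S \<subseteq> K \<and> full_active l xP S \<and> (\<forall>i\<in>K. i \<in> S \<longleftrightarrow> active l xP K i)"

definition target_part :: "real \<Rightarrow> (nat \<Rightarrow> point) \<Rightarrow> nat set \<Rightarrow> nat \<Rightarrow> point set" where
  "target_part l xP K i =
     target_line l \<inter> (\<Inter>j \<in> K - {i}. {z. norm (z - xP i) < norm (z - xP j)})"

definition F1_1 :: "real \<Rightarrow> real \<Rightarrow> point \<Rightarrow> point set" where
  "F1_1 \<alpha> l h1 = (let m = (0, 0); k1 = \<alpha>\<^sup>2 * fst h1 in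
     {z. norm (z - m) = \<alpha> * norm (h1 - m) \<and> fst z \<le> k1 \<and> snd z < 0})"

definition F1_2 :: "real \<Rightarrow> real \<Rightarrow> point \<Rightarrow> point set" where
  "F1_2 \<alpha> l h1 = (let k1 = \<alpha>\<^sup>2 * fst h1; k2 = (1 - \<alpha>\<^sup>2) * l + \<alpha>\<^sup>2 * fst h1 in
     {(x, y). (x - fst h1)\<^sup>2 + (1 - 1 / \<alpha>\<^sup>2) * y\<^sup>2 + (1 - \<alpha>\<^sup>2) * (snd h1)\<^sup>2 = 0 \<and>
              k1 < x \<and> x < k2 \<and> y < 0})"

definition F1_3 :: "real \<Rightarrow> real \<Rightarrow> point \<Rightarrow> point set" where
  "F1_3 \<alpha> l h1 = (let n = (l, 0); k2 = (1 - \<alpha>\<^sup>2) * l + \<alpha>\<^sup>2 * fst h1 in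
     {z. norm (z - n) = \<alpha> * norm (h1 - n) \<and> fst z \<ge> k2 \<and> snd z < 0})"

text \<open>The point of the horizontal axis equidistant from two points, unique if their
  first coordinates differ.\<close>

definition equidistant_point :: "point \<Rightarrow> point \<Rightarrow> point" where
  "equidistant_point h1 h2 = (THE p. snd p = 0 \<and> norm (p - h1) = norm (p - h2))"

definition F2_1 :: "real \<Rightarrow> real \<Rightarrow> point \<Rightarrow> point \<Rightarrow> point set" where
  "F2_1 \<alpha> l h1 h2 = F1_1 \<alpha> l h1"

definition F2_2 :: "real \<Rightarrow> real \<Rightarrow> point \<Rightarrow> point \<Rightarrow> point set" where
  "F2_2 \<alpha> l h1 h2 =
    (let xc = fst (equidistant_point h1 h2);
         k3 = \<alpha>\<^sup>2 * fst h1; k4 = (1 - \<alpha>\<^sup>2) * xc + \<alpha>\<^sup>2 * fst h1 in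
     {(x, y). (x - fst h1)\<^sup>2 + (1 - 1 / \<alpha>\<^sup>2) * y\<^sup>2 + (1 - \<alpha>\<^sup>2) * (snd h1)\<^sup>2 = 0 \<and>
              k3 < x \<and> x < k4 \<and> y < 0})"

definition F2_3 :: "real \<Rightarrow> real \<Rightarrow> point \<Rightarrow> point \<Rightarrow> point set" where
  "F2_3 \<alpha> l h1 h2 =
    (let pc = equidistant_point h1 h2; xc = fst pc;
         k4 = (1 - \<alpha>\<^sup>2) * xc + \<alpha>\<^sup>2 * fst h1; k5 = (1 - \<alpha>\<^sup>2) * xc + \<alpha>\<^sup>2 * fst h2 in
     {z. norm (z - pc) = \<alpha> * norm (h1 - pc) \<and> k4 \<le> fst z \<and> fst z \<le> k5 \<and> snd z < 0})"

definition F2_4 :: "real \<Rightarrow> real \<Rightarrow> point \<Rightarrow> point \<Rightarrow> point set" where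
  "F2_4 \<alpha> l h1 h2 =
    (let xc = fst (equidistant_point h1 h2);
         k5 = (1 - \<alpha>\<^sup>2) * xc + \<alpha>\<^sup>2 * fst h2; k6 = (1 - \<alpha>\<^sup>2) * l + \<alpha>\<^sup>2 * fst h2 in
     {(x, y). (x - fst h2)\<^sup>2 + (1 - 1 / \<alpha>\<^sup>2) * y\<^sup>2 + (1 - \<alpha>\<^sup>2) * (snd h2)\<^sup>2 = 0 \<and>
              k5 < x \<and> x < k6 \<and> y < 0})"

definition F2_5 :: "real \<Rightarrow> real \<Rightarrow> point \<Rightarrow> point \<Rightarrow> point set" where
  "F2_5 \<alpha> l h1 h2 = F1_3 \<alpha> l h2"

definition F3 :: "real \<Rightarrow> point \<Rightarrow> point \<Rightarrow> point \<Rightarrow> point set" where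
  "F3 \<alpha> h1 h2 h3 =
    (let xc1 = fst (equidistant_point h1 h2); xc2 = fst (equidistant_point h2 h3);
         k7 = (1 - \<alpha>\<^sup>2) * xc1 + \<alpha>\<^sup>2 * fst h2; k8 = (1 - \<alpha>\<^sup>2) * xc2 + \<alpha>\<^sup>2 * fst h2 in
     {(x, y). (x - fst h2)\<^sup>2 + (1 - 1 / \<alpha>\<^sup>2) * y\<^sup>2 + (1 - \<alpha>\<^sup>2) * (snd h2)\<^sup>2 = 0 \<and>
              k7 < x \<and> x < k8 \<and> y < 0})"

text \<open>The points \<open>h 1, \<dots>, h n\<close> are the only values of \<open>h\<close> used in \<open>Phi \<alpha> l n h\<close>; only \<open>n \<ge> 1\<close> is meaningful.\<close>

definition Phi :: "real \<Rightarrow> real \<Rightarrow> nat \<Rightarrow> (nat \<Rightarrow> point) \<Rightarrow> point set" where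
  "Phi \<alpha> l n h =
    (if n = 1 then F1_1 \<alpha> l (h 1) \<union> F1_2 \<alpha> l (h 1) \<union> F1_3 \<alpha> l (h 1)
     else if n = 2 then
       F2_1 \<alpha> l (h 1) (h 2) \<union> F2_2 \<alpha> l (h 1) (h 2) \<union> F2_3 \<alpha> l (h 1) (h 2) \<union>
       F2_4 \<alpha> l (h 1) (h 2) \<union> F2_5 \<alpha> l (h 1) (h 2)
     else
       F2_1 \<alpha> l (h 1) (h 2) \<union> F2_2 \<alpha> l (h 1) (h 2) \<union>
       (\<Union>i\<in>{1..n-1}. F2_3 \<alpha> l (h i) (h (i + 1))) \<union>
       (\<Union>i\<in>{2..n-1}. F3 \<alpha> (h (i - 1)) (h i) (h (i + 1))) \<union>
       F2_4 \<alpha> l (h (n - 1)) (h n) \<union> F2_5 \<alpha> l (h (n - 1)) (h n))"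

definition increasing_listing :: "nat \<Rightarrow> (nat \<Rightarrow> point) \<Rightarrow> point set \<Rightarrow> bool" where
  "increasing_listing n h X \<longleftrightarrow>
     bij_betw h {1..n} X \<and> strict_mono_on {1..n} (\<lambda>i. fst (h i))"

end

theory Submission
  imports Defs
begin

text \<open>Call a position of the evader dominated by the pursuers if every point of the target line is closer,
  after rescaling by the speed ratio \<open>\<alpha>\<close>, to some pursuer, and dominated by the evader if some point of it is
  closer to the evader than to all pursuers.  The barrier consists of the positions for which neither holds.

  An evader who dominates a point runs straight to it.  If the pursuers dominate, they move in discrete time
  steps such that the lines of sight stay parallel; then the Apollonius discs are nested, the evader is confined to a compact
  set disjoint from the target line, and the distances decrease, until some pursuer is so close that it can finish by running to
  the previous positions of the evader in time steps that shrink to zero.  The reaction is delayed by one time step,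
  and the same plan therefore defeats every feedback of the evader.

  In a position where neither side dominates there is a critical point of the target line which is reached
  simultaneously.  The evader forces this tie by running straight to it.  If all pursuers run straight to it, too, then any
  deviation \<open>d\<close> of the evader costs a term of order \<open>\<bar>d\<bar>\<^sup>2 / s\<close> within time \<open>s\<close> and gains only \<open>O(\<bar>d\<bar>\<^sup>2)\<close>, hence leads to
  a position dominated by the pursuers.

  On the target line the differences of the squared distances are quadratic polynomials in \<open>x\<close> with the common
  leading coefficient \<open>1 - \<alpha>\<^sup>2\<close>.  Neutral positions are those for which their maximum has minimum zero; the pieces of the
  explicit curves correspond to the place of the minimum: a vertex of one of the parabolas, a breakpoint between two of
  them, or an end of the target line.\<close>

section \<open>Trajectories and admissible controls\<close>

text \<open>The two sides are not treated alike: pursuers answer by a non-anticipative strategy, the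
  evader by an arbitrary, possibly discontinuous feedback. Two sides reacting to each other at once
  need not have a joint play. Hence every pursuit is made of open-loop legs fixed before the
  evader's reply to them is seen, and \<open>pursuit_induction\<close> speaks of an abstract
  predicate \<open>G\<close> on states, so that it yields strategies as well as plays against a
  given feedback. The error caused by the delay is absorbed by the positive distance between the
  confining set and the target line.

  With steps of fixed length a pursuer only comes close; capture itself needs infinitely many legs
  in finite time, hence the gluing of controls at an accumulation point.

  Controls have norm one and paths must stay in \<Omega> forever, even after the game is decided. A
  player cannot wait, so spare time is spent on excursions, and every finite manoeuvre is continued
  by some admissible control. As \<Omega> need not be closed, projections and limits of positions
  need separate care.\<close>

lemma AE_lebesgue_on_atLeast_iff:
  "(AE t in lebesgue_on {0::real..}. P t) \<longleftrightarrow> negligible {t. 0 \<le> t \<and> \<not> P t}"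
  by (subst AE_restrict_space_iff)
    (auto simp: eventually_ae_filter_negligible intro: negligible_subset)

text \<open>Extending by the unit vector \<open>(1, 0)\<close> turns measurability on the half-line
  into Lebesgue measurability on the whole line, where translations and case distinctions are at
  hand.\<close>

definition ext_nonneg :: "(real \<Rightarrow> point) \<Rightarrow> real \<Rightarrow> point" where
  "ext_nonneg u t = (if t \<in> {0..} then u t else (1, 0))"

lemma control_signal_iff:
  "control_signal u \<longleftrightarrow> ext_nonneg u \<in> borel_measurable lebesgue \<and> (\<forall>t\<ge>0. norm (u t) = 1)"
  unfolding control_signal_def ext_nonneg_def
  by (subst measurable_restrict_space_iff[where c = "(1, 0)"]) auto

lemma lebesgue_measurable_shift: "(\<lambda>t::real. t + c) \<in> lebesgue \<rightarrow>\<^sub>M lebesgue"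
  using lebesgue_affine_measurable[where c = "\<lambda>_::real. 1" and t = c] by (simp add: add.commute)

lemma control_signal_shift:
  assumes "control_signal u" "0 \<le> a"
  shows "control_signal (\<lambda>s. u (s + a))"
proof -
  have "(\<lambda>s. ext_nonneg u (s + a)) \<in> borel_measurable lebesgue"
    using assms measurable_compose[OF lebesgue_measurable_shift[of a]] by (auto simp: control_signal_iff)
  then have "(\<lambda>s. if s \<in> {0..} then ext_nonneg u (s + a) else (1, 0)) \<in> borel_measurable lebesgue"
    by (intro measurable_If_set) auto
  moreover have "(\<lambda>s. if s \<in> {0..} then ext_nonneg u (s + a) else (1, 0)) = ext_nonneg (\<lambda>s. u (s + a))"
    using assms by (auto simp: ext_nonneg_def fun_eq_iff)
  ultimately show ?thesis
    using assms by (auto simp: control_signal_iff)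
qed

text \<open>The second control runs on its own clock, so that it can be taken from the game
  restarted at time \<open>a\<close>.\<close>

definition switch :: "real \<Rightarrow> (real \<Rightarrow> point) \<Rightarrow> (real \<Rightarrow> point) \<Rightarrow> real \<Rightarrow> point" where
  "switch a u w t = (if t < a then u t else w (t - a))"

lemma control_signal_splice:
  assumes "control_signal u" "control_signal w" "0 \<le> a"
  shows "control_signal (switch a u w)"
proof -
  have "(\<lambda>s. ext_nonneg w (s + (- a))) \<in> borel_measurable lebesgue"
    using assms measurable_compose[OF lebesgue_measurable_shift[of "- a"]] by (auto simp: control_signal_iff)
  then have "(\<lambda>s. if s \<in> {..<a} then ext_nonneg u s else ext_nonneg w (s + (- a))) \<in> borel_measurable lebesgue"
    using assms by (intro measurable_If_set) (auto simp: control_signal_iff)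
  moreover have "(\<lambda>s. if s \<in> {..<a} then ext_nonneg u s else ext_nonneg w (s + (- a))) = ext_nonneg (switch a u w)"
    using assms by (auto simp: ext_nonneg_def switch_def fun_eq_iff)
  ultimately show ?thesis
    using assms by (auto simp: control_signal_iff switch_def)
qed

lemma control_signal_integrable:
  assumes "control_signal u" "0 \<le> a"
  shows "u integrable_on {a..b}"
proof -
  have "u \<in> borel_measurable (lebesgue_on {a..b})"
    using assms unfolding control_signal_def
    by (meson atLeast_iff atLeastAtMost_iff measurable_restrict_mono order_trans subsetI)
  then show ?thesis
    by (rule measurable_bounded_by_integrable_imp_integrable[where g = "\<lambda>_. 1"])
      (use assms in \<open>auto simp: control_signal_def\<close>)
qed

lemma trajectory_0 [simp]: "trajectory v x u 0 = x"
  by (simp add: trajectory_def)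

lemma trajectory_diff:
  assumes "control_signal u" "0 \<le> s" "s \<le> t"
  shows "trajectory v x u t - trajectory v x u s = v *\<^sub>R integral {s..t} u"
proof -
  have "integral {0..s} u + integral {s..t} u = integral {0..t} u"
    using assms control_signal_integrable[of u 0 t]
    by (intro Henstock_Kurzweil_Integration.integral_combine) auto
  then show ?thesis
    by (auto simp: trajectory_def algebra_simps simp flip: scaleR_add_right)
qed

lemma trajectory_speed:
  assumes "control_signal u" "0 \<le> v" "0 \<le> s" "s \<le> t"
  shows "norm (trajectory v x u t - trajectory v x u s) \<le> v * (t - s)"
proof -
  have "norm (integral {s..t} u) \<le> integral {s..t} (\<lambda>_. 1::real)"
    using assms by (intro integral_norm_bound_integral control_signal_integrable)
      (auto simp: control_signal_def)
  then show ?thesis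
    using assms by (simp add: trajectory_diff mult_left_mono)
qed

lemma trajectory_dist:
  assumes "control_signal u" "0 \<le> v" "0 \<le> s" "0 \<le> t"
  shows "dist (trajectory v x u s) (trajectory v x u t) \<le> v * \<bar>s - t\<bar>"
  using trajectory_speed[of u v s t x] trajectory_speed[of u v t s x] assms
  by (cases "s \<le> t") (auto simp: dist_norm norm_minus_commute)

lemma trajectory_continuous:
  assumes "control_signal u" "0 \<le> v"
  shows "continuous_on {0..} (trajectory v x u)"
proof -
  have "v-lipschitz_on {0..} (trajectory v x u)"
    using assms trajectory_dist by (intro lipschitz_onI) (auto simp: dist_real_def)
  then show ?thesis
    by (rule lipschitz_on_continuous_on)
qed

lemma trajectory_shift:
  assumes "control_signal u" "0 \<le> a" "0 \<le> s"
  shows "trajectory v x u (s + a) = trajectory v (trajectory v x u a) (\<lambda>r. u (r + a)) s"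
proof -
  have "integral {a..s + a} u = integral {0..s} (\<lambda>r. u (r + a))"
    using integral_shift_Icc_real[of 0 s u a] by (simp add: o_def add.commute)
  then show ?thesis
    using trajectory_diff[OF assms(1,2), of "s + a" v x] assms
    by (simp add: trajectory_def algebra_simps)
qed

lemma trajectory_cong:
  assumes "\<And>s. 0 \<le> s \<Longrightarrow> s < t \<Longrightarrow> u s = w s"
  shows "trajectory v x u t = trajectory v x w t"
proof -
  have "integral {0..t} u = integral {0..t} w"
    by (rule integral_spike[of "{t}"]) (use assms in auto)
  then show ?thesis
    by (simp add: trajectory_def)
qed

lemma trajectory_splice_le:
  assumes "t \<le> a"
  shows "trajectory v x (switch a u w) t = trajectory v x u t"
  by (rule trajectory_cong) (use assms in \<open>auto simp: switch_def\<close>)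

lemma trajectory_splice_ge:
  assumes "control_signal u" "control_signal w" "0 \<le> a" "a \<le> t"
  shows "trajectory v x (switch a u w) t = trajectory v (trajectory v x u a) w (t - a)"
proof -
  have "trajectory v x (switch a u w) ((t - a) + a) =
      trajectory v (trajectory v x (switch a u w) a) (\<lambda>r. switch a u w (r + a)) (t - a)"
    by (rule trajectory_shift) (use assms control_signal_splice in auto)
  also have "\<dots> = trajectory v (trajectory v x u a) (\<lambda>r. switch a u w (r + a)) (t - a)"
    by (simp add: trajectory_splice_le)
  also have "\<dots> = trajectory v (trajectory v x u a) w (t - a)"
    by (rule trajectory_cong) (simp add: switch_def)
  finally show ?thesis by simp
qed

lemma trajectory_const: "0 \<le> t \<Longrightarrow> trajectory v x (\<lambda>_. d) t = x + (v * t) *\<^sub>R d"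
  by (simp add: trajectory_def)

lemma control_signal_const: "norm d = 1 \<Longrightarrow> control_signal (\<lambda>_. d)"
  by (simp add: control_signal_def)


section \<open>Gluing infinitely many controls\<close>

lemma borel_measurable_eventually_const:
  fixes V :: "nat \<Rightarrow> 'a \<Rightarrow> 'b::metric_space"
  assumes "\<And>k. V k \<in> borel_measurable M" "\<And>x. \<exists>n. \<forall>k\<ge>n. V k x = f x"
  shows "f \<in> borel_measurable M"
proof (rule borel_measurable_LIMSEQ_metric)
  fix x
  obtain n where "\<forall>k\<ge>n. V k x = f x" using assms(2) by blast
  then show "(\<lambda>k. V k x) \<longlonglongrightarrow> f x"
    by (intro tendsto_eventually) (auto simp: eventually_sequentially)
qed (rule assms)

text \<open>For a coherent family any \<open>k\<close> with \<open>s < \<tau> k\<close> gives the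
  same value. The control \<open>w\<close> takes over beyond all \<open>\<tau> k\<close>, which
  happens if the switching times accumulate.\<close>

definition glue :: "(nat \<Rightarrow> real) \<Rightarrow> (nat \<Rightarrow> real \<Rightarrow> 'a) \<Rightarrow> (real \<Rightarrow> 'a) \<Rightarrow> real \<Rightarrow> 'a" where
  "glue \<tau> U w s = (if \<exists>k. s < \<tau> k then U (LEAST k. s < \<tau> k) s else w s)"

lemma ext_nonneg_const: "ext_nonneg (\<lambda>_. (1, 0)) \<in> borel_measurable lebesgue"
proof -
  have "ext_nonneg (\<lambda>_. (1, 0)) = (\<lambda>_. (1, 0))" by (auto simp: ext_nonneg_def)
  then show ?thesis by simp
qed

lemma glue_eq:
  assumes coh: "\<And>k s. 0 \<le> s \<Longrightarrow> s < \<tau> k \<Longrightarrow> U (Suc k) s = U k s" and "mono \<tau>" and "0 \<le> s" "s < \<tau> k"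
  shows "glue \<tau> U w s = U k s"
proof -
  let ?n = "LEAST k. s < \<tau> k"
  have n: "s < \<tau> ?n" by (rule LeastI) (rule assms)
  have "?n \<le> k" by (rule Least_le) (rule assms)
  then have "U k s = U ?n s"
  proof (induction k rule: dec_induct)
    case (step m)
    have "s < \<tau> m" using n monoD[OF \<open>mono \<tau>\<close> step.hyps(1)] by linarith
    then show ?case using coh step \<open>0 \<le> s\<close> by simp
  qed simp
  then show ?thesis using assms by (auto simp: glue_def)
qed

text \<open>At each time the truncations of the \<open>U k\<close> to \<open>{..<\<tau> k}\<close>,
  completed by \<open>w\<close>, are eventually constant in \<open>k\<close>, and measurability
  passes to the pointwise limit.\<close>

lemma control_signal_glue:
  assumes "\<And>k s. 0 \<le> s \<Longrightarrow> s < \<tau> k \<Longrightarrow> U (Suc k) s = U k s" "mono \<tau>"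
    "\<And>k. control_signal (U k)" "ext_nonneg w \<in> borel_measurable lebesgue"
    "\<And>s. (\<And>k. \<tau> k \<le> s) \<Longrightarrow> 0 \<le> s \<Longrightarrow> norm (w s) = 1"
  shows "control_signal (glue \<tau> U w)"
  unfolding control_signal_iff
proof (intro conjI allI impI)
  show "ext_nonneg (glue \<tau> U w) \<in> borel_measurable lebesgue"
  proof (rule borel_measurable_eventually_const)
    show "(\<lambda>s. if s \<in> {..<\<tau> k} then ext_nonneg (U k) s else ext_nonneg w s) \<in> borel_measurable lebesgue" for k
      using assms by (intro measurable_If_set) (auto simp: control_signal_iff)
    show "\<exists>n. \<forall>k\<ge>n. (if s \<in> {..<\<tau> k} then ext_nonneg (U k) s else ext_nonneg w s) = ext_nonneg (glue \<tau> U w) s" for s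
    proof (cases "\<exists>k. s < \<tau> k")
      case True
      then obtain n where n: "s < \<tau> n" by blast
      have "s < \<tau> k" if "k \<ge> n" for k
        using n monoD[OF \<open>mono \<tau>\<close> that] by linarith
      moreover have "glue \<tau> U w s = U k s" if "k \<ge> n" "0 \<le> s" for k
        by (rule glue_eq) (use assms(1,2) calculation that in auto)
      ultimately show ?thesis
        by (intro exI[of _ n]) (simp add: ext_nonneg_def)
    next
      case False
      then show ?thesis by (auto simp: ext_nonneg_def glue_def)
    qed
  qed
  show "norm (glue \<tau> U w s) = 1" if "0 \<le> s" for s
    using assms that by (cases "\<exists>k. s < \<tau> k") (auto simp: glue_def control_signal_def not_less)
qed

lemma trajectory_glue:
  assumes "\<And>k s. 0 \<le> s \<Longrightarrow> s < \<tau> k \<Longrightarrow> U (Suc k) s = U k s" "mono \<tau>" "t \<le> \<tau> k"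
  shows "trajectory v x (glue \<tau> U w) t = trajectory v x (U k) t"
  by (rule trajectory_cong) (use assms in \<open>auto intro: glue_eq\<close>)

lemma admissible_controlD:
  "admissible_control \<Omega> v x u \<Longrightarrow> control_signal u"
  "admissible_control \<Omega> v x u \<Longrightarrow> 0 \<le> t \<Longrightarrow> trajectory v x u t \<in> \<Omega>"
  by (auto simp: admissible_control_def)

lemma admissible_splice:
  assumes "control_signal u" "\<And>t. 0 \<le> t \<Longrightarrow> t \<le> a \<Longrightarrow> trajectory v x u t \<in> \<Omega>" "0 \<le> a"
    "admissible_control \<Omega> v (trajectory v x u a) w"
  shows "admissible_control \<Omega> v x (switch a u w)"
  unfolding admissible_control_def
proof (intro conjI allI impI)
  show "control_signal (switch a u w)"
    using assms(1,3) admissible_controlD(1)[OF assms(4)] by (intro control_signal_splice)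
  show "trajectory v x (switch a u w) t \<in> \<Omega>" if "0 \<le> t" for t
    using assms that
    by (cases "t \<le> a") (auto simp: trajectory_splice_le trajectory_splice_ge admissible_control_def)
qed

lemma admissible_shift:
  assumes "admissible_control \<Omega> v x u" "0 \<le> a"
  shows "admissible_control \<Omega> v (trajectory v x u a) (\<lambda>r. u (r + a))"
  using assms
  by (auto simp: admissible_control_def control_signal_shift simp flip: trajectory_shift)

lemma admissible_glue_unbounded:
  assumes "\<And>k s. 0 \<le> s \<Longrightarrow> s < \<tau> k \<Longrightarrow> U (Suc k) s = U k s" "mono \<tau>"
    "\<And>k. admissible_control \<Omega> v x (U k)" "\<And>s. \<exists>k. s < \<tau> k"
  shows "admissible_control \<Omega> v x (glue \<tau> U w)"
proof -
  have eq: "glue \<tau> U w = glue \<tau> U (\<lambda>_. (1, 0))"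
    using assms(4) by (auto simp: glue_def)
  have "control_signal (glue \<tau> U (\<lambda>_. (1, 0)))"
    using assms by (intro control_signal_glue admissible_controlD) (auto simp: ext_nonneg_const)
  moreover have "trajectory v x (glue \<tau> U w) t \<in> \<Omega>" if "0 \<le> t" for t
  proof -
    obtain k where "t < \<tau> k" using assms by blast
    then show ?thesis
      using trajectory_glue[of \<tau> U t k] assms that admissible_controlD by (auto simp: less_imp_le)
  qed
  ultimately show ?thesis by (auto simp: admissible_control_def eq)
qed

lemma trajectory_tendsto:
  assumes "control_signal u" "0 \<le> v" "\<tau> \<longlonglongrightarrow> T" "\<And>k. 0 \<le> \<tau> k"
  shows "(\<lambda>k. trajectory v x u (\<tau> k)) \<longlonglongrightarrow> trajectory v x u T"
proof (rule continuous_on_tendsto_compose[OF trajectory_continuous[OF assms(1,2)] assms(3)])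
  show "T \<in> {0..}" using assms by (auto intro: LIMSEQ_le_const)
qed (use assms in auto)

text \<open>The glued path is Lipschitz, so its value at the accumulation time \<open>T\<close> is
  the limit of its values at the switching times; from there \<open>w\<close> continues.\<close>

lemma admissible_glue_bounded:
  assumes "\<And>k s. 0 \<le> s \<Longrightarrow> s < \<tau> k \<Longrightarrow> U (Suc k) s = U k s" "strict_mono \<tau>"
    "\<And>k. admissible_control \<Omega> v x (U k)" "\<tau> \<longlonglongrightarrow> T" "\<tau> 0 = 0" "0 \<le> v"
    "(\<lambda>k. trajectory v x (U k) (\<tau> k)) \<longlonglongrightarrow> y" "admissible_control \<Omega> v y w"
  defines "u \<equiv> glue \<tau> U (\<lambda>s. w (s - T))"
  shows "admissible_control \<Omega> v x u \<and> trajectory v x u T = y"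
proof -
  have mono: "mono \<tau>" using assms(2) by (rule strict_mono_mono)
  have nonneg: "0 \<le> \<tau> k" for k using monoD[OF mono, of 0 k] assms(5) by simp
  have less: "\<tau> k < T" for k
    using incseq_le[OF mono assms(4), of "Suc k"] strict_monoD[OF assms(2), of k "Suc k"] by simp
  have T: "0 < T" using less[of 0] assms(5) by simp
  \<comment> \<open>Seen from \<open>T\<close>, the glued control is a single switch, so that the
    splicing lemmas apply.\<close>
  have u: "u = switch T (glue \<tau> U (\<lambda>_. (1, 0))) w"
  proof
    fix s
    have "\<exists>k. s < \<tau> k" if "s < T"
      using order_tendstoD(1)[OF assms(4) that] by (auto dest: eventually_happens)
    moreover have "\<not> s < \<tau> k" if "T \<le> s" for k using less[of k] that by simp
    ultimately show "u s = switch T (glue \<tau> U (\<lambda>_. (1, 0))) w s"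
      by (auto simp: u_def switch_def glue_def)
  qed
  let ?g = "glue \<tau> U (\<lambda>_. (1, 0))"
  have g: "control_signal ?g"
    using assms(1,3) mono by (intro control_signal_glue admissible_controlD) (auto simp: ext_nonneg_const)
  have "(\<lambda>k. trajectory v x ?g (\<tau> k)) \<longlonglongrightarrow> trajectory v x ?g T"
    using g assms(4,6) nonneg by (intro trajectory_tendsto)
  moreover have "(\<lambda>k. trajectory v x ?g (\<tau> k)) = (\<lambda>k. trajectory v x (U k) (\<tau> k))"
    by (intro ext trajectory_glue assms(1) mono order_refl)
  ultimately have gT: "trajectory v x ?g T = y"
    using LIMSEQ_unique assms(7) by metis
  have y: "y \<in> \<Omega>" using admissible_controlD(2)[OF assms(8), of 0] by simp
  have "trajectory v x ?g t \<in> \<Omega>" if "0 \<le> t" "t \<le> T" for t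
  proof (cases "t = T")
    case False
    then have "eventually (\<lambda>k. t < \<tau> k) sequentially"
      using order_tendstoD(1)[OF assms(4)] that by simp
    then obtain k where "t < \<tau> k" by (auto simp: eventually_sequentially)
    then show ?thesis
      using trajectory_glue[of \<tau> U, OF assms(1) mono, of t k] assms(3) that by (auto simp: admissible_control_def)
  qed (use gT y in simp)
  then have "admissible_control \<Omega> v x u"
    unfolding u using g gT assms(8) T by (intro admissible_splice) auto
  then show ?thesis
    using gT by (simp add: u trajectory_splice_le)
qed

section \<open>Existence of admissible controls\<close>

lemma trajectory_const_in:
  assumes "convex \<Omega>" "x \<in> \<Omega>" "x + r *\<^sub>R d \<in> \<Omega>" "0 \<le> t" "0 \<le> v" "v * t \<le> r"
  shows "trajectory v x (\<lambda>_. d) t \<in> \<Omega>"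
proof (cases "r = 0")
  case True
  then have eq: "v * t = 0" using assms by (metis mult_nonneg_nonneg order_antisym)
  show ?thesis unfolding trajectory_const[OF assms(4)] eq using assms by simp
next
  case False
  then have r: "r > 0" using assms by (metis mult_nonneg_nonneg order_trans less_eq_real_def)
  define q where "q = v * t / r"
  have q: "0 \<le> q" "q \<le> 1" "v * t = q * r" using r assms by (auto simp: q_def)
  have "(1 - q) *\<^sub>R x + q *\<^sub>R (x + r *\<^sub>R d) \<in> \<Omega>"
    using assms q by (intro convexD_alt) auto
  moreover have "(1 - q) *\<^sub>R x + q *\<^sub>R (x + r *\<^sub>R d) = x + (v * t) *\<^sub>R d"
    using q by (simp add: algebra_simps)
  ultimately show ?thesis using assms by (simp add: trajectory_const)
qed

text \<open>Running out along \<open>d\<close> and back is the substitute for waiting, which unit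
  speed forbids.\<close>

lemma excursion:
  assumes "convex \<Omega>" "x \<in> \<Omega>" "x + r *\<^sub>R d \<in> \<Omega>" "norm d = 1" "0 \<le> h" "0 \<le> v" "v * h \<le> r"
  defines "u \<equiv> switch h (\<lambda>_. d) (\<lambda>_. - d)"
  shows "control_signal u" "trajectory v x u (2 * h) = x"
    "0 \<le> t \<Longrightarrow> t \<le> 2 * h \<Longrightarrow> trajectory v x u t \<in> \<Omega>"
proof -
  show "control_signal u"
    unfolding u_def using assms by (intro control_signal_splice control_signal_const) auto
  have tr: "trajectory v x u t = x + (v * (2 * h - t)) *\<^sub>R d" if "h \<le> t" for t
    unfolding u_def using assms that
    by (subst trajectory_splice_ge) (auto simp: control_signal_const trajectory_const algebra_simps simp flip: scaleR_add_left)
  show "trajectory v x u (2 * h) = x" using tr[of "2 * h"] assms by simp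
  assume t: "0 \<le> t" "t \<le> 2 * h"
  show "trajectory v x u t \<in> \<Omega>"
  proof (cases "t \<le> h")
    case True
    then have "v * t \<le> r" using assms t by (meson mult_left_mono order_trans)
    then have "trajectory v x (\<lambda>_. d) t \<in> \<Omega>"
      using assms t by (intro trajectory_const_in[of \<Omega> x r]) auto
    then show ?thesis using True by (simp add: u_def trajectory_splice_le)
  next
    case False
    have "v * (2 * h - t) \<le> v * h" using False assms by (intro mult_left_mono) auto
    then have "trajectory v x (\<lambda>_. d) (2 * h - t) \<in> \<Omega>"
      using assms t by (intro trajectory_const_in[of \<Omega> x r]) auto
    then show ?thesis using False t by (simp add: tr trajectory_const)
  qed
qed

text \<open>By the triangle inequality one of \<open>c1\<close>, \<open>c2\<close> is at least
  \<open>dist c1 c2 / 2\<close> away from \<open>x\<close>; this gives room for excursions that is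
  uniform in \<open>x\<close>.\<close>

lemma far_direction:
  assumes "convex \<Omega>" "c1 \<in> \<Omega>" "c2 \<in> \<Omega>" "c1 \<noteq> c2" "x \<in> \<Omega>"
  shows "\<exists>d. norm d = 1 \<and> x + (dist c1 c2 / 2) *\<^sub>R d \<in> \<Omega>"
proof -
  obtain c where c: "c \<in> \<Omega>" "dist c1 c2 / 2 \<le> dist x c"
  proof (cases "dist c1 c2 / 2 \<le> dist x c1")
    case False
    then have "dist c1 c2 / 2 \<le> dist x c2"
      using dist_triangle2[of c1 c2 x] by (simp add: dist_commute)
    then show ?thesis using assms that by blast
  qed (use assms in blast)
  define R where "R = dist x c"
  have R: "R > 0" "dist c1 c2 / 2 \<le> R" using c assms by (auto simp: R_def intro: less_le_trans)
  define q where "q = dist c1 c2 / 2 / R"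
  have q: "0 \<le> q" "q \<le> 1" "dist c1 c2 / 2 = q * R" using R by (auto simp: q_def)
  let ?d = "(1 / R) *\<^sub>R (c - x)"
  have "(1 - q) *\<^sub>R x + q *\<^sub>R c \<in> \<Omega>"
    using assms c q by (intro convexD_alt) auto
  moreover have "(1 - q) *\<^sub>R x + q *\<^sub>R c = x + (dist c1 c2 / 2) *\<^sub>R ?d"
    using R q by (simp add: algebra_simps)
  moreover have "norm ?d = 1" using R by (simp add: R_def dist_norm norm_minus_commute)
  ultimately show ?thesis by metis
qed

text \<open>The same excursion is repeated forever.\<close>

lemma ex_admissible_control:
  assumes "convex \<Omega>" "c1 \<in> \<Omega>" "c2 \<in> \<Omega>" "c1 \<noteq> c2" "x \<in> \<Omega>" "0 < v"
  shows "\<exists>u. admissible_control \<Omega> v x u"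
proof -
  define r where "r = dist c1 c2 / 2"
  have r: "r > 0" using assms by (simp add: r_def)
  obtain d where d: "norm d = 1" "x + r *\<^sub>R d \<in> \<Omega>"
    using far_direction[OF assms(1-5)] by (auto simp: r_def)
  define h where "h = r / v"
  have h: "h > 0" "v * h = r" using r assms by (auto simp: h_def)
  define u0 where "u0 = switch h (\<lambda>_. d) (\<lambda>_. - d)"
  note u0 = excursion[OF assms(1,5) d(2,1), of h v, folded u0_def]
  \<comment> \<open>\<open>U k\<close> makes \<open>k + 1\<close> excursions and then runs on,
    possibly out of \<Omega>; it is only used up to \<open>\<tau> k\<close>, hence the
    \<open>Suc k\<close> there.\<close>
  define U where "U k = rec_nat u0 (\<lambda>_. switch (2 * h) u0) k" for k
  have U_simps: "U 0 = u0" "\<And>k. U (Suc k) = switch (2 * h) u0 (U k)" by (auto simp: U_def)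
  define \<tau> where "\<tau> k = 2 * h * real (Suc k)" for k
  have cs: "control_signal (U k)" for k
    by (induction k) (use u0 h assms in \<open>auto simp: U_simps intro!: control_signal_splice\<close>)
  have coh: "U (Suc k) s = U k s" if "0 \<le> s" "s < \<tau> k" for k s
    using that
  proof (induction k arbitrary: s)
    case 0
    then show ?case by (simp add: U_simps \<tau>_def switch_def)
  next
    case (Suc k)
    then have "U (Suc k) (s - 2 * h) = U k (s - 2 * h)" if "s \<ge> 2 * h"
      using that by (intro Suc.IH) (auto simp: \<tau>_def algebra_simps)
    then show ?case unfolding U_simps(2) by (auto simp: switch_def)
  qed
  have tr: "trajectory v x (U k) s \<in> \<Omega>" if "0 \<le> s" "s \<le> \<tau> k" for k s
    using that
  proof (induction k arbitrary: s)
    case 0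
    then show ?case using u0(3)[of s] h assms by (simp add: U_simps \<tau>_def)
  next
    case (Suc k)
    show ?case
    proof (cases "s \<le> 2 * h")
      case True
      then show ?thesis using u0(3)[of s] h assms Suc by (simp add: U_simps trajectory_splice_le)
    next
      case False
      then have "trajectory v x (U k) (s - 2 * h) \<in> \<Omega>"
        using Suc by (intro Suc.IH) (auto simp: \<tau>_def algebra_simps)
      then show ?thesis
        using False u0(1,2) h assms cs by (simp add: U_simps trajectory_splice_ge)
    qed
  qed
  have mono: "mono \<tau>" using h by (auto simp: \<tau>_def mono_def)
  have unb: "\<exists>k. s < \<tau> k" for s
  proof -
    obtain k where "s / (2 * h) < real k" using reals_Archimedean2 by blast
    then have "s < \<tau> k" using h by (auto simp: \<tau>_def field_simps)
    then show ?thesis by blast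
  qed
  let ?g = "glue \<tau> U (\<lambda>_. (1, 0))"
  have "control_signal ?g"
    by (rule control_signal_glue) (use coh mono cs in \<open>auto simp: ext_nonneg_const\<close>)
  moreover have "trajectory v x ?g t \<in> \<Omega>" if t: "0 \<le> t" for t
  proof -
    obtain k where k: "t < \<tau> k" using unb by blast
    have "trajectory v x ?g t = trajectory v x (U k) t"
      by (rule trajectory_glue) (use coh mono k in auto)
    then show ?thesis using tr t k by simp
  qed
  ultimately show ?thesis by (auto simp: admissible_control_def)
qed

text \<open>The surplus time is spent on an excursion before the straight run. The bound
  \<open>v * t \<le> dist c1 c2\<close> ensures that half of the surplus fits into the room given by
  \<open>far_direction\<close>.\<close>

lemma ex_admissible_control_to:
  assumes "convex \<Omega>" "c1 \<in> \<Omega>" "c2 \<in> \<Omega>" "c1 \<noteq> c2" "x \<in> \<Omega>" "y \<in> \<Omega>" "0 < v"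
    "dist x y \<le> v * t" "v * t \<le> dist c1 c2"
  shows "\<exists>u. admissible_control \<Omega> v x u \<and> trajectory v x u t = y"
proof -
  define r where "r = dist c1 c2 / 2"
  obtain d where d: "norm d = 1" "x + r *\<^sub>R d \<in> \<Omega>"
    using far_direction[OF assms(1-5)] by (auto simp: r_def)
  obtain w where w: "admissible_control \<Omega> v y w"
    using ex_admissible_control assms by blast
  define s where "s = dist x y / v"
  have s: "0 \<le> s" "s \<le> t" "v * s = dist x y" using assms by (auto simp: s_def field_simps)
  obtain e where e: "norm e = 1" "x + dist x y *\<^sub>R e = y"
  proof (cases "x = y")
    case False
    then show ?thesis
      by (intro that[of "(1 / dist x y) *\<^sub>R (y - x)"]) (auto simp: dist_norm norm_minus_commute)
  qed (use that d in auto)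
  define h where "h = (t - s) / 2"
  have h: "0 \<le> h" "v * h \<le> r" "2 * h + s = t"
  proof -
    have "v * h = (v * t - dist x y) / 2" using s(3) by (simp add: h_def algebra_simps)
    then show "v * h \<le> r" using assms(9) zero_le_dist[of x y] unfolding r_def by argo
  qed (use s in \<open>auto simp: h_def field_simps\<close>)
  define u0 where "u0 = switch h (\<lambda>_. d) (\<lambda>_. - d)"
  note u0 = excursion[OF assms(1,5) d(2,1), of h v, folded u0_def]
  define u1 where "u1 = switch s (\<lambda>_. e) w"
  have u1: "admissible_control \<Omega> v x u1"
    unfolding u1_def
  proof (rule admissible_splice)
    show "trajectory v x (\<lambda>_. e) t' \<in> \<Omega>" if "0 \<le> t'" "t' \<le> s" for t'
      using assms that e s by (intro trajectory_const_in[of \<Omega> x "dist x y"])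
       (auto intro: order_trans[OF mult_left_mono])
    show "admissible_control \<Omega> v (trajectory v x (\<lambda>_. e) s) w"
      using w e s by (simp add: trajectory_const)
  qed (use e s in \<open>auto simp: control_signal_const\<close>)
  have u1s: "trajectory v x u1 s = y"
    using e s by (simp add: u1_def trajectory_splice_le trajectory_const)
  let ?u = "switch (2 * h) u0 u1"
  have "admissible_control \<Omega> v x ?u"
    by (rule admissible_splice) (use u0 h assms u1 in auto)
  moreover have "trajectory v x ?u t = y"
    using u0 h assms u1 u1s s by (subst trajectory_splice_ge) (auto intro: admissible_controlD)
  ultimately show ?thesis by blast
qed

section \<open>Open-loop steps of the game\<close>

locale reach_avoid =
  fixes \<Omega> :: "point set" and l vP vE :: real
  assumes dom: "reach_avoid_domain \<Omega> l" and vE_pos: "0 < vE" and vE_less: "vE < vP"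
begin

abbreviation "play \<equiv> play_region \<Omega>"
abbreviation "tline \<equiv> target_line l"
abbreviation "admP \<equiv> admissible_control \<Omega> vP"
abbreviation "admE \<equiv> admissible_control \<Omega> vE"
abbreviation "fplay \<equiv> feedback_play \<Omega> vP vE"

section \<open>Geometry of the domain\<close>

lemma vP_pos: "0 < vP" using vE_pos vE_less by simp

lemma l_pos: "0 < l" and convex_domain: "convex \<Omega>" and bounded_domain: "bounded \<Omega>"
  and interior_domain: "interior \<Omega> \<noteq> {}"
  using dom by (auto simp: reach_avoid_domain_def)

lemma target_line_iff: "p \<in> tline \<longleftrightarrow> snd p = 0 \<and> 0 \<le> fst p \<and> fst p \<le> l"
proof
  assume "p \<in> tline"
  then show "snd p = 0 \<and> 0 \<le> fst p \<and> fst p \<le> l"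
    using l_pos by (auto simp: target_line_def in_segment mult_left_le_one_le)
next
  assume p: "snd p = 0 \<and> 0 \<le> fst p \<and> fst p \<le> l"
  then have "p = (1 - fst p / l) *\<^sub>R (0, 0) + (fst p / l) *\<^sub>R (l, 0)"
    using l_pos by (simp add: prod_eq_iff)
  then show "p \<in> tline"
    using p l_pos unfolding target_line_def in_segment by (intro exI[of _ "fst p / l"]) (simp add: zero_prod_def)
qed

lemma axis_iff: "z \<in> \<Omega> \<and> snd z = 0 \<longleftrightarrow> z \<in> tline"
  using dom by (auto simp: reach_avoid_domain_def)

lemma target_line_subset: "p \<in> tline \<Longrightarrow> p \<in> \<Omega>"
  using axis_iff by blast

lemma compact_target_line: "compact tline" and target_line_nonempty: "tline \<noteq> {}"
  by (auto simp: target_line_def)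

lemma play_iff: "z \<in> play \<longleftrightarrow> z \<in> \<Omega> \<and> snd z < 0"
  by (auto simp: play_region_def target_region_def)

lemma play_domain: "z \<in> play \<Longrightarrow> z \<in> \<Omega>"
  by (simp add: play_iff)

lemma target_region_iff: "z \<in> target_region \<Omega> \<longleftrightarrow> z \<in> \<Omega> \<and> 0 \<le> snd z"
  by (auto simp: target_region_def)

lemma ends_in_domain: "(0, 0) \<in> \<Omega>" "(l, 0) \<in> \<Omega>" "(0, 0) \<noteq> (l, 0::real)" "dist (0, 0) (l, 0::real) = l"
  using l_pos by (auto intro!: target_line_subset simp: target_line_iff dist_Pair_Pair)

lemma ex_admissible: "x \<in> \<Omega> \<Longrightarrow> 0 < v \<Longrightarrow> \<exists>u. admissible_control \<Omega> v x u"
  using ex_admissible_control[OF convex_domain ends_in_domain(1-3)] by blast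

lemma ex_admissible_to:
  "x \<in> \<Omega> \<Longrightarrow> y \<in> \<Omega> \<Longrightarrow> 0 < v \<Longrightarrow> dist x y \<le> v * t \<Longrightarrow> v * t \<le> l \<Longrightarrow>
    \<exists>u. admissible_control \<Omega> v x u \<and> trajectory v x u t = y"
  using ex_admissible_control_to[OF convex_domain ends_in_domain(1-3), unfolded ends_in_domain(4)] by blast

text \<open>By the intermediate value theorem a path leaving the play region crosses the axis, which
  meets \<Omega> in the target line only.\<close>

lemma stays_in_play:
  fixes X :: "real \<Rightarrow> point" and s t :: real
  assumes "continuous_on {0..} X" "\<And>s. 0 \<le> s \<Longrightarrow> X s \<in> \<Omega>" "X 0 \<in> play"
    "\<And>s. 0 \<le> s \<Longrightarrow> s \<le> t \<Longrightarrow> X s \<notin> tline" "0 \<le> s" "s \<le> t"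
  shows "X s \<in> play"
proof (rule ccontr)
  assume "X s \<notin> play"
  then have "0 \<le> snd (X s)" using assms by (auto simp: play_iff)
  moreover have "snd (X 0) \<le> 0" using assms by (simp add: play_iff)
  moreover have "continuous_on {0..s} (\<lambda>r. snd (X r))"
    using assms by (intro continuous_intros) (auto intro: continuous_on_subset)
  ultimately obtain r where "0 \<le> r" "r \<le> s" "snd (X r) = 0"
    using IVT'[of "\<lambda>r. snd (X r)" 0 0 s] \<open>0 \<le> s\<close> by auto
  then have "X r \<in> tline" using assms(2)[of r] axis_iff[of "X r"] by blast
  then show False using assms \<open>0 \<le> r\<close> \<open>r \<le> s\<close> by auto
qed

lemma trajectory_in_play:
  assumes "admE e u" "e \<in> play" "\<And>p. p \<in> tline \<Longrightarrow> vE * t < dist e p" "0 \<le> s" "s \<le> t"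
  shows "trajectory vE e u s \<in> play"
proof (rule stays_in_play[where X = "trajectory vE e u" and t = t])
  show "trajectory vE e u r \<notin> tline" if "0 \<le> r" "r \<le> t" for r
  proof
    assume "trajectory vE e u r \<in> tline"
    then have "vE * t < dist e (trajectory vE e u r)" by (rule assms)
    also have "\<dots> \<le> vE * r"
      using trajectory_dist[of u vE 0 r e] assms vE_pos that by (simp add: admissible_control_def)
    also have "\<dots> \<le> vE * t" using that vE_pos by simp
    finally show False by simp
  qed
qed (use assms vE_pos in \<open>auto simp: admissible_control_def intro: trajectory_continuous\<close>)

lemma trajectory_dist0:
  assumes "admissible_control \<Omega> v x u" "0 \<le> v" "0 \<le> t"
  shows "dist x (trajectory v x u t) \<le> v * t"
  using trajectory_dist[of u v 0 t x] assms by (simp add: admissible_control_def)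

text \<open>During the first leg the pursuers move to \<open>Y\<close> without looking at the
  evader, who is too far from the target line to arrive. At time \<open>t\<close> a strategy that
  wins from the state reached takes over.\<close>

lemma pursuit_step:
  assumes e: "e \<in> play" and t: "0 < t" "vP * t \<le> l"
    and XY: "\<And>i. i \<in> K \<Longrightarrow> X i \<in> \<Omega>" "\<And>i. i \<in> K \<Longrightarrow> Y i \<in> \<Omega>" "\<And>i. i \<in> K \<Longrightarrow> dist (X i) (Y i) \<le> vP * t"
    and far: "\<And>p. p \<in> tline \<Longrightarrow> vE * t < dist e p"
    and win: "\<And>e'. e' \<in> play \<Longrightarrow> dist e e' \<le> vE * t \<Longrightarrow> e' \<in> pursuit_winning_region \<Omega> vP vE K Y"
  shows "e \<in> pursuit_winning_region \<Omega> vP vE K X"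
proof -
  have "\<forall>i\<in>K. \<exists>u. admP (X i) u \<and> trajectory vP (X i) u t = Y i"
    using XY t vP_pos by (intro ballI ex_admissible_to) auto
  then obtain w where w: "\<And>i. i \<in> K \<Longrightarrow> admP (X i) (w i)"
      "\<And>i. i \<in> K \<Longrightarrow> trajectory vP (X i) (w i) t = Y i"
    by metis
  have "\<forall>e'. \<exists>\<gamma>. e' \<in> play \<and> dist e e' \<le> vE * t \<longrightarrow> pursuit_strategy \<Omega> vP vE K Y e' \<gamma> \<and>
        (\<forall>uE. admE e' uE \<longrightarrow>
           pursuers_win \<Omega> K (\<lambda>i. trajectory vP (Y i) (\<gamma> uE i)) (trajectory vE e' uE))"
    using win by (auto simp: pursuit_winning_region_def)
  then obtain G where "\<forall>e'. e' \<in> play \<and> dist e e' \<le> vE * t \<longrightarrow> pursuit_strategy \<Omega> vP vE K Y e' (G e') \<and>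
        (\<forall>uE. admE e' uE \<longrightarrow>
           pursuers_win \<Omega> K (\<lambda>i. trajectory vP (Y i) (G e' uE i)) (trajectory vE e' uE))"
    by metis
  then have G: "\<And>e'. e' \<in> play \<Longrightarrow> dist e e' \<le> vE * t \<Longrightarrow> pursuit_strategy \<Omega> vP vE K Y e' (G e')"
      "\<And>e' uE. e' \<in> play \<Longrightarrow> dist e e' \<le> vE * t \<Longrightarrow> admE e' uE \<Longrightarrow>
           pursuers_win \<Omega> K (\<lambda>i. trajectory vP (Y i) (G e' uE i)) (trajectory vE e' uE)"
    by auto
  \<comment> \<open>The strategy \<open>G e'\<close> is selected by the evader's position at time
    \<open>t\<close> alone, and controls that agree up to a later time lead to the same position;
    this keeps \<gamma> non-anticipative.\<close>
  define \<gamma> where "\<gamma> u i = switch t (w i) (G (trajectory vE e u t) (\<lambda>r. u (r + t)) i)" for u i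
  have E: "trajectory vE e u t \<in> play" "dist e (trajectory vE e u t) \<le> vE * t"
    "admE (trajectory vE e u t) (\<lambda>r. u (r + t))"
    if "admE e u" for u
    using that t vE_pos e far by (auto intro!: trajectory_in_play[where t = t] trajectory_dist0 admissible_shift)
  have adm: "admP (Y i) (G (trajectory vE e u t) (\<lambda>r. u (r + t)) i)"
    if "admE e u" "i \<in> K" for u i
    using G(1)[OF E(1,2)] E(3) that unfolding pursuit_strategy_def by blast
  have "pursuit_strategy \<Omega> vP vE K X e \<gamma>"
    unfolding pursuit_strategy_def
  proof (intro conjI allI impI ballI)
    fix u i assume "admE e u" "i \<in> K"
    then show "admP (X i) (\<gamma> u i)"
      unfolding \<gamma>_def using w t adm
      by (intro admissible_splice) (auto dest: admissible_controlD)
  next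
    fix u u' r i s
    assume u: "admE e u" "admE e u'"
      and eq: "\<forall>s\<in>{0..r}. u s = u' s" and i: "i \<in> K" and s: "s \<in> {0..r}"
    show "\<gamma> u i s = \<gamma> u' i s"
    proof (cases "s < t")
      case False
      have tr: "trajectory vE e u t = trajectory vE e u' t"
        by (rule trajectory_cong) (use eq s False in auto)
      have "\<forall>q\<in>{0..r - t}. u (q + t) = u' (q + t)"
        using eq t by auto
      then have "G (trajectory vE e u t) (\<lambda>r. u (r + t)) i (s - t) = G (trajectory vE e u t) (\<lambda>r. u' (r + t)) i (s - t)"
        using conjunct2[OF G(1)[OF E(1,2)[OF u(1)], unfolded pursuit_strategy_def], rule_format,
            of "\<lambda>r. u (r + t)" "\<lambda>r. u' (r + t)" "r - t" i "s - t"]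
          E(3)[OF u(1)] E(3)[OF u(2)] i s False tr by auto
      then show ?thesis using False tr by (simp add: \<gamma>_def switch_def)
    qed (simp add: \<gamma>_def switch_def)
  qed
  moreover have "pursuers_win \<Omega> K (\<lambda>i. trajectory vP (X i) (\<gamma> u i)) (trajectory vE e u)"
    if u: "admE e u" for u
  proof -
    obtain r i where r: "r \<ge> 0" "i \<in> K"
      "trajectory vP (Y i) (G (trajectory vE e u t) (\<lambda>r. u (r + t)) i) r
        = trajectory vE (trajectory vE e u t) (\<lambda>r. u (r + t)) r"
      "\<And>s. s \<in> {0..r} \<Longrightarrow> trajectory vE (trajectory vE e u t) (\<lambda>r. u (r + t)) s \<in> play"
      using G(2)[OF E[OF u]] unfolding pursuers_win_def by blast
    have cs: "control_signal u" using u by (rule admissible_controlD)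
    have "trajectory vP (X i) (\<gamma> u i) (r + t) = trajectory vE e u (r + t)"
      unfolding \<gamma>_def using r t w(2) cs admissible_controlD(1)[OF w(1)] admissible_controlD(1)[OF adm[OF u]]
      by (subst trajectory_splice_ge) (auto simp: trajectory_shift)
    moreover have "trajectory vE e u s \<in> play" if s: "s \<in> {0..r + t}" for s
    proof (cases "s \<le> t")
      case True
      then show ?thesis using trajectory_in_play[OF u e far] s by auto
    next
      case False
      then have "trajectory vE e u ((s - t) + t) \<in> play"
        using r(4)[of "s - t"] s t cs by (subst trajectory_shift) auto
      then show ?thesis by simp
    qed
    ultimately show ?thesis
      using r t unfolding pursuers_win_def by (intro exI[of _ "r + t"]) auto
  qed
  ultimately show ?thesis using e by (auto simp: pursuit_winning_region_def)
qed

text \<open>One play against \<beta> that the evader fails to win refutes \<beta>. Since \<beta>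
  sees only the state, the same \<beta> is in force when the game is restarted from a later
  state.\<close>

definition holds_out :: "nat set \<Rightarrow> ((nat \<Rightarrow> point) \<Rightarrow> point \<Rightarrow> point) \<Rightarrow> (nat \<Rightarrow> point) \<Rightarrow> point \<Rightarrow> bool" where
  "holds_out K \<beta> X e \<longleftrightarrow> (\<exists>uP uE. fplay K X e \<beta> uP uE \<and>
     \<not> evader_wins \<Omega> K (\<lambda>i. trajectory vP (X i) (uP i)) (trajectory vE e uE))"

lemma feedback_play_iff:
  "fplay K X e \<beta> uP uE \<longleftrightarrow>
     (\<forall>i\<in>K. admP (X i) (uP i)) \<and> admE e uE \<and>
     negligible {t. 0 \<le> t \<and> undecided \<Omega> K (\<lambda>i. trajectory vP (X i) (uP i)) (trajectory vE e uE) t \<and>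
        uE t \<noteq> \<beta> (\<lambda>i\<in>K. trajectory vP (X i) (uP i) t) (trajectory vE e uE t)}"
  by (simp add: feedback_play_def AE_lebesgue_on_atLeast_iff)

lemma feedback_play_cong:
  assumes "\<And>i. i \<in> K \<Longrightarrow> X i = X' i"
  shows "fplay K X e \<beta> uP uE \<longleftrightarrow> fplay K X' e \<beta> uP uE"
proof -
  have "(\<lambda>i\<in>K. trajectory vP (X i) (uP i) t) = (\<lambda>i\<in>K. trajectory vP (X' i) (uP i) t)" for t
    using assms by (auto simp: restrict_def)
  then show ?thesis
    using assms by (simp add: feedback_play_iff undecided_def)
qed

lemma ex_feedback_play:
  assumes "evader_feedback \<Omega> vP vE K \<beta>" "\<And>i. i \<in> K \<Longrightarrow> admP (X i) (uP i)" "e \<in> play"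
  shows "\<exists>uE. fplay K X e \<beta> uP uE"
proof -
  have "X i \<in> \<Omega>" if "i \<in> K" for i
    using admissible_controlD(2)[OF assms(2)[OF that], of 0] by simp
  then have "restrict X K \<in> K \<rightarrow>\<^sub>E \<Omega>"
    by auto
  then have "\<exists>uE. fplay K (restrict X K) e \<beta> uP uE"
    using assms unfolding evader_feedback_def by simp
  then show ?thesis
    by (subst feedback_play_cong[where X' = "restrict X K"]) auto
qed

text \<open>A spliced play that is still undecided at \<open>s\<close> was undecided in the first
  piece, or in the restarted game at \<open>s - t\<close>. So the exceptional set lies in the union
  of the first exceptional set and a translate of the second.\<close>

lemma feedback_play_splice:
  assumes fp: "fplay K X e \<beta> uP uE" and t: "0 \<le> t"
    and fp': "fplay K (\<lambda>i. trajectory vP (X i) (uP i) t) (trajectory vE e uE t) \<beta> wP wE"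
  shows "fplay K X e \<beta> (\<lambda>i. switch t (uP i) (wP i)) (switch t uE wE)"
proof -
  have cs: "\<And>i. i \<in> K \<Longrightarrow> control_signal (uP i)" "\<And>i. i \<in> K \<Longrightarrow> control_signal (wP i)"
    "control_signal uE" "control_signal wE"
    using fp fp' by (auto simp: feedback_play_iff dest: admissible_controlD)
  let ?XP = "\<lambda>i. trajectory vP (X i) (uP i)" and ?XE = "trajectory vE e uE"
  let ?YP = "\<lambda>i. trajectory vP (X i) (switch t (uP i) (wP i))" and ?YE = "trajectory vE e (switch t uE wE)"
  let ?ZP = "\<lambda>i. trajectory vP (?XP i t) (wP i)" and ?ZE = "trajectory vE (?XE t) wE"
  let ?A = "{s. 0 \<le> s \<and> undecided \<Omega> K ?XP ?XE s \<and> uE s \<noteq> \<beta> (\<lambda>i\<in>K. ?XP i s) (?XE s)}"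
  let ?B = "{s. 0 \<le> s \<and> undecided \<Omega> K ?ZP ?ZE s \<and> wE s \<noteq> \<beta> (\<lambda>i\<in>K. ?ZP i s) (?ZE s)}"
  have neg: "negligible (?A \<union> (+) t ` ?B)"
    using fp fp' by (intro negligible_Un negligible_translation) (auto simp: feedback_play_iff)
  have early: "?YE s = ?XE s" "?YP i s = ?XP i s" if "s \<le> t" for s i
    using that by (simp_all add: trajectory_splice_le)
  have late: "?YE s = ?ZE (s - t)" "i \<in> K \<Longrightarrow> ?YP i s = ?ZP i (s - t)" if "t \<le> s" for s i
    using that t cs by (simp_all add: trajectory_splice_ge)
  have "s \<in> ?A \<union> (+) t ` ?B"
    if s: "0 \<le> s" "undecided \<Omega> K ?YP ?YE s" "switch t uE wE s \<noteq> \<beta> (\<lambda>i\<in>K. ?YP i s) (?YE s)" for s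
  proof (cases "s < t")
    case True
    have "undecided \<Omega> K ?XP ?XE s"
      using s(2) True unfolding undecided_def by (auto simp: early)
    then have "s \<in> ?A" using s True by (simp add: early switch_def)
    then show ?thesis by blast
  next
    case False
    have "undecided \<Omega> K ?ZP ?ZE (s - t)"
      unfolding undecided_def
    proof
      fix r assume "r \<in> {0..s - t}"
      then have r: "r + t \<in> {0..s}" "t \<le> r + t" using t by auto
      then show "?ZE r \<in> play_region \<Omega> \<and> (\<forall>i\<in>K. ?ZP i r \<noteq> ?ZE r)"
        using s(2) late[of "r + t"] unfolding undecided_def by fastforce
    qed
    moreover have "(\<lambda>i\<in>K. ?YP i s) = (\<lambda>i\<in>K. ?ZP i (s - t))"
      using late(2)[of s] False by (auto simp: restrict_def)
    ultimately have "s - t \<in> ?B" using s False late(1)[of s] by (simp add: switch_def)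
    then have "t + (s - t) \<in> (+) t ` ?B" by blast
    then show ?thesis by simp
  qed
  then have "negligible {s. 0 \<le> s \<and> undecided \<Omega> K ?YP ?YE s \<and> switch t uE wE s \<noteq> \<beta> (\<lambda>i\<in>K. ?YP i s) (?YE s)}"
    by (intro negligible_subset[OF neg]) blast
  moreover have "admP (X i) (switch t (uP i) (wP i))" if "i \<in> K" for i
    using fp fp' t that by (intro admissible_splice) (auto simp: feedback_play_iff dest: admissible_controlD)
  moreover have "admE e (switch t uE wE)"
    using fp fp' t by (intro admissible_splice) (auto simp: feedback_play_iff dest: admissible_controlD)
  ultimately show ?thesis by (simp add: feedback_play_iff)
qed

lemma holds_out_splice:
  assumes fp: "fplay K X e \<beta> uP uE" and t: "0 \<le> t"
    and play: "\<And>s. 0 \<le> s \<Longrightarrow> s \<le> t \<Longrightarrow> trajectory vE e uE s \<in> play"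
    and ho: "holds_out K \<beta> (\<lambda>i. trajectory vP (X i) (uP i) t) (trajectory vE e uE t)"
  shows "holds_out K \<beta> X e"
proof -
  let ?XP = "\<lambda>i. trajectory vP (X i) (uP i)" and ?XE = "trajectory vE e uE"
  obtain wP wE where w: "fplay K (\<lambda>i. ?XP i t) (?XE t) \<beta> wP wE"
    "\<not> evader_wins \<Omega> K (\<lambda>i. trajectory vP (?XP i t) (wP i)) (trajectory vE (?XE t) wE)"
    using ho unfolding holds_out_def by blast
  have cs: "\<And>i. i \<in> K \<Longrightarrow> control_signal (uP i)" "\<And>i. i \<in> K \<Longrightarrow> control_signal (wP i)"
    "control_signal uE" "control_signal wE"
    using fp w(1) by (auto simp: feedback_play_iff dest: admissible_controlD)
  let ?YP = "\<lambda>i. trajectory vP (X i) (switch t (uP i) (wP i))" and ?YE = "trajectory vE e (switch t uE wE)"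
  have late: "?YE s = trajectory vE (?XE t) wE (s - t)" "i \<in> K \<Longrightarrow> ?YP i s = trajectory vP (?XP i t) (wP i) (s - t)" if "t \<le> s" for s i
    using that t cs by (simp_all add: trajectory_splice_ge)
  have "\<not> evader_wins \<Omega> K ?YP ?YE"
  proof
    assume "evader_wins \<Omega> K ?YP ?YE"
    then obtain s where s: "0 \<le> s" "?YE s \<in> target_region \<Omega>" "\<And>r i. r \<in> {0..s} \<Longrightarrow> i \<in> K \<Longrightarrow> ?YP i r \<noteq> ?YE r"
      unfolding evader_wins_def by blast
    show False
    proof (cases "s \<le> t")
      case True
      then show False using play[of s] s by (simp add: trajectory_splice_le play_region_def)
    next
      case False
      have "evader_wins \<Omega> K (\<lambda>i. trajectory vP (?XP i t) (wP i)) (trajectory vE (?XE t) wE)"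
        unfolding evader_wins_def
      proof (intro exI[of _ "s - t"] conjI ballI)
        fix r i assume "r \<in> {0..s - t}" "i \<in> K"
        then show "trajectory vP (?XP i t) (wP i) r \<noteq> trajectory vE (?XE t) wE r"
          using s(3)[of "r + t" i] late[of "r + t"] t by auto
      qed (use False s late in auto)
      then show False using w by simp
    qed
  qed
  then show ?thesis
    using feedback_play_splice[OF fp t w(1)] unfolding holds_out_def by blast
qed

text \<open>The counterpart of \<open>pursuit_step\<close>: the open-loop leg is fixed first, and
  implementability of \<beta> provides the evader's reply to it.\<close>

lemma holds_out_step:
  assumes \<beta>: "evader_feedback \<Omega> vP vE K \<beta>"
    and e: "e \<in> play" and t: "0 < t" "vP * t \<le> l"
    and XY: "\<And>i. i \<in> K \<Longrightarrow> X i \<in> \<Omega>" "\<And>i. i \<in> K \<Longrightarrow> Y i \<in> \<Omega>" "\<And>i. i \<in> K \<Longrightarrow> dist (X i) (Y i) \<le> vP * t"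
    and far: "\<And>p. p \<in> tline \<Longrightarrow> vE * t < dist e p"
    and ho: "\<And>e'. e' \<in> play \<Longrightarrow> dist e e' \<le> vE * t \<Longrightarrow> holds_out K \<beta> Y e'"
  shows "holds_out K \<beta> X e"
proof -
  have "\<forall>i\<in>K. \<exists>u. admP (X i) u \<and> trajectory vP (X i) u t = Y i"
    using XY t vP_pos by (intro ballI ex_admissible_to) auto
  then obtain w where w: "\<And>i. i \<in> K \<Longrightarrow> admP (X i) (w i)"
      "\<And>i. i \<in> K \<Longrightarrow> trajectory vP (X i) (w i) t = Y i"
    by metis
  obtain u where u: "fplay K X e \<beta> w u"
    using ex_feedback_play[where X = X and uP = w, OF \<beta> w(1) e] by blast
  then have adm: "admE e u" by (simp add: feedback_play_iff)
  have pl: "trajectory vE e u s \<in> play" if "0 \<le> s" "s \<le> t" for s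
    using trajectory_in_play[OF adm e far] that by blast
  have "holds_out K \<beta> Y (trajectory vE e u t)"
    using ho pl t trajectory_dist0[OF adm, of t] vE_pos by auto
  moreover have "holds_out K \<beta> Y e' = holds_out K \<beta> (\<lambda>i. trajectory vP (X i) (w i) t) e'" for e'
    using w(2) feedback_play_cong[of K Y "\<lambda>i. trajectory vP (X i) (w i) t"]
    by (simp add: holds_out_def evader_wins_def)
  ultimately have "holds_out K \<beta> (\<lambda>i. trajectory vP (X i) (w i) t) (trajectory vE e u t)"
    by blast
  then show ?thesis
    using holds_out_splice[OF u less_imp_le[OF t(1)]] pl by blast
qed

end

section \<open>Parallel guidance\<close>

text \<open>Dominance regions \<open>{p. norm (p - F) \<le> a * norm (p - V)}\<close> are discs (Apollonius).  The new position \<open>Q\<close> of the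
  pursuer keeps the line of sight parallel, so that the discs are homothetic; they are nested because
  the speed of the pursuer is at least \<open>1 / a\<close> times that of the evader.\<close>

lemma apollonius_disc_iff:
  fixes p F V :: "'a::real_inner"
  assumes "0 < a" "a < 1"
  shows "norm (p - F) \<le> a * norm (p - V) \<longleftrightarrow>
    norm (p - (F - (a\<^sup>2 / (1 - a\<^sup>2)) *\<^sub>R (V - F))) \<le> a / (1 - a\<^sup>2) * norm (V - F)"
proof -
  define k where "k = 1 - a\<^sup>2"
  have k: "k > 0" using assms by (simp add: k_def power_less_one_iff abs_square_less_1)
  define q D where "q = p - F" and "D = V - F"
  have pV: "p - V = q - D" and pF: "p - F = q" by (auto simp: q_def D_def)
  have C: "p - (F - (a\<^sup>2 / k) *\<^sub>R (V - F)) = q + (a\<^sup>2 / k) *\<^sub>R D" by (simp add: q_def D_def)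
  have "norm q \<le> a * norm (q - D) \<longleftrightarrow> (norm q)\<^sup>2 \<le> (a * norm (q - D))\<^sup>2"
    using assms by (auto simp: abs_le_square_iff[symmetric])
  also have "\<dots> \<longleftrightarrow> q \<bullet> q \<le> a\<^sup>2 * (q \<bullet> q - 2 * (q \<bullet> D) + D \<bullet> D)"
    by (simp add: power_mult_distrib power2_norm_eq_inner algebra_simps inner_commute)
  also have "\<dots> \<longleftrightarrow> k * (q \<bullet> q) + 2 * a\<^sup>2 * (q \<bullet> D) \<le> a\<^sup>2 * (D \<bullet> D)"
    by (simp add: k_def algebra_simps)
  also have "\<dots> \<longleftrightarrow> (k * (q \<bullet> q) + 2 * a\<^sup>2 * (q \<bullet> D)) * (1 / k) \<le> a\<^sup>2 * (D \<bullet> D) * (1 / k)"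
    using k by (subst mult_le_cancel_right_pos) auto
  also have "(k * (q \<bullet> q) + 2 * a\<^sup>2 * (q \<bullet> D)) * (1 / k) = q \<bullet> q + 2 * (a\<^sup>2 / k) * (q \<bullet> D)"
    using k by (simp add: field_simps)
  \<comment> \<open>The same term is added on both sides to complete the square.\<close>
  also have "q \<bullet> q + 2 * (a\<^sup>2 / k) * (q \<bullet> D) \<le> a\<^sup>2 * (D \<bullet> D) * (1 / k) \<longleftrightarrow>
      q \<bullet> q + 2 * (a\<^sup>2 / k) * (q \<bullet> D) + (a\<^sup>2 / k)\<^sup>2 * (D \<bullet> D) \<le> a\<^sup>2 * (D \<bullet> D) / k + (a\<^sup>2 / k)\<^sup>2 * (D \<bullet> D)"
    by simp
  also have "a\<^sup>2 * (D \<bullet> D) / k + (a\<^sup>2 / k)\<^sup>2 * (D \<bullet> D) = (a / k)\<^sup>2 * (D \<bullet> D)"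
  proof -
    have "a\<^sup>2 / k + (a\<^sup>2 / k)\<^sup>2 = a\<^sup>2 * (k + a\<^sup>2) / k\<^sup>2" using k by (simp add: field_simps power2_eq_square)
    also have "\<dots> = (a / k)\<^sup>2" by (simp add: k_def power_divide)
    finally have E: "a\<^sup>2 / k + (a\<^sup>2 / k)\<^sup>2 = (a / k)\<^sup>2" .
    have "a\<^sup>2 * (D \<bullet> D) / k + (a\<^sup>2 / k)\<^sup>2 * (D \<bullet> D) = (a\<^sup>2 / k + (a\<^sup>2 / k)\<^sup>2) * (D \<bullet> D)"
      by (simp add: algebra_simps)
    then show ?thesis by (simp only: E)
  qed
  also have "q \<bullet> q + 2 * (a\<^sup>2 / k) * (q \<bullet> D) + (a\<^sup>2 / k)\<^sup>2 * (D \<bullet> D) = (norm (q + (a\<^sup>2 / k) *\<^sub>R D))\<^sup>2"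
    unfolding power2_norm_eq_inner by (simp add: algebra_simps inner_commute power2_eq_square)
  also have "(a / k)\<^sup>2 * (D \<bullet> D) = (a / k * norm D)\<^sup>2"
    by (simp add: power_mult_distrib power_divide power2_norm_eq_inner)
  also have "(norm (q + (a\<^sup>2 / k) *\<^sub>R D))\<^sup>2 \<le> (a / k * norm D)\<^sup>2 \<longleftrightarrow> norm (q + (a\<^sup>2 / k) *\<^sub>R D) \<le> a / k * norm D"
    using k assms by (auto simp: abs_le_square_iff[symmetric])
  finally show ?thesis
    unfolding pV pF C[unfolded k_def] k_def D_def .
qed

lemma parallel_guidance:
  fixes F V F' :: "'a::real_inner"
  assumes a: "0 < a" "a < 1" and s: "0 < s" and F': "norm (F' - F) \<le> a * s" and far: "s * (1 + a) < norm (V - F)"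
  obtains Q where "norm (Q - V) \<le> s" "norm (Q - F') \<le> norm (V - F) - (1 - a) * s"
    "\<And>p. norm (p - F') \<le> a * norm (p - Q) \<Longrightarrow> norm (p - F) \<le> a * norm (p - V)"
proof -
  define D d where "D = V - F" and "d = norm D"
  have "0 < s * (1 + a)" using s a by simp
  then have d: "s * (1 + a) < d" "0 < d"
    using far unfolding D_def d_def by linarith+
  define e where "e = (1 / d) *\<^sub>R D"
  have e: "e \<bullet> e = 1" "D = d *\<^sub>R e"
    using d by (auto simp: e_def d_def power2_norm_eq_inner[symmetric] power2_eq_square)
  define g where "g = F' - F"
  define x where "x = g \<bullet> e"
  have x: "x\<^sup>2 \<le> g \<bullet> g"
    using Cauchy_Schwarz_ineq[of g e] e by (simp add: x_def)
  have gs: "g \<bullet> g \<le> (a * s)\<^sup>2"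
    using F' by (simp add: g_def power2_norm_eq_inner[symmetric] power_mono)
  \<comment> \<open>\<open>f = x + r\<close> will be the larger root of
    \<open>(norm (g - f *\<^sub>R e))\<^sup>2 = s\<^sup>2\<close>: the pursuer keeps the direction
    \<open>e\<close> of the line of sight, uses its full speed and shortens the distance by
    \<open>f\<close>.\<close>
  define r where "r = sqrt (s\<^sup>2 - (g \<bullet> g - x\<^sup>2))"
  have as: "0 \<le> a * s" "a * s \<le> s" using a s by (auto simp: mult_left_le_one_le)
  have "(a * s)\<^sup>2 \<le> s\<^sup>2" using as by (intro power_mono) auto
  then have arg: "0 \<le> s\<^sup>2 - (g \<bullet> g - x\<^sup>2)" "x\<^sup>2 \<le> s\<^sup>2 - (g \<bullet> g - x\<^sup>2)"
    using gs x zero_le_power2[of x] by linarith+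
  have r: "r\<^sup>2 = s\<^sup>2 - (g \<bullet> g - x\<^sup>2)" "0 \<le> r" "\<bar>x\<bar> \<le> r"
    using arg real_sqrt_le_mono[OF arg(2)] by (auto simp: r_def)
  define f where "f = x + r"
  define Q where "Q = F' + (d - f) *\<^sub>R e"
  have QV: "Q - V = g - f *\<^sub>R e" by (simp add: Q_def g_def algebra_simps e(2)[unfolded D_def, symmetric] flip: e(2))
  have "(norm (Q - V))\<^sup>2 = g \<bullet> g - 2 * f * x + f\<^sup>2"
    unfolding QV power2_norm_eq_inner by (simp add: algebra_simps inner_commute x_def e power2_eq_square)
  also have "\<dots> = s\<^sup>2"
    using r(1) by (simp add: f_def power2_eq_square algebra_simps)
  finally have QVs: "norm (Q - V) = s" using s by (simp add: power2_eq_iff_nonneg)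
  have fs: "\<bar>f\<bar> \<le> s * (1 + a)" "(1 - a) * s \<le> f"
  proof -
    have "norm (f *\<^sub>R e) = \<bar>f\<bar>" using e by (simp add: norm_eq_sqrt_inner)
    moreover have "f *\<^sub>R e = g - (Q - V)" by (simp add: QV)
    ultimately have 1: "\<bar>f\<bar> = norm (g - (Q - V))" by simp
    show "\<bar>f\<bar> \<le> s * (1 + a)"
      unfolding 1 using norm_triangle_ineq4[of g "Q - V"] F' QVs by (simp add: g_def algebra_simps)
    have "f \<ge> 0" using r by (simp add: f_def)
    then have "f = norm (g - (Q - V))" using 1 by simp
    then show "(1 - a) * s \<le> f"
      using norm_triangle_ineq2[of "Q - V" g] F' QVs by (simp add: g_def algebra_simps norm_minus_commute)
  qed
  have df: "0 \<le> d - f" "norm (Q - F') = d - f"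
    using fs d e by (auto simp: Q_def norm_eq_sqrt_inner)
  show ?thesis
  proof
    show "norm (Q - V) \<le> s" using QVs by simp
    show "norm (Q - F') \<le> norm (V - F) - (1 - a) * s" using df fs by (simp add: d_def D_def)
    fix p assume p: "norm (p - F') \<le> a * norm (p - Q)"
    define k where "k = 1 - a\<^sup>2"
    have k: "k > 0" using a by (simp add: k_def power_less_one_iff abs_square_less_1)
    \<comment> \<open>These are the centres of the two discs. Their radii differ by
      \<open>a / k * f\<close>, so nestedness amounts to the same bound for the distance of the
      centres.\<close>
    define C C' where "C = F - (a\<^sup>2 / k) *\<^sub>R (V - F)" and "C' = F' - (a\<^sup>2 / k) *\<^sub>R (Q - F')"
    have "C' - C = g + (f * (a\<^sup>2 / k)) *\<^sub>R e"
      by (simp add: C_def C'_def g_def Q_def e(2)[unfolded D_def] algebra_simps)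
    then have "(norm (C' - C))\<^sup>2 = g \<bullet> g + 2 * f * (a\<^sup>2 / k) * x + (f * (a\<^sup>2 / k))\<^sup>2"
      unfolding power2_norm_eq_inner by (simp add: algebra_simps inner_commute x_def e power2_eq_square)
    also have "\<dots> \<le> (a / k * f)\<^sup>2"
    proof -
      have fx: "2 * f * x = f\<^sup>2 + g \<bullet> g - s\<^sup>2"
        using r(1) by (simp add: f_def power2_eq_square algebra_simps)
      have "2 * f * (a\<^sup>2 / k) * x = (a\<^sup>2 / k) * (2 * f * x)" by (simp add: algebra_simps)
      then have "g \<bullet> g + 2 * f * (a\<^sup>2 / k) * x + (f * (a\<^sup>2 / k))\<^sup>2
          = g \<bullet> g * (1 + a\<^sup>2 / k) - (a\<^sup>2 / k) * s\<^sup>2 + f\<^sup>2 * ((a\<^sup>2 / k) + (a\<^sup>2 / k)\<^sup>2)"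
        unfolding fx by (simp add: algebra_simps power_mult_distrib power_divide)
      also have "(a\<^sup>2 / k) + (a\<^sup>2 / k)\<^sup>2 = (a / k)\<^sup>2"
      proof -
        have "a\<^sup>2 / k + (a\<^sup>2 / k)\<^sup>2 = a\<^sup>2 * (k + a\<^sup>2) / k\<^sup>2" using k by (simp add: field_simps power2_eq_square)
        also have "\<dots> = (a / k)\<^sup>2" by (simp add: k_def power_divide)
        finally show ?thesis .
      qed
      also have "1 + a\<^sup>2 / k = 1 / k" using k by (simp add: field_simps k_def)
      also have "g \<bullet> g * (1 / k) - (a\<^sup>2 / k) * s\<^sup>2 \<le> 0"
        using gs k by (simp add: field_simps power_mult_distrib)
      finally have "g \<bullet> g + 2 * f * (a\<^sup>2 / k) * x + (f * (a\<^sup>2 / k))\<^sup>2 \<le> f\<^sup>2 * (a / k)\<^sup>2"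
        by simp
      also have "\<dots> = (a / k * f)\<^sup>2" by (simp only: power_mult_distrib mult.commute[of "f\<^sup>2"])
      finally show ?thesis .
    qed
    finally have CC2: "(norm (C' - C))\<^sup>2 \<le> (a / k * f)\<^sup>2" .
    have "0 \<le> (1 - a) * s" using a s by simp
    then have "0 \<le> f" using fs(2) by linarith
    then have "0 \<le> a / k * f" using a k by simp
    with CC2 have CC: "norm (C' - C) \<le> a / k * f"
      by (rule power2_le_imp_le)
    have "norm (p - C') \<le> a / k * norm (Q - F')"
      using p unfolding apollonius_disc_iff[OF a] C'_def k_def .
    moreover have "a / k * norm (Q - F') = a / k * d - a / k * f"
      unfolding df(2) by (rule right_diff_distrib)
    moreover have "norm (p - C) \<le> norm (p - C') + norm (C' - C)"
      using norm_triangle_ineq[of "p - C'" "C' - C"] by simp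
    ultimately have "norm (p - C) \<le> a / k * d"
      using CC by linarith
    then show "norm (p - F) \<le> a * norm (p - V)"
      unfolding apollonius_disc_iff[OF a] C_def k_def d_def D_def .
  qed
qed


section \<open>Pursuit in small time steps\<close>

lemma continuous_on_Max_finite:
  fixes f :: "'a \<Rightarrow> 'b::topological_space \<Rightarrow> real"
  assumes "finite K" "K \<noteq> {}" "\<And>i. i \<in> K \<Longrightarrow> continuous_on S (f i)"
  shows "continuous_on S (\<lambda>p. Max ((\<lambda>i. f i p) ` K))"
  using assms by (induction K rule: finite_ne_induct) (auto intro!: continuous_on_max)

context reach_avoid
begin

definition pursuers_dominate :: "nat set \<Rightarrow> (nat \<Rightarrow> point) \<Rightarrow> point \<Rightarrow> bool" where
  "pursuers_dominate K X e \<longleftrightarrow> (\<forall>p\<in>tline. \<exists>i\<in>K. vE / vP * norm (X i - p) < norm (e - p))"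

text \<open>The best margin over the pursuers is a continuous positive function on the compact
  target line, hence bounded away from zero, which leaves room for a larger ratio.\<close>

lemma pursuers_dominate_margin:
  assumes K: "finite K" "K \<noteq> {}" and dom: "pursuers_dominate K X e"
  obtains a where "vE / vP < a" "a < 1" "\<And>p. p \<in> tline \<Longrightarrow> \<exists>i\<in>K. a * norm (p - X i) < norm (p - e)"
proof -
  define \<alpha> where "\<alpha> = vE / vP"
  have \<alpha>: "0 < \<alpha>" "\<alpha> < 1" using vE_pos vE_less vP_pos by (auto simp: \<alpha>_def)
  define f where "f i p = norm (e - p) - \<alpha> * norm (X i - p)" for i p
  define g where "g p = Max ((\<lambda>i. f i p) ` K)" for p
  have cont: "continuous_on tline g"
    unfolding g_def f_def using K by (intro continuous_on_Max_finite continuous_intros)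
  obtain p0 where p0: "p0 \<in> tline" "\<And>p. p \<in> tline \<Longrightarrow> g p0 \<le> g p"
    using continuous_attains_inf[OF compact_target_line target_line_nonempty cont] by blast
  have "0 < g p0"
  proof -
    obtain i where "i \<in> K" "0 < f i p0"
      using dom p0(1) by (auto simp: pursuers_dominate_def f_def \<alpha>_def)
    then show ?thesis using K unfolding g_def by (subst Max_gr_iff) auto
  qed
  obtain B where B: "\<And>i p. i \<in> K \<Longrightarrow> p \<in> tline \<Longrightarrow> norm (X i - p) \<le> B" "0 < B"
  proof -
    obtain b where b: "\<And>p. p \<in> tline \<Longrightarrow> norm p \<le> b"
      using compact_imp_bounded[OF compact_target_line] unfolding bounded_iff by blast
    obtain b' where b': "\<And>i. i \<in> K \<Longrightarrow> norm (X i) \<le> b'"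
      using finite_imp_bounded[of "X ` K"] K unfolding bounded_iff by blast
    have "norm (X i - p) \<le> \<bar>b\<bar> + \<bar>b'\<bar> + 1" if "i \<in> K" "p \<in> tline" for i p
      using norm_triangle_ineq4[of "X i" p] b[OF that(2)] b'[OF that(1)] by linarith
    then show ?thesis using that by (metis abs_ge_zero add_nonneg_pos add_nonneg_nonneg zero_less_one)
  qed
  \<comment> \<open>All distances from pursuers to the target line are at most \<open>B\<close>, so
    raising the ratio by \<open>g p0 / (2 * B)\<close> costs at most half of the minimal
    margin.\<close>
  define a where "a = min ((1 + \<alpha>) / 2) (\<alpha> + g p0 / (2 * B))"
  have a: "\<alpha> < a" "a < 1"
    using \<alpha> \<open>0 < g p0\<close> B(2) by (auto simp: a_def min_less_iff_disj)
  have "\<exists>i\<in>K. a * norm (p - X i) < norm (p - e)" if p: "p \<in> tline" for p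
  proof -
    have "g p \<in> (\<lambda>i. f i p) ` K" unfolding g_def using K by (intro Max_in) auto
    then obtain i where i: "i \<in> K" "g p0 \<le> f i p" using p0(2)[OF p] by auto
    have "a \<le> \<alpha> + g p0 / (2 * B)" unfolding a_def by simp
    then have "a * norm (X i - p) \<le> (\<alpha> + g p0 / (2 * B)) * norm (X i - p)"
      by (intro mult_right_mono) auto
    also have "\<dots> = \<alpha> * norm (X i - p) + g p0 / (2 * B) * norm (X i - p)"
      by (simp add: algebra_simps)
    also have "g p0 / (2 * B) * norm (X i - p) \<le> g p0 / (2 * B) * B"
      using B i p \<open>0 < g p0\<close> by (intro mult_left_mono) auto
    also have "g p0 / (2 * B) * B < g p0" using B \<open>0 < g p0\<close> by simp
    finally show ?thesis using i by (intro bexI[of _ i]) (auto simp: f_def norm_minus_commute)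
  qed
  then show ?thesis using that a by (simp add: \<alpha>_def)
qed

text \<open>The waypoints of the pursuers are the points \<open>(1 - \<epsilon>) *\<^sub>R V i + \<epsilon> *\<^sub>R c\<close>: the virtual positions \<open>V i\<close> are
  projections to the closure of \<open>\<Omega>\<close>, which is not contained in \<open>\<Omega>\<close>.  Moreover they react to the
  position \<open>F\<close> of the evader one time step earlier.\<close>

lemma pursuit_induction:
  assumes K: "finite K" "K \<noteq> {}" and X: "\<And>i. i \<in> K \<Longrightarrow> X i \<in> \<Omega>" and e: "e \<in> play"
    and dom: "pursuers_dominate K X e"
    and step: "\<And>X Y e t. e \<in> play \<Longrightarrow> 0 < t \<Longrightarrow> vP * t \<le> l \<Longrightarrow> (\<And>i. i \<in> K \<Longrightarrow> X i \<in> \<Omega>) \<Longrightarrow> (\<And>i. i \<in> K \<Longrightarrow> Y i \<in> \<Omega>) \<Longrightarrow>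
      (\<And>i. i \<in> K \<Longrightarrow> dist (X i) (Y i) \<le> vP * t) \<Longrightarrow> (\<And>p. p \<in> tline \<Longrightarrow> vE * t < dist e p) \<Longrightarrow>
      (\<And>e'. e' \<in> play \<Longrightarrow> dist e e' \<le> vE * t \<Longrightarrow> G Y e') \<Longrightarrow> G X e"
    and base: "0 < c" "\<And>X e i. i \<in> K \<Longrightarrow> (\<And>i. i \<in> K \<Longrightarrow> X i \<in> \<Omega>) \<Longrightarrow> e \<in> play \<Longrightarrow>
      dist (X i) e \<le> c * infdist e tline \<Longrightarrow> G X e"
  shows "G X e"
proof -
  obtain a where a: "vE / vP < a" "a < 1" "\<And>p. p \<in> tline \<Longrightarrow> \<exists>i\<in>K. a * norm (p - X i) < norm (p - e)"
    using pursuers_dominate_margin[OF K dom] by blast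
  have a0: "0 < a" using a(1) vE_pos vP_pos by (auto intro: less_trans[of 0 "vE / vP"])
  \<comment> \<open>Speed of the virtual pursuers: against it the evader has exactly the speed ratio
    \<open>a\<close>.\<close>
  define v where "v = vE / a"
  have v: "0 < v" "v < vP" "a * v = vE"
    using a a0 vE_pos vP_pos by (auto simp: v_def field_simps)
  \<comment> \<open>The intersection of the initial Apollonius discs, to which the evader will stay
    confined up to one step of delay.\<close>
  define S where "S = {p \<in> closure \<Omega>. \<forall>i\<in>K. norm (p - e) \<le> a * norm (p - X i)}"
  have "compact S"
  proof -
    have "S = closure \<Omega> \<inter> (\<Inter>i\<in>K. {p. norm (p - e) \<le> a * norm (p - X i)})"
      using K by (auto simp: S_def)
    moreover have "closed (\<Inter>i\<in>K. {p. norm (p - e) \<le> a * norm (p - X i)})"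
      by (intro closed_INT ballI closed_Collect_le continuous_intros)
    ultimately show ?thesis
      using bounded_domain by (simp add: compact_Int_closed)
  qed
  moreover have "S \<inter> tline = {}" using a(3) by (force simp: S_def)
  ultimately obtain d0 where d0: "0 < d0" "\<And>p q. p \<in> S \<Longrightarrow> q \<in> tline \<Longrightarrow> d0 \<le> dist p q"
    using separate_compact_closed[of S tline] compact_imp_closed[OF compact_target_line] by blast
  obtain c0 where c0: "c0 \<in> interior \<Omega>" using interior_domain by blast
  obtain B where B: "0 < B" "\<And>p. p \<in> closure \<Omega> \<Longrightarrow> norm (p - c0) \<le> B"
  proof -
    obtain b where b: "0 < b" "\<And>p. p \<in> closure \<Omega> \<Longrightarrow> norm p \<le> b"
      using bounded_closure[OF bounded_domain] unfolding bounded_pos by blast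
    have "c0 \<in> closure \<Omega>" using c0 closure_subset interior_subset by blast
    then have "norm (p - c0) \<le> 2 * b" if "p \<in> closure \<Omega>" for p
      using norm_triangle_ineq4[of p c0] b(2)[OF that] b(2)[of c0] by linarith
    then show ?thesis using that[of "2 * b"] b by simp
  qed
  \<comment> \<open>The time step: a leg has length at most \<open>l\<close>, the evader moves at
    most \<open>d0 / 4\<close> per step, and the final distance of at most
    \<open>4 * (vP * \<delta>)\<close> is within \<open>c * (d0 / 2)\<close>, as the base case
    demands.\<close>
  define \<delta> where "\<delta> = min (l / vP) (min (d0 / (4 * vE)) (c * d0 / (8 * vP)))"
  have \<delta>: "0 < \<delta>" "vP * \<delta> \<le> l" "4 * (vE * \<delta>) \<le> d0" "8 * (vP * \<delta>) \<le> c * d0"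
    using l_pos vP_pos vE_pos d0 base(1)
    by (auto simp: \<delta>_def min_le_iff_disj min_less_iff_conj field_simps min_mult_distrib_left intro: min.coboundedI1 min.coboundedI2)
  \<comment> \<open>Shrinking towards the interior point \<open>c0\<close> displaces no waypoint by
    more than one leg.\<close>
  define \<epsilon> where "\<epsilon> = min 1 (vP * \<delta> / B)"
  have \<epsilon>: "0 < \<epsilon>" "\<epsilon> \<le> 1" "\<epsilon> * B \<le> vP * \<delta>"
    using \<delta> vP_pos B by (auto simp: \<epsilon>_def min_mult_distrib_right)
  define R where "R V i = (1 - \<epsilon>) *\<^sub>R V i + \<epsilon> *\<^sub>R c0" for V :: "nat \<Rightarrow> point" and i
  have R_in: "R V i \<in> \<Omega>" if "V i \<in> closure \<Omega>" for V i
  proof -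
    have "V i - \<epsilon> *\<^sub>R (V i - c0) \<in> interior \<Omega>"
      using that c0 \<epsilon> convex_domain by (intro mem_interior_closure_convex_shrink) auto
    moreover have "V i - \<epsilon> *\<^sub>R (V i - c0) = R V i" by (simp add: R_def algebra_simps)
    ultimately show ?thesis using interior_subset by auto
  qed
  have R_near: "dist (V i) (R V i) \<le> vP * \<delta>" if "V i \<in> closure \<Omega>" for V i
  proof -
    have "V i - R V i = \<epsilon> *\<^sub>R (V i - c0)" by (simp add: R_def algebra_simps)
    then have "dist (V i) (R V i) = \<epsilon> * norm (V i - c0)" using \<epsilon> by (simp add: dist_norm)
    also have "\<dots> \<le> \<epsilon> * B" using B that \<epsilon> by (intro mult_left_mono) auto
    finally show ?thesis using \<epsilon> by simp
  qed
  define s where "s = v * \<delta>"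
  have s: "0 < s" "s \<le> vP * \<delta>" "a * s = vE * \<delta>"
    using v \<delta> by (auto simp: s_def mult.assoc[symmetric] mult_right_mono)
  obtain j where j: "j \<in> K" using K by blast
  \<comment> \<open>Here \<open>F\<close> is the evader's position one step before
    \<open>e'\<close>. The invariant is that the present discs meet \<open>closure \<Omega>\<close>
    inside \<open>S\<close>; the number \<open>n\<close> bounds the steps until pursuer
    \<open>j\<close> is close.\<close>
  have main: "G (R V) e'"
    if "\<And>i. i \<in> K \<Longrightarrow> V i \<in> closure \<Omega>" "F \<in> closure \<Omega>" "e' \<in> play" "dist F e' \<le> vE * \<delta>"
      "\<And>p. p \<in> closure \<Omega> \<Longrightarrow> (\<And>i. i \<in> K \<Longrightarrow> norm (p - F) \<le> a * norm (p - V i)) \<Longrightarrow> p \<in> S"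
      "norm (V j - F) \<le> s * (1 + a) + real n * ((1 - a) * s)" for V F e' n
    using that
  proof (induction n arbitrary: V F e')
    have inS: "d0 - vE * \<delta> \<le> dist e' p"
      if "F \<in> closure \<Omega>" "dist F e' \<le> vE * \<delta>" "p \<in> tline"
        "\<And>p. p \<in> closure \<Omega> \<Longrightarrow> (\<And>i. i \<in> K \<Longrightarrow> norm (p - F) \<le> a * norm (p - V i)) \<Longrightarrow> p \<in> S"
      for F e' p and V :: "nat \<Rightarrow> point"
    proof -
      \<comment> \<open>At \<open>p = F\<close> the left-hand side of every disc inequality
        vanishes.\<close>
      have "F \<in> S" using that a0 by simp
      then show ?thesis using d0(2)[of F p] that dist_triangle[of F p e'] by simp
    qed
    have caught: "G (R V) e'"
      if V: "\<And>i. i \<in> K \<Longrightarrow> V i \<in> closure \<Omega>" "F \<in> closure \<Omega>" "e' \<in> play" "dist F e' \<le> vE * \<delta>"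
        "\<And>p. p \<in> closure \<Omega> \<Longrightarrow> (\<And>i. i \<in> K \<Longrightarrow> norm (p - F) \<le> a * norm (p - V i)) \<Longrightarrow> p \<in> S"
        "i \<in> K" "norm (V i - F) \<le> s * (1 + a)" for V F e' i
    proof (rule base(2)[OF V(6) _ V(3)])
      have "d0 - vE * \<delta> \<le> infdist e' tline"
        unfolding infdist_notempty[OF target_line_nonempty]
        using inS[of F e' _ V] V by (intro cINF_greatest target_line_nonempty) auto
      then have "d0 / 2 \<le> infdist e' tline" using \<delta> d0 by linarith
      then have "c * (d0 / 2) \<le> c * infdist e' tline" using base(1) by (intro mult_left_mono) auto
      moreover have "dist (R V i) e' \<le> vP * \<delta> + s * (1 + a) + vE * \<delta>"
        using dist_triangle[of "R V i" e' "V i"] dist_triangle[of "V i" e' F] R_near[of V i] V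
          dist_norm[of "V i" F] dist_commute[of "V i" "R V i"] dist_commute[of F e'] dist_commute[of F "V i"]
        by (smt (verit))
      moreover have "s * (1 + a) + vE * \<delta> \<le> 3 * (vP * \<delta>)"
      proof -
        have "vE * \<delta> \<le> vP * \<delta>" using vE_less \<delta>(1) by simp
        moreover have "s * (1 + a) = s + a * s" by (simp add: algebra_simps)
        ultimately show ?thesis using s(2,3) by linarith
      qed
      ultimately show "dist (R V i) e' \<le> c * infdist e' tline" using \<delta> by linarith
      show "R V i \<in> \<Omega>" if "i \<in> K" for i using R_in V that by blast
    qed
    {
      case 0
      then show ?case using caught[of V F e' j] j by simp
    next
      case (Suc n)
      show ?case
      proof (cases "\<exists>i\<in>K. norm (V i - F) \<le> s * (1 + a)")
        case True
        then show ?thesis using caught[of V F e'] Suc.prems by blast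
      next
        case False
        \<comment> \<open>The virtual pursuers answer the displacement from \<open>F\<close> to
          \<open>e'\<close>, which is already over.\<close>
        have "\<exists>Q. norm (Q - V i) \<le> s \<and> norm (Q - e') \<le> norm (V i - F) - (1 - a) * s \<and>
            (\<forall>p. norm (p - e') \<le> a * norm (p - Q) \<longrightarrow> norm (p - F) \<le> a * norm (p - V i))" if "i \<in> K" for i
          using parallel_guidance[of a s e' F "V i"] a0 a s False that Suc.prems(4)
          by (metis dist_norm dist_commute not_le)
        then obtain Q where Q: "\<And>i. i \<in> K \<Longrightarrow> norm (Q i - V i) \<le> s"
          "\<And>i. i \<in> K \<Longrightarrow> norm (Q i - e') \<le> norm (V i - F) - (1 - a) * s"
          "\<And>i p. i \<in> K \<Longrightarrow> norm (p - e') \<le> a * norm (p - Q i) \<Longrightarrow> norm (p - F) \<le> a * norm (p - V i)"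
          by metis
        \<comment> \<open>Projection onto the convex closure brings the pursuer no farther from any
          point of it. So both the inclusion of the discs within the closure and the gain in
          distance survive.\<close>
        define W where "W i = closest_point (closure \<Omega>) (Q i)" for i
        have ne: "closure \<Omega> \<noteq> {}" using c0 interior_subset by auto
        have W_in: "W i \<in> closure \<Omega>" for i
          unfolding W_def using ne by (intro closest_point_in_set) auto
        have W_dist: "dist (W i) p \<le> dist (Q i) p" if "p \<in> closure \<Omega>" for i p
          using closest_point_lipschitz[of "closure \<Omega>" "Q i" p] ne that convex_domain
          by (simp add: W_def closest_point_self convex_closure)
        have e'_cl: "e' \<in> closure \<Omega>" using Suc.prems(3) closure_subset play_domain by blast
        show ?thesis
        proof (rule step[OF Suc.prems(3) \<delta>(1,2)])
          show "R V i \<in> \<Omega>" "R W i \<in> \<Omega>" if "i \<in> K" for i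
            using R_in Suc.prems(1) that W_in by auto
          show "dist (R V i) (R W i) \<le> vP * \<delta>" if "i \<in> K" for i
          proof -
            have "R V i - R W i = (1 - \<epsilon>) *\<^sub>R (V i - W i)" by (simp add: R_def algebra_simps)
            then have "dist (R V i) (R W i) = (1 - \<epsilon>) * dist (W i) (V i)"
              using \<epsilon> by (simp add: dist_norm norm_minus_commute)
            also have "\<dots> \<le> 1 * dist (Q i) (V i)"
              using \<epsilon> W_dist Suc.prems(1)[OF that] by (intro mult_mono) auto
            finally show ?thesis using Q(1)[OF that] s by (simp add: dist_norm)
          qed
          show "vE * \<delta> < dist e' p" if "p \<in> tline" for p
          proof -
            have "d0 - vE * \<delta> \<le> dist e' p"
              using inS[of F e' p V] Suc.prems(2,4,5) that by blast
            then show ?thesis using \<delta> vE_pos d0 by linarith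
          qed
          show "G (R W) e''" if e'': "e'' \<in> play" "dist e' e'' \<le> vE * \<delta>" for e''
          proof (rule Suc.IH[OF W_in e'_cl e''])
            show "p \<in> S" if p: "p \<in> closure \<Omega>" "\<And>i. i \<in> K \<Longrightarrow> norm (p - e') \<le> a * norm (p - W i)" for p
            proof (rule Suc.prems(5)[OF p(1)])
              fix i assume i: "i \<in> K"
              have "norm (p - W i) \<le> norm (p - Q i)"
                using W_dist[OF p(1), of i] by (simp add: dist_norm norm_minus_commute)
              then have "a * norm (p - W i) \<le> a * norm (p - Q i)" using a0 by simp
              then show "norm (p - F) \<le> a * norm (p - V i)"
                using Q(3)[OF i, of p] p(2)[OF i] by linarith
            qed
            have "norm (W j - e') \<le> norm (Q j - e')"
              using W_dist[OF e'_cl, of j] by (simp add: dist_norm)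
            then show "norm (W j - e') \<le> s * (1 + a) + real n * ((1 - a) * s)"
              using Q(2)[OF j] Suc.prems(6) by (simp add: algebra_simps)
          qed
        qed
      qed
    }
  qed
  have X_cl: "X i \<in> closure \<Omega>" if "i \<in> K" for i using X that closure_subset by blast
  have e_cl: "e \<in> closure \<Omega>" using e play_domain closure_subset by blast
  show ?thesis
  \<comment> \<open>The initial leg leads only to the waypoints of \<open>X\<close>; it creates the
    delay, with \<open>F = e\<close>.\<close>
  proof (rule step[OF e \<delta>(1,2)])
    show "X i \<in> \<Omega>" "R X i \<in> \<Omega>" "dist (X i) (R X i) \<le> vP * \<delta>" if "i \<in> K" for i
      using X R_in R_near X_cl that by auto
    show "vE * \<delta> < dist e p" if "p \<in> tline" for p
    proof -
      have "e \<in> S" using e_cl a0 by (simp add: S_def)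
      then show ?thesis using d0(2)[of e p] that \<delta> d0(1) vE_pos by fastforce
    qed
    show "G (R X) e'" if "e' \<in> play" "dist e e' \<le> vE * \<delta>" for e'
    proof -
      have "0 < (1 - a) * s" using a s by simp
      then obtain n where "norm (X j - e) / ((1 - a) * s) < real n"
        using reals_Archimedean2 by blast
      then have "norm (X j - e) < real n * ((1 - a) * s)"
        using \<open>0 < (1 - a) * s\<close> by (simp only: pos_divide_less_eq)
      moreover have "0 \<le> s * (1 + a)" using s a0 by simp
      ultimately have "norm (X j - e) \<le> s * (1 + a) + real n * ((1 - a) * s)"
        by linarith
      then show ?thesis
        using that X_cl e_cl by (intro main[of X e e' n]) (auto simp: S_def)
    qed
  qed
qed

end

section \<open>Pursuit of delayed positions\<close>

context reach_avoid
begin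

lemma infdist_target_less: "r < infdist e tline \<Longrightarrow> p \<in> tline \<Longrightarrow> r < dist e p"
  using infdist_le[of p tline e] by simp

lemma infdist_target_pos:
  assumes "e \<in> play" shows "0 < infdist e tline"
proof -
  have "e \<notin> tline" using assms by (auto simp: play_iff target_line_iff)
  then show ?thesis
    using infdist_pos_not_in_closed[of tline e] compact_imp_closed[OF compact_target_line] target_line_nonempty by simp
qed

text \<open>The pursuer runs to the position which the evader had at the beginning of the previous time step; as the time
  steps shrink by the factor \<open>vE / vP\<close>, capture takes place at the end of the infinitely many steps.\<close>

lemma pursuit_chase:
  assumes i: "i \<in> K" and X: "\<And>i. i \<in> K \<Longrightarrow> X i \<in> \<Omega>" and e: "e \<in> play"
    and \<kappa>: "dist (X i) e \<le> \<kappa>" "0 < \<kappa>" "\<kappa> \<le> l" "vE * (\<kappa> / (vP - vE)) < infdist e tline"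
  shows "e \<in> pursuit_winning_region \<Omega> vP vE K X"
proof -
  define q where "q = vE / vP"
  have q: "0 < q" "q < 1" "vP * q = vE" using vE_pos vE_less vP_pos by (auto simp: q_def)
  \<comment> \<open>The sum of the geometric series of step lengths
    \<open>\<kappa> * q ^ k / vP\<close>.\<close>
  define T where "T = \<kappa> / (vP - vE)"
  define \<tau> where "\<tau> k = T * (1 - q ^ k)" for k
  have T: "0 < T" "vP * (T * (1 - q)) = \<kappa>"
    using \<kappa> vE_less q vP_pos by (auto simp: T_def q_def field_simps)
  have \<tau>0: "\<tau> 0 = 0" by (simp add: \<tau>_def)
  have step: "vP * (\<tau> (Suc k) - \<tau> k) = \<kappa> * q ^ k" for k
  proof -
    have "\<tau> (Suc k) - \<tau> k = (T * (1 - q)) * q ^ k" by (simp add: \<tau>_def algebra_simps)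
    then show ?thesis using T(2) by (simp add: mult.assoc[symmetric])
  qed
  have "strict_mono \<tau>"
  proof (rule strict_monoI_Suc)
    fix k
    have "0 < vP * (\<tau> (Suc k) - \<tau> k)" unfolding step using \<kappa> q by simp
    then show "\<tau> k < \<tau> (Suc k)" using vP_pos by (simp add: zero_less_mult_iff)
  qed
  then have mono: "mono \<tau>" by (rule strict_mono_mono)
  have \<tau>_nonneg: "0 \<le> \<tau> k" for k using monoD[OF mono, of 0 k] \<tau>0 by simp
  have "(\<lambda>k. q ^ k) \<longlonglongrightarrow> 0" using q by (intro LIMSEQ_realpow_zero) auto
  then have "\<tau> \<longlonglongrightarrow> T * (1 - 0)" unfolding \<tau>_def by (intro tendsto_mult tendsto_diff tendsto_const)
  then have lim: "\<tau> \<longlonglongrightarrow> T" by simp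
  have \<tau>_less: "\<tau> k < T" for k using T q by (simp add: \<tau>_def field_simps)
  \<comment> \<open>Legs are chosen as functions of end points and duration alone, so that the
    strategy depends on the evader only through the waypoints.\<close>
  have "\<forall>x\<in>\<Omega>. \<exists>u. admP x u" using ex_admissible vP_pos by blast
  then obtain C where C: "\<And>x. x \<in> \<Omega> \<Longrightarrow> admP x (C x)" by metis
  have "\<exists>u. dist x y \<le> vP * t \<and> vP * t \<le> l \<and> x \<in> \<Omega> \<and> y \<in> \<Omega> \<longrightarrow> admP x u \<and> trajectory vP x u t = y" for x y t
    using ex_admissible_to[of x y vP t] vP_pos by blast
  then obtain H where H: "\<And>x y t. dist x y \<le> vP * t \<Longrightarrow> vP * t \<le> l \<Longrightarrow> x \<in> \<Omega> \<Longrightarrow> y \<in> \<Omega> \<Longrightarrow>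
      admP x (H x y t) \<and> trajectory vP x (H x y t) t = y"
    by metis
  \<comment> \<open>In step \<open>k\<close> the pursuer runs from \<open>W u k\<close> to
    \<open>W u (Suc k)\<close>, the evader's position at \<open>\<tau> k\<close>, which is known
    when the step begins.\<close>
  define W where "W u k = (case k of 0 \<Rightarrow> X i | Suc m \<Rightarrow> trajectory vE e u (\<tau> m))" for u k
  define U where "U u k = rec_nat (C (X i)) (\<lambda>k f. switch (\<tau> k) f (H (W u k) (W u (Suc k)) (\<tau> (Suc k) - \<tau> k))) k" for u k
  have U_simps: "U u 0 = C (X i)" "U u (Suc k) = switch (\<tau> k) (U u k) (H (W u k) (W u (Suc k)) (\<tau> (Suc k) - \<tau> k))" for u k
    by (auto simp: U_def)
  \<comment> \<open>After capture at \<open>T\<close> any admissible continuation from the meeting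
    point will do.\<close>
  define g where "g u = glue \<tau> (U u) (\<lambda>s. C (trajectory vE e u T) (s - T))" for u
  define \<gamma> where "\<gamma> u j = (if j = i then g u else C (X j))" for u j
  have coh: "U u (Suc k) s = U u k s" if "0 \<le> s" "s < \<tau> k" for u k s
    using that by (simp add: U_simps switch_def)
  have W_in: "W u k \<in> \<Omega>" if "admE e u" for u k
    using that X[OF i] \<tau>_nonneg by (cases k) (auto simp: W_def dest: admissible_controlD(2))
  have W_dist: "dist (W u k) (W u (Suc k)) \<le> vP * (\<tau> (Suc k) - \<tau> k)" if u: "admE e u" for u k
  proof (cases k)
    case 0
    then show ?thesis using \<kappa>(1) \<tau>0 unfolding step by (simp add: W_def)
  next
    case (Suc m)
    have "dist (W u k) (W u (Suc k)) \<le> vE * \<bar>\<tau> m - \<tau> (Suc m)\<bar>"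
      unfolding W_def Suc using u vE_pos \<tau>_nonneg by (auto intro!: trajectory_dist admissible_controlD(1))
    also have "\<dots> = q * (vP * (\<tau> (Suc m) - \<tau> m))"
      using monoD[OF mono, of m "Suc m"] unfolding q(3)[symmetric] by (simp add: algebra_simps)
    also have "\<dots> = vP * (\<tau> (Suc k) - \<tau> k)"
      unfolding step Suc by simp
    finally show ?thesis .
  qed
  have step_le: "vP * (\<tau> (Suc k) - \<tau> k) \<le> l" for k
  proof -
    have "\<kappa> * q ^ k \<le> \<kappa> * 1" using \<kappa> q by (intro mult_left_mono power_le_one) auto
    then show ?thesis unfolding step using \<kappa>(3) by linarith
  qed
  have U: "admP (X i) (U u k) \<and> trajectory vP (X i) (U u k) (\<tau> k) = W u k"
    if u: "admE e u" for u k
  proof (induction k)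
    case 0
    then show ?case using C X i \<tau>0 by (simp add: U_simps W_def)
  next
    case (Suc k)
    note h = H[OF W_dist[OF u] step_le W_in[OF u] W_in[OF u], of k]
    have "control_signal (U u k)" "control_signal (H (W u k) (W u (Suc k)) (\<tau> (Suc k) - \<tau> k))"
      using Suc h by (auto dest: admissible_controlD(1))
    then show ?case
      using Suc h \<tau>_nonneg[of k] monoD[OF mono, of k "Suc k"] unfolding U_simps
      by (auto simp: trajectory_splice_ge intro!: admissible_splice dest: admissible_controlD(2))
  qed
  have g: "admP (X i) (g u) \<and> trajectory vP (X i) (g u) T = trajectory vE e u T"
    if u: "admE e u" for u
    unfolding g_def
  proof (rule admissible_glue_bounded[where \<tau> = \<tau> and U = "U u", OF coh \<open>strict_mono \<tau>\<close> _ lim \<tau>0])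
    show "admP (trajectory vE e u T) (C (trajectory vE e u T))"
      by (rule C, rule admissible_controlD(2)[OF u]) (use T in simp)
    have "(\<lambda>k. W u (Suc k)) \<longlonglongrightarrow> trajectory vE e u T"
      using trajectory_tendsto[OF admissible_controlD(1)[OF u] _ lim \<tau>_nonneg] vE_pos by (simp add: W_def)
    then have "(\<lambda>k. W u k) \<longlonglongrightarrow> trajectory vE e u T" by (rule LIMSEQ_imp_Suc)
    then show "(\<lambda>k. trajectory vP (X i) (U u k) (\<tau> k)) \<longlonglongrightarrow> trajectory vE e u T"
      using U[OF u] by simp
  qed (use U[OF u] vP_pos in auto)
  have "pursuit_strategy \<Omega> vP vE K X e \<gamma>"
    unfolding pursuit_strategy_def
  proof (intro conjI allI impI ballI)
    show "admP (X j) (\<gamma> u j)" if "admE e u" "j \<in> K" for u j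
      using that g C X by (simp add: \<gamma>_def)
  next
    fix u u' r j s
    assume "admE e u" "admE e u'"
      and eq: "\<forall>s\<in>{0..r}. u s = u' s" and s: "s \<in> {0..r}"
    have tr: "trajectory vE e u t = trajectory vE e u' t" if "t \<le> r" for t
      by (rule trajectory_cong) (use eq that in auto)
    have Weq: "W u k = W u' k" if "\<And>m. m < k \<Longrightarrow> \<tau> m \<le> r" for k
      using that tr by (cases k) (auto simp: W_def)
    have Ueq: "U u k = U u' k" if "\<And>m. m < k \<Longrightarrow> \<tau> m \<le> r" for k
      using that
    proof (induction k)
      case (Suc k)
      then show ?case using Weq[of k] Weq[of "Suc k"] by (simp add: U_simps)
    qed (simp add: U_simps)
    have "g u s = g u' s"
    proof (cases "\<exists>k. s < \<tau> k")
      case True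
      \<comment> \<open>By minimality, all evader positions entering this control belong to times
        not later than \<open>s\<close>.\<close>
      have "U u (LEAST k. s < \<tau> k) = U u' (LEAST k. s < \<tau> k)"
      proof (rule Ueq)
        fix m assume "m < (LEAST k. s < \<tau> k)"
        then have "\<not> s < \<tau> m" by (rule not_less_Least)
        then show "\<tau> m \<le> r" using s by simp
      qed
      then show ?thesis using True by (simp add: g_def glue_def)
    next
      case False
      then have "T \<le> s" using LIMSEQ_le_const2[OF lim, of s] by (meson not_less)
      then show ?thesis using False tr[of T] s by (simp add: g_def glue_def)
    qed
    then show "\<gamma> u j s = \<gamma> u' j s" by (simp add: \<gamma>_def)
  qed
  moreover have "pursuers_win \<Omega> K (\<lambda>i. trajectory vP (X i) (\<gamma> u i)) (trajectory vE e u)"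
    if u: "admE e u" for u
    unfolding pursuers_win_def
  proof (intro exI[of _ T] conjI ballI bexI[OF _ i])
    show "trajectory vP (X i) (\<gamma> u i) T = trajectory vE e u T" using g[OF u] by (simp add: \<gamma>_def)
    show "trajectory vE e u s \<in> play" if "s \<in> {0..T}" for s
      using trajectory_in_play[OF u e, of T s] infdist_target_less[OF \<kappa>(4)] that by (simp add: T_def)
  qed (use T in simp)
  ultimately show ?thesis using e by (auto simp: pursuit_winning_region_def)
qed

text \<open>The exceptional set of the glued play lies in the countable union of those of the
  pieces. Beyond the accumulation time the feedback imposes nothing, since by then the game is
  decided.\<close>

lemma feedback_play_glue:
  assumes fp: "\<And>k. fplay K X e \<beta> (\<lambda>j. UP j k) (UE k)"
    and cohP: "\<And>j k s. j \<in> K \<Longrightarrow> 0 \<le> s \<Longrightarrow> s < \<tau> k \<Longrightarrow> UP j (Suc k) s = UP j k s"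
    and cohE: "\<And>k s. 0 \<le> s \<Longrightarrow> s < \<tau> k \<Longrightarrow> UE (Suc k) s = UE k s"
    and mono: "mono \<tau>"
    and adm: "\<And>j. j \<in> K \<Longrightarrow> admP (X j) (glue \<tau> (UP j) (wP j))"
      "admE e (glue \<tau> UE wE)"
    and dec: "\<And>s. 0 \<le> s \<Longrightarrow> (\<And>k. \<tau> k \<le> s) \<Longrightarrow>
      \<not> undecided \<Omega> K (\<lambda>j. trajectory vP (X j) (glue \<tau> (UP j) (wP j))) (trajectory vE e (glue \<tau> UE wE)) s"
  shows "fplay K X e \<beta> (\<lambda>j. glue \<tau> (UP j) (wP j)) (glue \<tau> UE wE)"
proof -
  let ?XP = "\<lambda>k j. trajectory vP (X j) (UP j k)" and ?XE = "\<lambda>k. trajectory vE e (UE k)"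
  let ?YP = "\<lambda>j. trajectory vP (X j) (glue \<tau> (UP j) (wP j))" and ?YE = "trajectory vE e (glue \<tau> UE wE)"
  let ?N = "\<lambda>k. {s. 0 \<le> s \<and> undecided \<Omega> K (?XP k) (?XE k) s \<and> UE k s \<noteq> \<beta> (\<lambda>j\<in>K. ?XP k j s) (?XE k s)}"
  have neg: "negligible (\<Union>k. ?N k)"
    using fp by (intro negligible_countable_Union) (auto simp: feedback_play_iff)
  have *: "s \<in> (\<Union>k. ?N k)"
    if s: "0 \<le> s" "undecided \<Omega> K ?YP ?YE s" "glue \<tau> UE wE s \<noteq> \<beta> (\<lambda>j\<in>K. ?YP j s) (?YE s)" for s
  proof -
    obtain k where k: "s < \<tau> k" using dec[of s] s by (meson not_less)
    have E: "?YE r = ?XE k r" if "r \<le> s" for r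
      by (rule trajectory_glue) (use cohE mono k that in auto)
    have P: "?YP j r = ?XP k j r" if "r \<le> s" "j \<in> K" for r j
      by (rule trajectory_glue) (use cohP mono k that in auto)
    have u: "glue \<tau> UE wE s = UE k s"
      by (rule glue_eq) (use cohE mono k s in auto)
    have "undecided \<Omega> K (?XP k) (?XE k) s"
      using s(2) E P by (auto simp: undecided_def)
    moreover have "(\<lambda>j\<in>K. ?YP j s) = (\<lambda>j\<in>K. ?XP k j s)" using P by (auto simp: restrict_def)
    ultimately have "s \<in> ?N k" using s(1,3) E u by simp
    then show ?thesis by blast
  qed
  have "{s. 0 \<le> s \<and> undecided \<Omega> K ?YP ?YE s \<and> glue \<tau> UE wE s \<noteq> \<beta> (\<lambda>j\<in>K. ?YP j s) (?YE s)} \<subseteq> (\<Union>k. ?N k)"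
    using * by blast
  note negligible_subset[OF neg this]
  then show ?thesis using adm by (simp add: feedback_play_iff)
qed


text \<open>Here the time steps are proportional to the distance of the evader from the target line.  If infinitely many
  of them take place in finite time, then the evader converges to the target line, and so does the pursuer.\<close>

lemma holds_out_chase:
  assumes \<beta>: "evader_feedback \<Omega> vP vE K \<beta>"
    and i: "i \<in> K" and X: "\<And>i. i \<in> K \<Longrightarrow> X i \<in> \<Omega>" and e: "e \<in> play"
    and c: "0 < c" "vE \<le> vP * (1 - c * vE)" "\<And>p. p \<in> \<Omega> \<Longrightarrow> vP * (c * infdist p tline) \<le> l"
    and near: "dist (X i) e \<le> vP * (c * infdist e tline)"
  shows "holds_out K \<beta> X e"
proof -
  let ?tr = "\<lambda>U j. trajectory vP (X j) (U j)" and ?te = "trajectory vE e"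
  \<comment> \<open>Duration of the step that begins with the evader at \<open>p\<close>.\<close>
  define \<delta> where "\<delta> p = c * infdist p tline" for p :: point
  have cvE: "c * vE < 1"
    using c(2) vE_pos vP_pos by (smt (verit) mult_nonneg_nonpos)
  have \<delta>_pos: "0 < \<delta> p" if "p \<in> play" for p using infdist_target_pos[OF that] c by (simp add: \<delta>_def)
  have \<delta>_far: "vE * \<delta> p < dist p y" if "p \<in> play" "y \<in> tline" for p y
  proof -
    have "vE * \<delta> p = (c * vE) * infdist p tline" by (simp add: \<delta>_def)
    also have "\<dots> < 1 * infdist p tline" using cvE infdist_target_pos[OF that(1)] by (intro mult_strict_right_mono)
    also have "\<dots> \<le> dist p y" using infdist_le[OF that(2)] by simp
    finally show ?thesis .
  qed
  define P where "P = (\<lambda>(uP, uE, t). fplay K X e \<beta> uP uE \<and> 0 \<le> t \<and>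
      (\<forall>s\<in>{0..t}. ?te uE s \<in> play) \<and> dist (?tr uP i t) (?te uE t) \<le> vP * \<delta> (?te uE t) \<and>
      (\<forall>j\<in>K - {i}. ?tr uP j t = X j))"
  define Q where "Q = (\<lambda>(uP, uE, t) (uP', uE', t'). t' = t + \<delta> (?te uE t) \<and>
      (\<forall>j. \<forall>s<t. uP' j s = uP j s) \<and> (\<forall>s<t. uE' s = uE s) \<and> ?tr uP' i t' = ?te uE t)"
    for x y :: "(nat \<Rightarrow> real \<Rightarrow> point) \<times> (real \<Rightarrow> point) \<times> real"
  \<comment> \<open>Dependent choice builds the play leg by leg, since the evader's reply to each
    leg is merely known to exist.\<close>
  have "\<exists>f. \<forall>n. P (f n) \<and> Q (f n) (f (Suc n)) \<and> (n = 0 \<longrightarrow> snd (snd (f n)) = 0)"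
  proof -
    have "\<exists>x. P x \<and> snd (snd x) = 0"
    proof -
      obtain w where w: "\<And>j. j \<in> K \<Longrightarrow> admP (X j) (w j)"
        using ex_admissible[OF X vP_pos] by metis
      obtain u where "fplay K X e \<beta> w u"
        using ex_feedback_play[where X = X and uP = w, OF \<beta> w e] by blast
      then have "P (w, u, 0)" using near e by (simp add: P_def \<delta>_def)
      then show ?thesis by force
    qed
    moreover have "\<exists>y. P y \<and> Q x y" if "P x" for x
    proof -
      obtain uP uE t where x: "x = (uP, uE, t)" by (cases x)
      have fp: "fplay K X e \<beta> uP uE" and t: "0 \<le> t"
        and play: "\<And>s. 0 \<le> s \<Longrightarrow> s \<le> t \<Longrightarrow> ?te uE s \<in> play"
        and ne: "dist (?tr uP i t) (?te uE t) \<le> vP * \<delta> (?te uE t)"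
        and others: "\<And>j. j \<in> K \<Longrightarrow> j \<noteq> i \<Longrightarrow> ?tr uP j t = X j"
        using that by (auto simp: P_def x)
      let ?y = "?te uE t"
      define h where "h = \<delta> ?y"
      have y: "?y \<in> play" using play[of t] t by simp
      have h: "0 < h" "vP * h \<le> l" using \<delta>_pos[OF y] c(3)[OF play_domain[OF y]] by (auto simp: h_def \<delta>_def)
      \<comment> \<open>The other pursuers return to their initial positions after every leg, which
        gives their paths a limit at a possible accumulation time.\<close>
      define Y where "Y j = (if j = i then ?y else X j)" for j
      have XP: "?tr uP j t \<in> \<Omega>" if "j \<in> K" for j
        using fp that t by (auto simp: feedback_play_iff dest: admissible_controlD(2))
      have "\<exists>w. admP (?tr uP j t) w \<and> trajectory vP (?tr uP j t) w h = Y j" if "j \<in> K" for j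
      proof (rule ex_admissible_to[OF XP[OF that] _ vP_pos _ h(2)])
        show "Y j \<in> \<Omega>" using X that y play_domain by (auto simp: Y_def)
        show "dist (?tr uP j t) (Y j) \<le> vP * h"
          using ne others[OF that] h vP_pos by (auto simp: Y_def h_def)
      qed
      then obtain w where w: "\<And>j. j \<in> K \<Longrightarrow> admP (?tr uP j t) (w j)"
          "\<And>j. j \<in> K \<Longrightarrow> trajectory vP (?tr uP j t) (w j) h = Y j"
        by metis
      obtain u where u: "fplay K (\<lambda>j. ?tr uP j t) ?y \<beta> w u"
        using ex_feedback_play[where X = "\<lambda>j. ?tr uP j t" and uP = w, OF \<beta> w(1) y] by blast
      have au: "admE ?y u" using u by (simp add: feedback_play_iff)
      define vP' where "vP' j = switch t (uP j) (w j)" for j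
      define vE' where "vE' = switch t uE u"
      have fp': "fplay K X e \<beta> vP' vE'"
        unfolding vP'_def vE'_def by (rule feedback_play_splice[OF fp t u])
      have cs: "control_signal uE" "control_signal u" "\<And>j. j \<in> K \<Longrightarrow> control_signal (uP j)" "\<And>j. j \<in> K \<Longrightarrow> control_signal (w j)"
        using fp au w(1) by (auto simp: feedback_play_iff dest: admissible_controlD(1))
      have P': "?tr vP' j (t + h) = Y j" if "j \<in> K" for j
        unfolding vP'_def using cs that t h w(2) by (subst trajectory_splice_ge) auto
      have E': "?te vE' s = trajectory vE ?y u (s - t)" if "t \<le> s" for s
        unfolding vE'_def using cs t that by (subst trajectory_splice_ge) auto
      have play': "?te vE' s \<in> play" if "0 \<le> s" "s \<le> t + h" for s
      proof (cases "s \<le> t")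
        case True
        then show ?thesis using play that by (simp add: vE'_def trajectory_splice_le)
      next
        case False
        have "trajectory vE ?y u (s - t) \<in> play"
          using \<delta>_far[OF y] that False by (intro trajectory_in_play[OF au y, of h]) (auto simp: h_def)
        then show ?thesis using E' False by simp
      qed
      have "dist ?y (?te vE' (t + h)) \<le> vE * h"
        using trajectory_dist0[OF au, of h] vE_pos h E'[of "t + h"] by simp
      \<comment> \<open>The distance to the target line is 1-Lipschitz, so the next duration is at
        least \<open>(1 - c * vE) * h\<close>; by the second bound on \<open>c\<close> the evader's
        displacement can be covered in that time.\<close>
      moreover have "vE * h \<le> vP * \<delta> (?te vE' (t + h))"
      proof -
        have "infdist ?y tline \<le> infdist (?te vE' (t + h)) tline + dist ?y (?te vE' (t + h))"
          by (rule infdist_triangle)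
        then have "c * infdist ?y tline \<le> c * (infdist (?te vE' (t + h)) tline + vE * h)"
          using calculation c(1) by (intro mult_left_mono) auto
        then have "(1 - c * vE) * h \<le> \<delta> (?te vE' (t + h))"
          by (simp add: \<delta>_def h_def algebra_simps)
        then have "vP * ((1 - c * vE) * h) \<le> vP * \<delta> (?te vE' (t + h))"
          using vP_pos by (intro mult_left_mono) auto
        moreover have "vE * h \<le> vP * (1 - c * vE) * h" using c(2) h by (intro mult_right_mono) auto
        ultimately show ?thesis by (simp add: algebra_simps)
      qed
      ultimately have "dist (?tr vP' i (t + h)) (?te vE' (t + h)) \<le> vP * \<delta> (?te vE' (t + h))"
        using P'[OF i] by (simp add: Y_def)
      then have "P (vP', vE', t + h)"
        using fp' t h play' P' by (auto simp: P_def Y_def)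
      moreover have "Q x (vP', vE', t + h)"
        using P'[OF i] by (simp add: Q_def x h_def Y_def vP'_def vE'_def switch_def)
      ultimately show ?thesis by blast
    qed
    ultimately have "\<exists>f. \<forall>n. (P (f n) \<and> (n = 0 \<longrightarrow> snd (snd (f n)) = 0)) \<and> Q (f n) (f (Suc n))"
      by (intro dependent_nat_choice) auto
    then show ?thesis by blast
  qed
  then obtain f where f: "\<And>n. P (f n)" "\<And>n. Q (f n) (f (Suc n))" "snd (snd (f 0)) = 0"
    by blast
  define UP where "UP j n = fst (f n) j" for j n
  define UE where "UE n = fst (snd (f n))" for n
  define \<tau> where "\<tau> n = snd (snd (f n))" for n
  define y where "y n = ?te (UE n) (\<tau> n)" for n
  have f_eq: "f n = (\<lambda>j. UP j n, UE n, \<tau> n)" for n by (simp add: UP_def UE_def \<tau>_def)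
  have fp: "fplay K X e \<beta> (\<lambda>j. UP j n) (UE n)" and \<tau>_nonneg: "0 \<le> \<tau> n"
    and play: "\<And>s. 0 \<le> s \<Longrightarrow> s \<le> \<tau> n \<Longrightarrow> ?te (UE n) s \<in> play"
    and others: "\<And>j. j \<in> K \<Longrightarrow> j \<noteq> i \<Longrightarrow> trajectory vP (X j) (UP j n) (\<tau> n) = X j" for n
    using f(1)[of n] unfolding f_eq by (auto simp: P_def)
  have \<tau>_Suc: "\<tau> (Suc n) = \<tau> n + \<delta> (y n)"
    and cohP: "\<And>j s. s < \<tau> n \<Longrightarrow> UP j (Suc n) s = UP j n s" and cohE: "\<And>s. s < \<tau> n \<Longrightarrow> UE (Suc n) s = UE n s"
    and meet: "trajectory vP (X i) (UP i (Suc n)) (\<tau> (Suc n)) = y n" for n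
    using f(2)[of n] unfolding f_eq by (auto simp: Q_def y_def)
  have \<tau>0: "\<tau> 0 = 0" using f(3) by (simp add: \<tau>_def)
  have y_play: "y n \<in> play" for n using play[of "\<tau> n" n] \<tau>_nonneg by (simp add: y_def)
  have smono: "strict_mono \<tau>"
    by (rule strict_monoI_Suc) (use \<tau>_Suc \<delta>_pos y_play in auto)
  then have mono: "mono \<tau>" by (rule strict_mono_mono)
  have adm: "\<And>j. j \<in> K \<Longrightarrow> admP (X j) (UP j n)" "admE e (UE n)" for n
    using fp[of n] by (auto simp: feedback_play_iff)
  have glueE: "?te (glue \<tau> UE w) s = ?te (UE n) s" if "s \<le> \<tau> n" for w s n
    by (rule trajectory_glue) (use cohE mono that in auto)
  show ?thesis
  proof (cases "\<forall>s. \<exists>n. s < \<tau> n")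
    case True
    let ?w = "\<lambda>_. (1, 0) :: point"
    have gP: "admP (X j) (glue \<tau> (UP j) ?w)" if "j \<in> K" for j
      by (rule admissible_glue_unbounded) (use cohP mono adm True that in auto)
    have gE: "admE e (glue \<tau> UE ?w)"
      by (rule admissible_glue_unbounded) (use cohE mono adm True in auto)
    have "fplay K X e \<beta> (\<lambda>j. glue \<tau> (UP j) ?w) (glue \<tau> UE ?w)"
    proof (rule feedback_play_glue[where wP = "\<lambda>_. ?w", OF fp])
      fix s assume "\<And>k. \<tau> k \<le> s"
      then show "\<not> undecided \<Omega> K (\<lambda>j. trajectory vP (X j) (glue \<tau> (UP j) ?w)) (?te (glue \<tau> UE ?w)) s"
        using True by (meson not_less)
    qed (use cohP cohE mono gP gE in auto)
    moreover have "?te (glue \<tau> UE ?w) s \<in> play" if s: "0 \<le> s" for s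
    proof -
      obtain n where "s < \<tau> n" using True by blast
      then show ?thesis using glueE[of s n] play[of s n] s by simp
    qed
    ultimately show ?thesis
      unfolding holds_out_def evader_wins_def by (fastforce simp: play_region_def)
  next
    case False
    then obtain b where "\<And>n. \<tau> n \<le> b" by (auto simp: not_less)
    then obtain T where lim: "\<tau> \<longlonglongrightarrow> T" and le: "\<And>n. \<tau> n \<le> T"
      using incseq_convergent[OF mono] by blast
    have T: "0 \<le> T" using le[of 0] \<tau>0 by simp
    let ?g = "glue \<tau> UE (\<lambda>_. (1, 0))"
    have csg: "control_signal ?g"
      by (rule control_signal_glue) (use cohE mono adm(2)[THEN admissible_controlD(1)] in \<open>auto simp: ext_nonneg_const\<close>)
    define z where "z = ?te ?g T"
    have "(\<lambda>n. ?te ?g (\<tau> n)) \<longlonglongrightarrow> z"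
      unfolding z_def using csg vE_pos lim \<tau>_nonneg by (intro trajectory_tendsto) auto
    moreover have "(\<lambda>n. ?te ?g (\<tau> n)) = y" by (auto simp: y_def glueE)
    ultimately have ylim: "y \<longlonglongrightarrow> z" by simp
    have "(\<lambda>n. \<tau> (Suc n) - \<tau> n) \<longlonglongrightarrow> T - T"
      by (intro tendsto_diff lim LIMSEQ_Suc)
    then have "(\<lambda>n. c * infdist (y n) tline) \<longlonglongrightarrow> 0" by (simp add: \<tau>_Suc \<delta>_def)
    moreover have "(\<lambda>n. c * infdist (y n) tline) \<longlonglongrightarrow> c * infdist z tline"
      by (intro tendsto_intros ylim)
    ultimately have "c * infdist z tline = 0" using LIMSEQ_unique by blast
    then have z: "z \<in> tline"
      using c(1) in_closed_iff_infdist_zero[of tline z] compact_imp_closed[OF compact_target_line] target_line_nonempty by simp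
    then have z\<Omega>: "z \<in> \<Omega>" by (rule target_line_subset)
    obtain wE where wE: "admE z wE" using ex_admissible[OF z\<Omega> vE_pos] by blast
    define x where "x j = (if j = i then z else X j)" for j
    have "\<exists>w. admP (x j) w" if "j \<in> K" for j
      using ex_admissible[OF _ vP_pos] z\<Omega> X that by (auto simp: x_def)
    then obtain wP where wP: "\<And>j. j \<in> K \<Longrightarrow> admP (x j) (wP j)" by metis
    let ?UE = "glue \<tau> UE (\<lambda>s. wE (s - T))" and ?UP = "\<lambda>j. glue \<tau> (UP j) (\<lambda>s. wP j (s - T))"
    have gE: "admE e ?UE \<and> ?te ?UE T = z"
      by (rule admissible_glue_bounded[where \<tau> = \<tau> and U = UE, OF _ smono _ lim \<tau>0 _ _ wE])
        (use cohE adm vE_pos ylim in \<open>auto simp: y_def[abs_def]\<close>)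
    have plim: "(\<lambda>n. trajectory vP (X j) (UP j n) (\<tau> n)) \<longlonglongrightarrow> x j" if "j \<in> K" for j
    proof (cases "j = i")
      case True
      have "(\<lambda>n. trajectory vP (X i) (UP i (Suc n)) (\<tau> (Suc n))) \<longlonglongrightarrow> z"
        using ylim by (simp add: meet)
      then show ?thesis unfolding True x_def by (auto intro: LIMSEQ_imp_Suc)
    next
      case False
      then show ?thesis using others[OF that False] by (simp add: x_def)
    qed
    have gP: "admP (X j) (?UP j) \<and> trajectory vP (X j) (?UP j) T = x j" if "j \<in> K" for j
      by (rule admissible_glue_bounded[where \<tau> = \<tau> and U = "UP j", OF _ smono _ lim \<tau>0 _ plim[OF that] wP[OF that]])
        (use cohP adm vP_pos that in auto)
    \<comment> \<open>A meeting on the target line is no win for the pursuers, but it is enough to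
      deny the evader's.\<close>
    have capture: "trajectory vP (X i) (?UP i) T = ?te ?UE T" using gP[OF i] gE by (simp add: x_def)
    have late: "T \<le> s" if "\<And>n. \<tau> n \<le> s" for s using LIMSEQ_le_const2[OF lim] that by blast
    have "fplay K X e \<beta> ?UP ?UE"
    proof (rule feedback_play_glue[OF fp])
      fix s assume "0 \<le> s" "\<And>k. \<tau> k \<le> s"
      then show "\<not> undecided \<Omega> K (\<lambda>j. trajectory vP (X j) (?UP j)) (?te ?UE) s"
        using capture i T late[of s] by (auto simp: undecided_def)
    qed (use cohP cohE mono gE gP in auto)
    moreover have "\<not> evader_wins \<Omega> K (\<lambda>j. trajectory vP (X j) (?UP j)) (?te ?UE)"
    proof
      assume "evader_wins \<Omega> K (\<lambda>j. trajectory vP (X j) (?UP j)) (?te ?UE)"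
      then obtain s where s: "0 \<le> s" "?te ?UE s \<in> target_region \<Omega>"
        "\<And>r j. r \<in> {0..s} \<Longrightarrow> j \<in> K \<Longrightarrow> trajectory vP (X j) (?UP j) r \<noteq> ?te ?UE r"
        unfolding evader_wins_def by blast
      have "\<not> T \<le> s" using s(3)[of T i] i T capture by auto
      then obtain n where "s < \<tau> n" using late by (meson not_less)
      then show False using glueE[of s n] play[of s n] s by (simp add: play_region_def)
    qed
    ultimately show ?thesis unfolding holds_out_def by blast
  qed
qed

lemma domain_infdist_bound:
  obtains B where "0 < B" "\<And>p. p \<in> \<Omega> \<Longrightarrow> infdist p tline \<le> B"
proof -
  obtain b where b: "0 < b" "\<And>p. p \<in> \<Omega> \<Longrightarrow> norm p \<le> b"
    using bounded_domain unfolding bounded_pos by blast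
  have "infdist p tline \<le> b" if "p \<in> \<Omega>" for p
  proof -
    have "infdist p tline \<le> dist p 0"
      using l_pos by (intro infdist_le) (simp add: target_line_iff)
    then show ?thesis using b(2)[OF that] by simp
  qed
  then show ?thesis using that b(1) by blast
qed

theorem pursuers_dominate_imp_winning:
  assumes K: "finite K" "K \<noteq> {}" and X: "\<And>i. i \<in> K \<Longrightarrow> X i \<in> \<Omega>" and e: "e \<in> play"
    and dom: "pursuers_dominate K X e"
  shows "e \<in> pursuit_winning_region \<Omega> vP vE K X"
proof -
  obtain B where B: "0 < B" "\<And>p. p \<in> \<Omega> \<Longrightarrow> infdist p tline \<le> B" using domain_infdist_bound by blast
  \<comment> \<open>The first bound keeps \<open>\<kappa>\<close> below \<open>l\<close>; the
    second, with its factor 2, makes the evader's path during the chase strictly shorter than its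
    distance to the target line.\<close>
  define c where "c = min (l / B) ((vP - vE) / (2 * vE))"
  have c: "0 < c" "c * B \<le> l" "vE * c < vP - vE"
  proof -
    show "0 < c" using l_pos B vE_pos vE_less by (simp add: c_def)
    have "c * B \<le> l / B * B" using B by (intro mult_right_mono) (auto simp: c_def)
    then show "c * B \<le> l" using B by simp
    have "vE * c \<le> vE * ((vP - vE) / (2 * vE))" using vE_pos by (intro mult_left_mono) (auto simp: c_def)
    then show "vE * c < vP - vE" using vE_pos vE_less by simp
  qed
  show ?thesis
  proof (rule pursuit_induction[where G = "\<lambda>X e. e \<in> pursuit_winning_region \<Omega> vP vE K X" and c = c, OF K X e dom])
    fix X e i
    assume i: "i \<in> K" "\<And>i. i \<in> K \<Longrightarrow> X i \<in> \<Omega>" "e \<in> play" "dist (X i) e \<le> c * infdist e tline"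
    show "e \<in> pursuit_winning_region \<Omega> vP vE K X"
    proof (rule pursuit_chase[where K = K and X = X and i = i, OF i])
      show "0 < c * infdist e tline" using c infdist_target_pos[OF i(3)] by simp
      have "c * infdist e tline \<le> c * B" using B(2)[OF play_domain[OF i(3)]] c by (intro mult_left_mono) auto
      then show "c * infdist e tline \<le> l" using c(2) by linarith
      have "vE * c / (vP - vE) < 1" using c(3) vE_less by simp
      then have "(vE * c / (vP - vE)) * infdist e tline < 1 * infdist e tline"
        using infdist_target_pos[OF i(3)] by (intro mult_strict_right_mono)
      then show "vE * (c * infdist e tline / (vP - vE)) < infdist e tline" by simp
    qed
  next
    fix X Y :: "nat \<Rightarrow> point" and e t
    assume *: "e \<in> play" "0 < t" "vP * t \<le> l" "\<And>i. i \<in> K \<Longrightarrow> X i \<in> \<Omega>" "\<And>i. i \<in> K \<Longrightarrow> Y i \<in> \<Omega>"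
      "\<And>i. i \<in> K \<Longrightarrow> dist (X i) (Y i) \<le> vP * t" "\<And>p. p \<in> tline \<Longrightarrow> vE * t < dist e p"
      "\<And>e'. e' \<in> play \<Longrightarrow> dist e e' \<le> vE * t \<Longrightarrow> e' \<in> pursuit_winning_region \<Omega> vP vE K Y"
    show "e \<in> pursuit_winning_region \<Omega> vP vE K X"
      by (rule pursuit_step[where X = X and Y = Y and t = t]) (use * in auto)
  qed (use c in auto)
qed

theorem pursuers_dominate_imp_holds_out:
  assumes \<beta>: "evader_feedback \<Omega> vP vE K \<beta>"
    and K: "finite K" "K \<noteq> {}" and X: "\<And>i. i \<in> K \<Longrightarrow> X i \<in> \<Omega>" and e: "e \<in> play"
    and dom: "pursuers_dominate K X e"
  shows "holds_out K \<beta> X e"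
proof -
  obtain B where B: "0 < B" "\<And>p. p \<in> \<Omega> \<Longrightarrow> infdist p tline \<le> B" using domain_infdist_bound by blast
  \<comment> \<open>The second bound is \<open>vE \<le> vP * (1 - c * vE)\<close> solved for
    \<open>c\<close>.\<close>
  define c where "c = min (l / (vP * B)) ((1 - vE / vP) / vE)"
  have c: "0 < c" "vE \<le> vP * (1 - c * vE)" "vP * (c * B) \<le> l"
  proof -
    show "0 < c" using l_pos B vE_pos vE_less vP_pos by (simp add: c_def)
    have "c * (vP * B) \<le> l / (vP * B) * (vP * B)" using B vP_pos by (intro mult_right_mono) (auto simp: c_def)
    then show "vP * (c * B) \<le> l" using B vP_pos by (simp add: algebra_simps)
    have "c * vE \<le> (1 - vE / vP) / vE * vE" using vE_pos by (intro mult_right_mono) (auto simp: c_def)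
    then have "vE / vP \<le> 1 - c * vE" using vE_pos by simp
    then have "vP * (vE / vP) \<le> vP * (1 - c * vE)" using vP_pos by (intro mult_left_mono) auto
    then show "vE \<le> vP * (1 - c * vE)" using vP_pos by simp
  qed
  have cB: "vP * (c * infdist p tline) \<le> l" if "p \<in> \<Omega>" for p
  proof -
    have "vP * (c * infdist p tline) \<le> vP * (c * B)" using B(2)[OF that] c vP_pos by simp
    then show ?thesis using c by simp
  qed
  show ?thesis
  proof (rule pursuit_induction[where G = "\<lambda>X e. holds_out K \<beta> X e" and c = "vP * c", OF K X e dom])
    show "0 < vP * c" using vP_pos c by simp
    show "holds_out K \<beta> X e" if "i \<in> K" "\<And>i. i \<in> K \<Longrightarrow> X i \<in> \<Omega>" "e \<in> play" "dist (X i) e \<le> vP * c * infdist e tline" for X e i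
      using that c cB by (intro holds_out_chase[where X = X and i = i and c = c, OF \<beta>]) auto
  next
    fix X Y :: "nat \<Rightarrow> point" and e t
    assume *: "e \<in> play" "0 < t" "vP * t \<le> l" "\<And>i. i \<in> K \<Longrightarrow> X i \<in> \<Omega>" "\<And>i. i \<in> K \<Longrightarrow> Y i \<in> \<Omega>"
      "\<And>i. i \<in> K \<Longrightarrow> dist (X i) (Y i) \<le> vP * t" "\<And>p. p \<in> tline \<Longrightarrow> vE * t < dist e p"
      "\<And>e'. e' \<in> play \<Longrightarrow> dist e e' \<le> vE * t \<Longrightarrow> holds_out K \<beta> Y e'"
    show "holds_out K \<beta> X e"
      by (rule holds_out_step[where X = X and Y = Y and t = t, OF \<beta>]) (use * in auto)
  qed
qed

end

section \<open>Straight runs to the target line\<close>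

context reach_avoid
begin

lemma ex_admissible_straight:
  assumes "x \<in> \<Omega>" "p \<in> \<Omega>" "x \<noteq> p" "0 < v" "0 \<le> t" "v * t \<le> dist x p"
  obtains u where "admissible_control \<Omega> v x u" "\<And>s. s < t \<Longrightarrow> u s = sgn (p - x)"
    "\<And>s. 0 \<le> s \<Longrightarrow> s \<le> t \<Longrightarrow> trajectory v x u s = x + (v * s) *\<^sub>R sgn (p - x)"
proof -
  have d: "norm (sgn (p - x)) = 1" "x + dist x p *\<^sub>R sgn (p - x) = p"
    using assms by (auto simp: norm_sgn sgn_div_norm dist_norm norm_minus_commute)
  have tr: "trajectory v x (\<lambda>_. sgn (p - x)) s \<in> \<Omega>" if "0 \<le> s" "s \<le> t" for s
  proof (rule trajectory_const_in[where r = "dist x p", OF convex_domain assms(1)])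
    have "v * s \<le> v * t" using assms that by simp
    then show "v * s \<le> dist x p" using assms by linarith
  qed (use d assms that in auto)
  obtain w where w: "admissible_control \<Omega> v (trajectory v x (\<lambda>_. sgn (p - x)) t) w"
    using ex_admissible[OF tr] assms by blast
  have "admissible_control \<Omega> v x (switch t (\<lambda>_. sgn (p - x)) w)"
    using d w tr assms by (intro admissible_splice control_signal_const) auto
  then show ?thesis
    by (rule that) (auto simp: switch_def trajectory_splice_le trajectory_const)
qed

definition evader_dominates :: "nat set \<Rightarrow> (nat \<Rightarrow> point) \<Rightarrow> point \<Rightarrow> bool" where
  "evader_dominates K X e \<longleftrightarrow> (\<exists>p\<in>tline. \<forall>i\<in>K. norm (e - p) < vE / vP * norm (X i - p))"

lemma play_neq_target: "e \<in> play \<Longrightarrow> p \<in> tline \<Longrightarrow> e \<noteq> p"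
  by (auto simp: play_iff target_line_iff)

text \<open>The straight run to \<open>p\<close> is a solution of the closed loop. The singularity
  of the direction field at \<open>p\<close> does no harm, because on arrival the game is no longer
  undecided.\<close>

lemma straight_feedback:
  assumes p: "p \<in> tline"
  shows "evader_feedback \<Omega> vP vE K (\<lambda>_ e. sgn (p - e))"
  unfolding evader_feedback_def
proof (intro conjI ballI allI impI)
  show "norm (sgn (p - e)) = 1" if "e \<in> play" for e
    using play_neq_target[OF that p] by (simp add: norm_sgn)
  fix X e uP
  assume X: "X \<in> K \<rightarrow>\<^sub>E \<Omega>" and e: "e \<in> play" and uP: "\<forall>i\<in>K. admP (X i) (uP i)"
  define t where "t = dist e p / vE"
  have t: "0 < t" "vE * t = dist e p" using play_neq_target[OF e p] vE_pos by (auto simp: t_def)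
  obtain u where u: "admE e u" "\<And>s. s < t \<Longrightarrow> u s = sgn (p - e)"
    "\<And>s. 0 \<le> s \<Longrightarrow> s \<le> t \<Longrightarrow> trajectory vE e u s = e + (vE * s) *\<^sub>R sgn (p - e)"
    using ex_admissible_straight[OF play_domain[OF e] target_line_subset[OF p] play_neq_target[OF e p] vE_pos, of t] t
    by auto
  have "u s = sgn (p - trajectory vE e u s)"
    if s: "0 \<le> s" "undecided \<Omega> K (\<lambda>i. trajectory vP (X i) (uP i)) (trajectory vE e u) s" for s
  proof -
    have "s < t"
    proof (rule ccontr)
      assume "\<not> s < t"
      then have "trajectory vE e u t \<in> play" using s t by (auto simp: undecided_def)
      moreover have "trajectory vE e u t = p"
        using u(3)[of t] t play_neq_target[OF e p] by (simp add: sgn_div_norm dist_norm norm_minus_commute)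
      ultimately show False using play_neq_target p by blast
    qed
    have "0 < 1 - vE * s / dist e p"
      using \<open>s < t\<close> t vE_pos by (simp add: t_def field_simps)
    moreover have "p - trajectory vE e u s = (1 - vE * s / dist e p) *\<^sub>R (p - e)"
      using u(3)[of s] s \<open>s < t\<close> by (simp add: sgn_div_norm dist_norm norm_minus_commute divide_inverse algebra_simps)
    ultimately show ?thesis using u(2) \<open>s < t\<close> by (simp add: sgn_scaleR)
  qed
  then have eq: "{s. 0 \<le> s \<and> undecided \<Omega> K (\<lambda>i. trajectory vP (X i) (uP i)) (trajectory vE e u) s \<and>
      u s \<noteq> sgn (p - trajectory vE e u s)} = {}"
    by blast
  have "fplay K X e (\<lambda>_ e. sgn (p - e)) uP u"
    unfolding feedback_play_iff eq using uP u(1) by simp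
  then show "\<exists>uE. fplay K X e (\<lambda>_ e. sgn (p - e)) uP uE" by blast
qed

text \<open>A given solution obeys the feedback only almost everywhere. Replacing \<open>u\<close>
  under the integral by the continuous direction field makes the path differentiable, and
  \<open>norm (trajectory vE e u s - p) + vE * s\<close> has derivative zero.\<close>

lemma straight_feedback_dist:
  assumes p: "p \<in> tline" and fp: "fplay K X e (\<lambda>_ e. sgn (p - e)) uP u"
    and b: "undecided \<Omega> K (\<lambda>i. trajectory vP (X i) (uP i)) (trajectory vE e u) b" and t: "0 \<le> t" "t \<le> b"
  shows "norm (trajectory vE e u t - p) = norm (e - p) - vE * t"
proof -
  let ?X = "trajectory vE e u"
  have adm: "admE e u" using fp by (simp add: feedback_play_iff)
  define f where "f s = sgn (p - ?X s)" for s
  have ne: "?X s \<noteq> p" if "s \<in> {0..b}" for s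
    using b play_neq_target p that unfolding undecided_def by blast
  have contX: "continuous_on {0..b} ?X"
    using vE_pos by (intro continuous_on_subset[OF trajectory_continuous[OF admissible_controlD(1)[OF adm]]]) auto
  have contf: "continuous_on {0..b} f"
    unfolding f_def using ne by (intro continuous_intros contX) (metis right_minus_eq)
  have int: "integral {0..s} u = integral {0..s} f" if "s \<le> b" for s
  proof (rule integral_spike)
    show "negligible {t. 0 \<le> t \<and> undecided \<Omega> K (\<lambda>i. trajectory vP (X i) (uP i)) ?X t \<and> u t \<noteq> sgn (p - ?X t)}"
      using fp by (simp add: feedback_play_iff)
    show "f r = u r" if "r \<in> {0..s} - {t. 0 \<le> t \<and> undecided \<Omega> K (\<lambda>i. trajectory vP (X i) (uP i)) ?X t \<and> u t \<noteq> sgn (p - ?X t)}" for r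
      using that b \<open>s \<le> b\<close> by (auto simp: f_def undecided_def)
  qed
  have "((\<lambda>s. norm (?X s - p) + vE * s) has_vector_derivative 0) (at s within {0..b})" if s: "s \<in> {0..b}" for s
  proof -
    have "((\<lambda>s. e + vE *\<^sub>R integral {0..s} f) has_vector_derivative 0 + vE *\<^sub>R f s) (at s within {0..b})"
      by (intro has_vector_derivative_add has_vector_derivative_const
          bounded_linear.has_vector_derivative[OF bounded_linear_scaleR_right]
          integral_has_vector_derivative contf s)
    then have d0: "((\<lambda>s. e + vE *\<^sub>R integral {0..s} f) has_vector_derivative vE *\<^sub>R f s) (at s within {0..b})"
      by simp
    have X': "(?X has_vector_derivative vE *\<^sub>R f s) (at s within {0..b})"
      by (rule has_vector_derivative_transform[OF s _ d0]) (simp add: trajectory_def int)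
    have "((\<lambda>s. ?X s - p) has_derivative (\<lambda>h. h *\<^sub>R (vE *\<^sub>R f s))) (at s within {0..b})"
      using has_derivative_diff[OF X'[unfolded has_vector_derivative_def] has_derivative_const[of p]] by simp
    then have "((\<lambda>s. norm (?X s - p)) has_derivative (\<lambda>h. (h *\<^sub>R (vE *\<^sub>R f s)) \<bullet> sgn (?X s - p))) (at s within {0..b})"
      using ne[OF s] by (intro has_derivative_compose[OF _ has_derivative_norm]) auto
    moreover have "(h *\<^sub>R (vE *\<^sub>R f s)) \<bullet> sgn (?X s - p) = - (h * vE)" for h
    proof -
      have "sgn (?X s - p) = - f s" by (simp add: f_def sgn_minus[symmetric])
      moreover have "f s \<bullet> f s = 1"
        using ne[OF s] by (simp add: f_def power2_norm_eq_inner[symmetric] norm_sgn)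
      ultimately show ?thesis by simp
    qed
    ultimately have "((\<lambda>s. norm (?X s - p)) has_derivative (\<lambda>h. - (h * vE))) (at s within {0..b})" by simp
    from has_derivative_add[OF this has_derivative_mult_right[OF has_derivative_ident, of vE]]
    show ?thesis
      unfolding has_vector_derivative_def by (simp add: mult.commute)
  qed
  from has_vector_derivative_zero_constant[OF convex_real_interval(5) this]
  obtain c where c: "\<And>s. s \<in> {0..b} \<Longrightarrow> norm (?X s - p) + vE * s = c" by auto
  show ?thesis using c[of 0] c[of t] t by simp
qed

text \<open>On every closed-loop solution a meeting would contradict domination by the triangle
  inequality. Let \<open>T\<close> be the supremum of the undecided times: if the evader were still
  in play at \<open>T\<close>, all conditions would persist a little longer, as they are open and
  \<open>K\<close> is finite.\<close>

theorem evader_dominates_imp_winning: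
  assumes K: "finite K" and e: "e \<in> play" and dom: "evader_dominates K X e"
  shows "e \<in> evasion_winning_region \<Omega> vP vE K X"
proof -
  obtain p where p: "p \<in> tline" "\<And>i. i \<in> K \<Longrightarrow> norm (e - p) < vE / vP * norm (X i - p)"
    using dom by (auto simp: evader_dominates_def)
  let ?\<beta> = "\<lambda>_ e. sgn (p - e)"
  have "evader_wins \<Omega> K (\<lambda>i. trajectory vP (X i) (uP i)) (trajectory vE e u)"
    if fp: "fplay K X e ?\<beta> uP u" for uP u
  proof -
    let ?XP = "\<lambda>i. trajectory vP (X i) (uP i)" and ?XE = "trajectory vE e u"
    have adm: "admE e u" "\<And>i. i \<in> K \<Longrightarrow> admP (X i) (uP i)"
      using fp by (auto simp: feedback_play_iff)
    note dist = straight_feedback_dist[OF p(1) fp]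
    have apart: "?XP i s \<noteq> ?XE s"
      if "i \<in> K" "0 \<le> s" "norm (?XE s - p) = norm (e - p) - vE * s" for i s
    proof
      assume "?XP i s = ?XE s"
      then have "dist (X i) (?XE s) \<le> vP * s"
        using trajectory_dist0[OF adm(2)[OF that(1)], of s] vP_pos that by simp
      then have "norm (X i - p) \<le> vP * s + (norm (e - p) - vE * s)"
        using dist_triangle[of "X i" p "?XE s"] that(3) by (simp add: dist_norm)
      moreover have "vE * s \<le> norm (e - p)" using that(3) norm_ge_zero[of "?XE s - p"] by linarith
      then have "(vP - vE) * (vE * s) \<le> (vP - vE) * norm (e - p)"
        using vE_less by (intro mult_left_mono) auto
      moreover have "vE * norm (X i - p) \<le> vE * (vP * s + (norm (e - p) - vE * s))"
        using calculation(1) vE_pos by (intro mult_left_mono) auto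
      moreover have "vE * (vP * s + (norm (e - p) - vE * s)) = (vP - vE) * (vE * s) + vE * norm (e - p)"
        by (simp add: algebra_simps)
      ultimately have "vE * norm (X i - p) \<le> (vP - vE) * norm (e - p) + vE * norm (e - p)"
        by simp
      also have "\<dots> = vP * norm (e - p)" by (simp add: algebra_simps)
      finally have "vE * norm (X i - p) \<le> vP * norm (e - p)" .
      then show False using p(2)[OF that(1)] vP_pos by (simp add: field_simps)
    qed
    define U where "U = {s. 0 \<le> s \<and> undecided \<Omega> K ?XP ?XE s}"
    have U0: "0 \<in> U"
      using e apart[of _ 0] by (auto simp: U_def undecided_def)
    have U_le: "vE * s \<le> norm (e - p)" if "s \<in> U" for s
      using dist[of s s] that norm_ge_zero[of "?XE s - p"] by (auto simp: U_def)
    have U_down: "r \<in> U" if "s \<in> U" "0 \<le> r" "r \<le> s" for r s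
      using that by (auto simp: U_def undecided_def)
    have bdd: "bdd_above U" using U_le vE_pos by (intro bdd_aboveI[of _ "norm (e - p) / vE"]) (auto simp: field_simps)
    define T where "T = Sup U"
    have T0: "0 \<le> T" using cSup_upper[OF U0 bdd] by (simp add: T_def)
    have below: "s \<in> U" if s: "0 \<le> s" "s < T" for s
    proof -
      obtain r where "r \<in> U" "s < r" using less_cSupE[of s U] s U0 by (auto simp: T_def)
      then show ?thesis using U_down s by simp
    qed
    have distT: "norm (?XE s - p) = norm (e - p) - vE * s" if s: "0 \<le> s" "s \<le> T" for s
    proof (cases "s < T")
      case True
      then show ?thesis using below[of s] dist[of s s] s by (simp add: U_def)
    next
      case False
      then have sT: "s = T" using s by simp
      show ?thesis
      proof (cases "T = 0")
        case False
        have "norm (norm (?XE T - p) - (norm (e - p) - vE * T)) \<le> 0 + \<epsilon>" if "0 < \<epsilon>" for \<epsilon> :: real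
        proof -
          define r where "r = max 0 (T - \<epsilon> / (2 * vE))"
          have r: "0 \<le> r" "r < T" "T - r \<le> \<epsilon> / (2 * vE)"
            using False T0 that vE_pos by (auto simp: r_def)
          have "norm (?XE r - p) = norm (e - p) - vE * r" using below[of r] dist[of r r] r by (simp add: U_def)
          moreover have "norm (?XE T - ?XE r) \<le> vE * (T - r)"
            using r vE_pos by (intro trajectory_speed admissible_controlD(1)[OF adm(1)]) auto
          moreover have "vE * (T - r) \<le> \<epsilon> / 2" using r(3) vE_pos by (simp add: field_simps)
          moreover have "\<bar>norm (?XE T - p) - norm (?XE r - p)\<bar> \<le> norm (?XE T - ?XE r)"
            using norm_triangle_ineq3[of "?XE T - p" "?XE r - p"] by simp
          moreover have "vE * (T - r) = vE * T - vE * r" by (simp add: algebra_simps)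
          ultimately show ?thesis unfolding real_norm_def by linarith
        qed
        then have "norm (norm (?XE T - p) - (norm (e - p) - vE * T)) \<le> 0" by (rule field_le_epsilon)
        then show ?thesis unfolding sT by simp
      qed (simp add: sT)
    qed
    have XE_T: "?XE T \<in> \<Omega>" using adm(1) T0 by (rule admissible_controlD)
    have "?XE T \<in> target_region \<Omega>"
    proof (rule ccontr)
      assume "?XE T \<notin> target_region \<Omega>"
      then have play: "?XE T \<in> play" using XE_T by (simp add: play_region_def)
      have cont: "continuous_on {0..} ?XE" "\<And>i. i \<in> K \<Longrightarrow> continuous_on {0..} (?XP i)"
        using adm vE_pos vP_pos by (auto intro!: trajectory_continuous dest: admissible_controlD(1))
      let ?F = "at T within {0..}"
      have lim: "(?XE \<longlongrightarrow> ?XE T) ?F" "\<And>i. i \<in> K \<Longrightarrow> (?XP i \<longlongrightarrow> ?XP i T) ?F"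
        using cont T0 by (auto simp: continuous_on_def)
      have "eventually (\<lambda>s. snd (?XE s) < 0) ?F"
        using play by (intro order_tendstoD(2)[OF tendsto_snd[OF lim(1)]]) (simp add: play_iff)
      moreover have "eventually (\<lambda>s. \<forall>i\<in>K. ?XP i s \<noteq> ?XE s) ?F"
      proof (rule eventually_ball_finite[OF K], rule ballI)
        fix i assume i: "i \<in> K"
        have "((\<lambda>s. ?XP i s - ?XE s) \<longlongrightarrow> ?XP i T - ?XE T) ?F" by (intro tendsto_diff lim i)
        then have "eventually (\<lambda>s. ?XP i s - ?XE s \<noteq> 0) ?F"
          using apart[OF i T0 distT[OF T0]] by (intro tendsto_imp_eventually_ne) auto
        then show "eventually (\<lambda>s. ?XP i s \<noteq> ?XE s) ?F" by (rule eventually_mono) simp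
      qed
      ultimately have "eventually (\<lambda>s. snd (?XE s) < 0 \<and> (\<forall>i\<in>K. ?XP i s \<noteq> ?XE s)) ?F"
        by (rule eventually_conj)
      then obtain d where d: "0 < d" "\<And>s. 0 \<le> s \<Longrightarrow> s \<noteq> T \<Longrightarrow> dist s T < d \<Longrightarrow> snd (?XE s) < 0 \<and> (\<forall>i\<in>K. ?XP i s \<noteq> ?XE s)"
        unfolding eventually_at by auto
      have "T + d / 2 \<in> U"
        unfolding U_def undecided_def
      proof (safe)
        fix s assume s: "s \<in> {0..T + d / 2}"
        have *: "snd (?XE s) < 0 \<and> (\<forall>i\<in>K. ?XP i s \<noteq> ?XE s)"
        proof (cases "s < T")
          case True
          then show ?thesis using below[of s] s by (auto simp: U_def undecided_def play_iff)
        next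
          case False
          then show ?thesis
            using d(2)[of s] s d(1) play apart[OF _ T0 distT[OF T0]] T0 by (cases "s = T") (auto simp: play_iff dist_real_def)
        qed
        show "?XE s \<in> play" using * admissible_controlD(2)[OF adm(1), of s] s by (auto simp: play_iff)
        show False if "i \<in> K" "?XP i s = ?XE s" for i using * that by blast
      qed (use T0 d in auto)
      then have "T + d / 2 \<le> T" unfolding T_def by (intro cSup_upper bdd)
      then show False using d by simp
    qed
    then show ?thesis
      using T0 apart distT unfolding evader_wins_def by (intro exI[of _ T]) auto
  qed
  then show ?thesis
    using e straight_feedback[OF p(1)] unfolding evasion_winning_region_def by blast
qed

end

section \<open>Neutral positions\<close>

text \<open>The sign compares arrival times at \<open>(x, 0)\<close>: it is negative if the evader
  is there first.\<close>

definition apollonius :: "real \<Rightarrow> point \<Rightarrow> point \<Rightarrow> real \<Rightarrow> real" where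
  "apollonius a z h x = (norm (z - (x, 0)))\<^sup>2 - a\<^sup>2 * (norm (h - (x, 0)))\<^sup>2"

lemma apollonius_eq:
  "apollonius a z h x = (fst z - x)\<^sup>2 + (snd z)\<^sup>2 - a\<^sup>2 * ((fst h - x)\<^sup>2 + (snd h)\<^sup>2)"
  by (simp add: apollonius_def norm_prod_def)

text \<open>Taylor expansion at \<open>x\<close>; the factor
  \<open>a\<^sup>2 * (fst h - x) - (fst z - x)\<close> is half the derivative, on whose sign the
  later case distinctions rest.\<close>

lemma apollonius_shift:
  "apollonius a z h (x + y) = (1 - a\<^sup>2) * y\<^sup>2 + 2 * (a\<^sup>2 * (fst h - x) - (fst z - x)) * y + apollonius a z h x"
  unfolding apollonius_eq by (simp add: power2_eq_square algebra_simps)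

lemma apollonius_le_iff:
  assumes "0 \<le> a"
  shows "apollonius a z h x \<le> 0 \<longleftrightarrow> norm (z - (x, 0)) \<le> a * norm (h - (x, 0))"
    "0 \<le> apollonius a z h x \<longleftrightarrow> a * norm (h - (x, 0)) \<le> norm (z - (x, 0))"
  using power_mono_iff[of "norm (z - (x, 0))" "a * norm (h - (x, 0))" 2]
    power_mono_iff[of "a * norm (h - (x, 0))" "norm (z - (x, 0))" 2] assms
  by (simp_all add: apollonius_def power_mult_distrib)

context reach_avoid
begin

text \<open>The evader runs to a point \<open>p\<close> that no pursuer reaches earlier. A capture
  on the way would let that pursuer, following the evader's remaining path at its own greater speed,
  arrive at \<open>p\<close> too soon.\<close>

lemma not_pursuers_dominate_imp_not_winning:
  assumes z: "z \<in> play" and dom: "\<not> pursuers_dominate K X z"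
  shows "z \<notin> pursuit_winning_region \<Omega> vP vE K X"
proof
  assume "z \<in> pursuit_winning_region \<Omega> vP vE K X"
  then obtain \<gamma> where \<gamma>: "pursuit_strategy \<Omega> vP vE K X z \<gamma>"
    "\<And>u. admE z u \<Longrightarrow>
      pursuers_win \<Omega> K (\<lambda>i. trajectory vP (X i) (\<gamma> u i)) (trajectory vE z u)"
    unfolding pursuit_winning_region_def by blast
  obtain p where p: "p \<in> tline" "\<And>i. i \<in> K \<Longrightarrow> norm (z - p) \<le> vE / vP * norm (X i - p)"
    using dom by (auto simp: pursuers_dominate_def not_less)
  have zp: "z \<noteq> p" using play_neq_target z p by blast
  define t where "t = dist z p / vE"
  have t: "0 < t" "vE * t = dist z p" using zp vE_pos by (auto simp: t_def)
  obtain u where u: "admE z u"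
    "\<And>s. 0 \<le> s \<Longrightarrow> s \<le> t \<Longrightarrow> trajectory vE z u s = z + (vE * s) *\<^sub>R sgn (p - z)"
    using ex_admissible_straight[OF play_domain[OF z] target_line_subset[OF p(1)] zp vE_pos, of t] t
    by (metis less_imp_le order_refl)
  have dist_p: "norm (trajectory vE z u s - p) = norm (z - p) - vE * s" if s: "0 \<le> s" "s \<le> t" for s
  proof -
    have "trajectory vE z u s - p = (1 - vE * s / norm (z - p)) *\<^sub>R (z - p)"
      using u(2)[OF s] zp by (simp add: sgn_div_norm norm_minus_commute divide_inverse algebra_simps)
    moreover have "vE * s \<le> norm (z - p)" using s t vE_pos by (metis dist_norm mult_le_cancel_left_pos)
    ultimately have "norm (trajectory vE z u s - p) = (1 - vE * s / norm (z - p)) * norm (z - p)"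
      using zp by simp
    then show ?thesis using zp by (simp add: left_diff_distrib)
  qed
  obtain r i where r: "0 \<le> r" "i \<in> K" "trajectory vP (X i) (\<gamma> u i) r = trajectory vE z u r"
    "\<And>s. s \<in> {0..r} \<Longrightarrow> trajectory vE z u s \<in> play"
    using \<gamma>(2)[OF u(1)] unfolding pursuers_win_def by blast
  have "r < t"
  proof (rule ccontr)
    assume "\<not> r < t"
    then have "trajectory vE z u t \<in> play" using r(4)[of t] t by auto
    moreover have "trajectory vE z u t = p" using dist_p[of t] t by (simp add: dist_norm)
    ultimately show False using play_neq_target p(1) by blast
  qed
  have "admP (X i) (\<gamma> u i)"
    using \<gamma>(1) u(1) r(2) unfolding pursuit_strategy_def by blast
  then have "dist (X i) (trajectory vE z u r) \<le> vP * r"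
    using trajectory_dist0[of vP "X i" "\<gamma> u i" r] r(1,3) vP_pos by simp
  then have "norm (X i - p) \<le> vP * r + (norm (z - p) - vE * r)"
    using dist_triangle[of "X i" p "trajectory vE z u r"] dist_p[of r] r(1) \<open>r < t\<close> by (simp add: dist_norm)
  moreover have "(vP - vE) * (vE * r) < (vP - vE) * norm (z - p)"
    using \<open>r < t\<close> t vE_pos vE_less by (intro mult_strict_left_mono) (auto simp: dist_norm[symmetric] simp flip: t(2))
  moreover have "vE * norm (X i - p) \<le> vE * (vP * r + (norm (z - p) - vE * r))"
    using calculation(1) vE_pos by (intro mult_left_mono) auto
  moreover have "vE * (vP * r + (norm (z - p) - vE * r)) = (vP - vE) * (vE * r) + vE * norm (z - p)"
    by (simp add: algebra_simps)
  ultimately have "vE * norm (X i - p) < (vP - vE) * norm (z - p) + vE * norm (z - p)"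
    by simp
  also have "\<dots> = vP * norm (z - p)" by (simp add: algebra_simps)
  finally have "vE * norm (X i - p) < vP * norm (z - p)" .
  then show False using p(2)[OF r(2)] vP_pos by (simp add: field_simps)
qed


section \<open>The critical point and deviations from the run to it\<close>

lemma target_line_image: "tline = (\<lambda>x. (x, 0)) ` {0..l}"
proof (rule set_eqI)
  fix p :: point
  show "p \<in> tline \<longleftrightarrow> p \<in> (\<lambda>x. (x, 0)) ` {0..l}"
    by (cases p) (auto simp: target_line_iff)
qed

lemma evader_dominates_iff:
  "evader_dominates K X e \<longleftrightarrow> (\<exists>x\<in>{0..l}. \<forall>i\<in>K. apollonius (vE / vP) e (X i) x < 0)"
proof -
  have "0 \<le> vE / vP" using vE_pos vP_pos by simp
  from apollonius_le_iff(2)[OF this]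
  have "norm (e - (x, 0)) < vE / vP * norm (h - (x, 0)) \<longleftrightarrow> apollonius (vE / vP) e h x < 0" for x h
    by (metis not_le)
  then show ?thesis
    unfolding evader_dominates_def target_line_image by simp
qed

lemma pursuers_dominate_iff:
  "pursuers_dominate K X e \<longleftrightarrow> (\<forall>x\<in>{0..l}. \<exists>i\<in>K. 0 < apollonius (vE / vP) e (X i) x)"
proof -
  have "0 \<le> vE / vP" using vE_pos vP_pos by simp
  from apollonius_le_iff(1)[OF this]
  have "vE / vP * norm (h - (x, 0)) < norm (e - (x, 0)) \<longleftrightarrow> 0 < apollonius (vE / vP) e h x" for x h
    by (metis not_le)
  then show ?thesis
    unfolding pursuers_dominate_def target_line_image by simp
qed

text \<open>One-sided first order condition for the minimum over the target line of the maximum of the quadratic polynomials.\<close>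

lemma ex_tight_pursuer:
  fixes x y :: real
  assumes K: "finite K" and x: "x \<in> {0..l}" "x + y \<in> {0..l}"
    and le: "\<And>i. i \<in> K \<Longrightarrow> apollonius a z (X i) x \<le> 0"
    and ge: "\<And>x. x \<in> {0..l} \<Longrightarrow> \<exists>i\<in>K. 0 \<le> apollonius a z (X i) x"
  shows "\<exists>i\<in>K. apollonius a z (X i) x = 0 \<and> 0 \<le> (a\<^sup>2 * (fst (X i) - x) - (fst z - x)) * y"
proof (rule ccontr)
  assume none: "\<not> ?thesis"
  define b where "b i = (a\<^sup>2 * (fst (X i) - x) - (fst z - x)) * y" for i
  \<comment> \<open>Otherwise all polynomials are negative slightly beyond \<open>x\<close>: those
    vanishing at \<open>x\<close> because of their derivative along \<open>y\<close>, the others by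
    continuity.\<close>
  have "eventually (\<lambda>t. \<forall>i\<in>K. apollonius a z (X i) (x + t * y) < 0) (at_right 0)"
  proof (rule eventually_ball_finite[OF K], rule ballI)
    fix i assume i: "i \<in> K"
    have eq: "apollonius a z (X i) (x + t * y) = t * ((1 - a\<^sup>2) * y\<^sup>2 * t + 2 * b i) + apollonius a z (X i) x" for t
      unfolding apollonius_shift b_def by (simp add: power2_eq_square algebra_simps)
    show "eventually (\<lambda>t. apollonius a z (X i) (x + t * y) < 0) (at_right 0)"
    proof (cases "apollonius a z (X i) x = 0")
      case True
      then have "b i < 0" using none i by (auto simp: b_def not_le)
      have "((\<lambda>t. (1 - a\<^sup>2) * y\<^sup>2 * t + 2 * b i) \<longlongrightarrow> (1 - a\<^sup>2) * y\<^sup>2 * 0 + 2 * b i) (at_right 0)"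
        by (intro tendsto_intros)
      then have "eventually (\<lambda>t. (1 - a\<^sup>2) * y\<^sup>2 * t + 2 * b i < 0) (at_right 0)"
        by (rule order_tendstoD(2)) (use \<open>b i < 0\<close> in auto)
      moreover have "eventually (\<lambda>t. 0 < t) (at_right (0::real))" by (rule eventually_at_right_less)
      ultimately show ?thesis
        by eventually_elim (simp add: eq True mult_pos_neg)
    next
      case False
      then have neg: "apollonius a z (X i) x < 0" using le[OF i] by simp
      have "((\<lambda>t. apollonius a z (X i) (x + t * y)) \<longlongrightarrow> 0 * ((1 - a\<^sup>2) * y\<^sup>2 * 0 + 2 * b i) + apollonius a z (X i) x) (at_right 0)"
        unfolding eq by (intro tendsto_intros)
      then show ?thesis
        by (rule order_tendstoD(2)) (use neg in auto)
    qed
  qed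
  moreover have "eventually (\<lambda>t. 0 < t \<and> t < (1::real)) (at_right 0)"
    by (rule eventually_at_right_real[of 0 1, simplified])
  ultimately have "eventually (\<lambda>t. (\<forall>i\<in>K. apollonius a z (X i) (x + t * y) < 0) \<and> 0 < t \<and> t < 1) (at_right 0)"
    by (rule eventually_conj)
  then obtain t where t: "\<forall>i\<in>K. apollonius a z (X i) (x + t * y) < 0" "0 < t" "t < 1"
    using eventually_happens trivial_limit_at_right_real by blast
  have "(1 - t) *\<^sub>R x + t *\<^sub>R (x + y) \<in> {0..l}"
    using x t by (intro convexD_alt) auto
  then have "x + t * y \<in> {0..l}" by (simp add: algebra_simps)
  then show False using ge t(1) by (meson not_le)
qed

text \<open>The deviation \<open>d\<close> raises the constant term of the quadratic polynomial in \<open>y\<close> by at least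
  \<open>(T - r) / (s - r) * (norm d)\<^sup>2\<close>, which outweighs the change \<open>2 * norm d * \<bar>y\<bar>\<close> of the linear term.\<close>

lemma deviation_positive:
  fixes z h d :: point
  assumes a: "0 < a" "a < 1" and zero: "apollonius a z h x = 0"
    and side: "0 \<le> (a\<^sup>2 * (fst h - x) - (fst z - x)) * y"
    and speed: "norm (((s - r) / T) *\<^sub>R ((x, 0) - z) + d) \<le> (s - r) / T * norm (z - (x, 0))"
    and time: "r < s" "s < T" "s - r < (1 - a\<^sup>2) * (T - r)" and T: "0 < T" and d: "d \<noteq> 0"
  shows "0 < apollonius a (z + (s / T) *\<^sub>R ((x, 0) - z) + d) (h + (s / T) *\<^sub>R ((x, 0) - h)) (x + y)"
proof -
  define k c where "k = 1 - s / T" and "c = (s - r) / T"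
  have k: "0 < k" using time T by (simp add: k_def)
  have c: "0 < c" using time T by (simp add: c_def)
  define q where "q = z - (x, 0)"
  define m where "m = (T - r) / (s - r)"
  have m: "m * c = k + c" "1 < (1 - a\<^sup>2) * m" using time T by (auto simp: m_def c_def k_def field_simps)
  define g where "g = q \<bullet> d"
  \<comment> \<open>Expanded, the speed bound says that the deviation points away from the critical
    point: \<open>d \<bullet> d \<le> 2 * c * (q \<bullet> d)\<close>.\<close>
  have "(norm (d - c *\<^sub>R q))\<^sup>2 \<le> (c * norm q)\<^sup>2"
  proof (rule power_mono)
    have "c *\<^sub>R ((x, 0) - z) + d = d - c *\<^sub>R q" by (simp add: q_def algebra_simps)
    then show "norm (d - c *\<^sub>R q) \<le> c * norm q" using speed by (simp add: c_def q_def)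
  qed simp
  then have "d \<bullet> d \<le> 2 * c * g"
    unfolding power_mult_distrib power2_norm_eq_inner g_def
    by (simp add: algebra_simps inner_commute power2_eq_square)
  then have "k * (d \<bullet> d) \<le> k * (2 * c * g)"
    using k by (intro mult_left_mono) auto
  moreover have "c * (m * (d \<bullet> d)) = k * (d \<bullet> d) + c * (d \<bullet> d)"
    using m(1) by (metis distrib_right mult.assoc mult.commute)
  moreover have "c * (d \<bullet> d + 2 * k * g) = c * (d \<bullet> d) + k * (2 * c * g)"
    by (simp add: algebra_simps)
  ultimately have "c * (m * (d \<bullet> d)) \<le> c * (d \<bullet> d + 2 * k * g)"
    by linarith
  then have md: "m * (d \<bullet> d) \<le> d \<bullet> d + 2 * k * g" using c by simp
  have zero': "(fst q)\<^sup>2 + (snd q)\<^sup>2 = a\<^sup>2 * ((fst h - x)\<^sup>2 + (snd h)\<^sup>2)"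
    using zero by (simp add: apollonius_eq q_def)
  let ?B = "a\<^sup>2 * (fst h - x) - (fst z - x)"
  have fz: "z = (fst q + x, snd q)" by (simp add: q_def)
  have sT: "s / T = 1 - k" by (simp add: k_def)
  let ?L = "apollonius a (z + (s / T) *\<^sub>R ((x, 0) - z) + d) (h + (s / T) *\<^sub>R ((x, 0) - h)) (x + y)"
  let ?M = "(1 - a\<^sup>2) * y\<^sup>2 - 2 * y * fst d + m * (d \<bullet> d)"
  \<comment> \<open>Without deviation both players are on their way to the same point, so the old
    constant term merely scales by \<open>k\<^sup>2\<close> and stays zero.\<close>
  have "?L = (1 - a\<^sup>2) * y\<^sup>2 + 2 * k * (?B * y) - 2 * y * fst d + (d \<bullet> d + 2 * k * g)
        + k\<^sup>2 * ((fst q)\<^sup>2 + (snd q)\<^sup>2 - a\<^sup>2 * ((fst h - x)\<^sup>2 + (snd h)\<^sup>2))"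
    unfolding apollonius_eq sT fz g_def inner_prod_def by (simp add: power2_eq_square algebra_simps)
  moreover have "k\<^sup>2 * ((fst q)\<^sup>2 + (snd q)\<^sup>2 - a\<^sup>2 * ((fst h - x)\<^sup>2 + (snd h)\<^sup>2)) = 0"
    using zero' by simp
  moreover have "0 \<le> 2 * k * (?B * y)" by (rule mult_nonneg_nonneg[OF _ side]) (use k in simp)
  ultimately have "?M \<le> ?L" using md by linarith
  moreover have "0 < ?M"
  proof -
    define b where "b = 1 - a\<^sup>2"
    have b: "0 < b" using a by (simp add: b_def power_less_one_iff abs_square_less_1)
    have dd: "0 < d \<bullet> d" using d by simp
    have fd: "(fst d)\<^sup>2 \<le> d \<bullet> d" by (simp add: inner_prod_def power2_eq_square)
    have "0 < (b * m - 1) * (d \<bullet> d)" using dd m(2) by (simp add: b_def)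
    \<comment> \<open>Completing the square in \<open>y\<close>; the time bound makes the last
      summand positive.\<close>
    moreover have "b * (b * y\<^sup>2 - 2 * y * fst d + m * (d \<bullet> d)) = (b * y - fst d)\<^sup>2 + (d \<bullet> d - (fst d)\<^sup>2) + (b * m - 1) * (d \<bullet> d)"
      by (simp add: power2_eq_square algebra_simps)
    ultimately have "0 < b * (b * y\<^sup>2 - 2 * y * fst d + m * (d \<bullet> d))"
      using fd zero_le_power2[of "b * y - fst d"] by linarith
    then show ?thesis using b by (simp add: b_def zero_less_mult_iff)
  qed
  ultimately show ?thesis by linarith
qed

lemma not_evader_dominates_imp_not_winning:
  assumes K: "finite K" "K \<noteq> {}" and X: "\<And>i. i \<in> K \<Longrightarrow> X i \<in> \<Omega>" and z: "z \<in> play"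
    and ndom: "\<not> pursuers_dominate K X z" "\<not> evader_dominates K X z"
  shows "z \<notin> evasion_winning_region \<Omega> vP vE K X"
proof
  assume "z \<in> evasion_winning_region \<Omega> vP vE K X"
  then obtain \<beta> where \<beta>: "evader_feedback \<Omega> vP vE K \<beta>"
    and win: "\<And>uP uE. fplay K X z \<beta> uP uE \<Longrightarrow>
      evader_wins \<Omega> K (\<lambda>i. trajectory vP (X i) (uP i)) (trajectory vE z uE)"
    unfolding evasion_winning_region_def by blast
  define a where "a = vE / vP"
  have a: "0 < a" "a < 1" "vE = a * vP" using vE_pos vE_less vP_pos by (auto simp: a_def)
  obtain x where x: "x \<in> {0..l}" "\<And>i. i \<in> K \<Longrightarrow> apollonius a z (X i) x \<le> 0"
    using ndom(1) by (auto simp: pursuers_dominate_iff a_def not_less)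
  have ge: "\<exists>i\<in>K. 0 \<le> apollonius a z (X i) x" if "x \<in> {0..l}" for x
    using ndom(2) that by (auto simp: evader_dominates_iff a_def not_less)
  let ?p = "(x, 0::real)"
  have p: "?p \<in> tline" using x(1) by (simp add: target_line_iff)
  have zp: "z \<noteq> ?p" using play_neq_target z p by blast
  define T where "T = dist z ?p / vE"
  have T: "0 < T" "vE * T = dist z ?p" using zp vE_pos by (auto simp: T_def)
  have Xp: "vP * T \<le> dist (X i) ?p" if "i \<in> K" for i
  proof -
    have "dist z ?p \<le> a * dist (X i) ?p"
      using x(2)[OF that] a by (simp add: apollonius_le_iff dist_norm)
    then have "a * (vP * T) \<le> a * dist (X i) ?p" using T(2) a(3) by (simp add: mult.assoc)
    then show ?thesis using a by simp
  qed
  have "\<exists>u. admP (X i) u \<and>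
      (\<forall>s\<in>{0..T}. trajectory vP (X i) u s = X i + (vP * s) *\<^sub>R sgn (?p - X i))" if i: "i \<in> K" for i
  proof -
    have "X i \<noteq> ?p" using Xp[OF i] T vP_pos by (auto simp: mult_le_0_iff)
    then show ?thesis
      using ex_admissible_straight[OF X[OF i] target_line_subset[OF p] _ vP_pos less_imp_le[OF T(1)] Xp[OF i]]
      by (metis atLeastAtMost_iff)
  qed
  then obtain w where w: "\<And>i. i \<in> K \<Longrightarrow> admP (X i) (w i)"
    "\<And>i s. i \<in> K \<Longrightarrow> 0 \<le> s \<Longrightarrow> s \<le> T \<Longrightarrow> trajectory vP (X i) (w i) s = X i + (vP * s) *\<^sub>R sgn (?p - X i)"
    by (metis atLeastAtMost_iff)
  let ?XP = "\<lambda>i. trajectory vP (X i) (w i)"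
  have tight: "?XP i s = X i + (s / T) *\<^sub>R (?p - X i)"
    if i: "i \<in> K" "apollonius a z (X i) x = 0" and s: "0 \<le> s" "s \<le> T" for i s
  proof -
    have "dist z ?p = a * dist (X i) ?p"
      using i(2) a apollonius_le_iff[of a z "X i" x] by (simp add: dist_norm)
    then have "a * (vP * T) = a * dist (X i) ?p" using T(2) a(3) by (simp add: mult.assoc)
    then have "dist (X i) ?p = vP * T" using a by simp
    then have "norm (?p - X i) = vP * T" by (simp add: dist_norm norm_minus_commute)
    then show ?thesis using w(2)[OF i(1) s] vP_pos by (simp add: sgn_div_norm divide_inverse)
  qed
  define st where "st s = z + (s / T) *\<^sub>R (?p - z)" for s
  have st: "snd (st s) < 0" if "0 \<le> s" "s < T" for s
  proof -
    have "snd (st s) = (1 - s / T) * snd z" by (simp add: st_def algebra_simps)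
    moreover have "0 < 1 - s / T" using that T by simp
    ultimately show ?thesis using z by (simp add: play_iff mult_pos_neg)
  qed
  have st_dist: "norm (st s - st r) = vE * \<bar>s - r\<bar>" for s r
  proof -
    have "st s - st r = ((s - r) / T) *\<^sub>R (?p - z)" by (simp add: st_def diff_divide_distrib algebra_simps)
    then have "norm (st s - st r) = \<bar>s - r\<bar> / T * dist z ?p" using T by (simp add: dist_norm norm_minus_commute)
    also have "\<dots> = vE * \<bar>s - r\<bar>" using T unfolding T(2)[symmetric] by simp
    finally show ?thesis .
  qed
  obtain u where u: "fplay K X z \<beta> w u"
    using ex_feedback_play[where X = X and uP = w, OF \<beta> w(1) z] by blast
  let ?XE = "trajectory vE z u"
  have adm: "admE z u" using u by (simp add: feedback_play_iff)
  have cs: "control_signal u" using adm by (rule admissible_controlD)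
  obtain t where t: "0 \<le> t" "?XE t \<in> target_region \<Omega>" "\<And>s i. s \<in> {0..t} \<Longrightarrow> i \<in> K \<Longrightarrow> ?XP i s \<noteq> ?XE s"
    using win[OF u] unfolding evader_wins_def by blast
  have st_closed: "?XE r = st r" if r: "0 \<le> r" "\<And>s. 0 \<le> s \<Longrightarrow> s < r \<Longrightarrow> ?XE s = st s" for r
  proof (cases "r = 0")
    case True
    then show ?thesis by (simp add: st_def)
  next
    case False
    have "norm (?XE r - st r) \<le> 0 + e" if "0 < e" for e :: real
    proof -
      define s where "s = max 0 (r - e / (2 * vE))"
      have s: "0 \<le> s" "s < r" "r - s \<le> e / (2 * vE)" using False r(1) that vE_pos by (auto simp: s_def)
      have "?XE r - st r = (?XE r - ?XE s) - (st r - st s)" using r(2)[of s] s by simp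
      then have "norm (?XE r - st r) \<le> norm (?XE r - ?XE s) + norm (st r - st s)"
        by (metis norm_triangle_ineq4)
      also have "norm (?XE r - ?XE s) \<le> vE * (r - s)" using cs vE_pos s by (intro trajectory_speed) auto
      also have "norm (st r - st s) = vE * (r - s)" using s by (simp add: st_dist)
      finally have "norm (?XE r - st r) \<le> 2 * (vE * (r - s))" by simp
      also have "2 * (vE * (r - s)) \<le> e" using s(3) vE_pos by (simp add: field_simps)
      finally show ?thesis by simp
    qed
    then have "norm (?XE r - st r) \<le> 0" by (rule field_le_epsilon)
    then show ?thesis by simp
  qed
  show False
  proof (cases "\<forall>s. 0 \<le> s \<and> s < T \<longrightarrow> ?XE s = st s")
    case True
    then have "?XE T = st T" using st_closed[of T] T by simp
    then have "?XE T = ?p" using T by (simp add: st_def)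
    \<comment> \<open>A tight pursuer is at the critical point at \<open>T\<close> as well, so the
      evader would have to win before \<open>T\<close>, while still below the axis.\<close>
    moreover obtain i where i: "i \<in> K" "apollonius a z (X i) x = 0"
      using ge[OF x(1)] x(2) by (meson antisym)
    then have "?XP i T = ?p" using tight[of i T] T by simp
    ultimately have "t < T" using t(3)[of T i] i T by (auto simp: not_le[symmetric])
    then show False using True t st[of t] by (auto simp: target_region_iff)
  next
    case False
    define D where "D = {s. 0 \<le> s \<and> s < T \<and> ?XE s \<noteq> st s}"
    have D: "D \<noteq> {}" "bdd_below D" using False by (auto simp: D_def intro!: bdd_belowI[of _ 0])
    define r where "r = Inf D"
    have r0: "0 \<le> r" using D unfolding r_def by (intro cInf_greatest) (auto simp: D_def)
    have "r < T"
    proof -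
      obtain s where "s \<in> D" using D by blast
      then show ?thesis using cInf_lower[OF _ D(2), of s] by (auto simp: r_def D_def)
    qed
    have before: "?XE s = st s" if "0 \<le> s" "s < r" for s
      using cInf_lower[OF _ D(2), of s] that \<open>r < T\<close> by (auto simp: r_def D_def)
    then have at_r: "?XE r = st r" using st_closed r0 by blast
    \<comment> \<open>The deviation must be caught this soon after \<open>r\<close> for
      \<open>deviation_positive\<close> to apply. The set \<open>D\<close> need not be an interval,
      hence domination is claimed only at times when the evader is off the straight run.\<close>
    have "r < r + (1 - a\<^sup>2) * (T - r)"
      using \<open>r < T\<close> a by (simp add: power_less_one_iff abs_square_less_1)
    then obtain q where q: "q \<in> D" "q < r + (1 - a\<^sup>2) * (T - r)"
      using cInf_lessD[OF D(1), of "r + (1 - a\<^sup>2) * (T - r)"] unfolding r_def by blast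
    have rq: "r < q"
    proof -
      have "r \<le> q" using cInf_lower[OF q(1) D(2)] by (simp add: r_def)
      moreover have "r \<noteq> q" using q at_r by (auto simp: D_def)
      ultimately show ?thesis by simp
    qed
    have dominate: "pursuers_dominate K (\<lambda>i. ?XP i s) (?XE s)"
      if s: "r < s" "s \<le> q" "?XE s \<noteq> st s" for s
      unfolding pursuers_dominate_iff
    proof
      fix x' assume x': "x' \<in> {0..l}"
      have sT: "0 \<le> s" "s < T" using s q r0 by (auto simp: D_def)
      obtain i where i: "i \<in> K" "apollonius a z (X i) x = 0"
        "0 \<le> (a\<^sup>2 * (fst (X i) - x) - (fst z - x)) * (x' - x)"
        \<comment> \<open>The tight pursuer depends on the side of \<open>x\<close> on which
          \<open>x'\<close> lies.\<close>
        using ex_tight_pursuer[OF K(1) x(1) _ x(2) ge, of "x' - x"] x' by auto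
      define d where "d = ?XE s - st s"
      have "0 < apollonius a (z + (s / T) *\<^sub>R (?p - z) + d) (X i + (s / T) *\<^sub>R (?p - X i)) (x + (x' - x))"
      proof (rule deviation_positive[OF a(1,2) i(2,3)])
        have "((s - r) / T) *\<^sub>R (?p - z) + d = ?XE s - ?XE r"
          unfolding at_r d_def by (simp add: st_def diff_divide_distrib algebra_simps)
        moreover have "norm (?XE s - ?XE r) \<le> vE * (s - r)"
          using cs vE_pos r0 s by (intro trajectory_speed) auto
        moreover have "(s - r) / T * norm (z - ?p) = vE * (s - r)"
          using T by (simp add: dist_norm[symmetric] flip: T(2))
        ultimately show "norm (((s - r) / T) *\<^sub>R (?p - z) + d) \<le> (s - r) / T * norm (z - ?p)" by simp
      qed (use s q sT T in \<open>auto simp: d_def\<close>)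
      then show "\<exists>i\<in>K. 0 < apollonius (vE / vP) (?XE s) (?XP i s) x'"
        using i(1) tight[OF i(1,2), of s] sT by (intro bexI[of _ i]) (auto simp: d_def st_def a_def)
    qed
    \<comment> \<open>On the straight run the evader is below the axis; off it the pursuers
      dominate, which excludes a position on the target line.\<close>
    have off: "?XE s \<notin> tline" if s: "0 \<le> s" "s \<le> q" for s
    proof (cases "?XE s = st s")
      case True
      then show ?thesis using st[of s] s q by (auto simp: D_def target_line_iff)
    next
      case False
      have "r < s" using before[of s] at_r False s by (metis less_linear)
      then have dom: "pursuers_dominate K (\<lambda>i. ?XP i s) (?XE s)" using dominate False s by blast
      show ?thesis
      proof
        assume "?XE s \<in> tline"
        then obtain i where "vE / vP * norm (?XP i s - ?XE s) < norm (?XE s - ?XE s)"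
          using dom unfolding pursuers_dominate_def by blast
        moreover have "0 \<le> vE / vP * norm (?XP i s - ?XE s)" using vE_pos vP_pos by simp
        ultimately show False by simp
      qed
    qed
    have play: "?XE s \<in> play" if s: "0 \<le> s" "s \<le> q" for s
    proof (rule stays_in_play[OF _ _ _ off s])
      show "continuous_on {0..} ?XE" using cs vE_pos by (intro trajectory_continuous) auto
      show "?XE t \<in> \<Omega>" if "0 \<le> t" for t using adm that by (rule admissible_controlD)
    qed (use z in simp)
    have q0: "0 \<le> q" using rq r0 by simp
    have "holds_out K \<beta> (\<lambda>i. ?XP i q) (?XE q)"
    proof (rule pursuers_dominate_imp_holds_out[OF \<beta> K])
      show "?XP i q \<in> \<Omega>" if "i \<in> K" for i using w(1)[OF that] q0 by (rule admissible_controlD)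
      show "?XE q \<in> play" using play q0 by simp
      show "pursuers_dominate K (\<lambda>i. ?XP i q) (?XE q)" using dominate[of q] rq q(1) by (simp add: D_def)
    qed
    then have "holds_out K \<beta> X z" using holds_out_splice[OF u q0 play] by blast
    then show False using win unfolding holds_out_def by blast
  qed
qed

theorem barrier_eq:
  assumes K: "finite K" "K \<noteq> {}" and X: "\<And>i. i \<in> K \<Longrightarrow> X i \<in> \<Omega>"
  shows "barrier \<Omega> vP vE K X = {z \<in> play. \<not> pursuers_dominate K X z \<and> \<not> evader_dominates K X z}"
  using pursuers_dominate_imp_winning[where X = X, OF K X] evader_dominates_imp_winning[OF K(1)]
    not_pursuers_dominate_imp_not_winning not_evader_dominates_imp_not_winning[where X = X, OF K X]
  unfolding barrier_def by blast

end

section \<open>The explicit curves\<close>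

lemma equidistant_point:
  assumes "fst h1 \<noteq> fst h2"
  shows "snd (equidistant_point h1 h2) = 0"
    "norm (equidistant_point h1 h2 - h1) = norm (equidistant_point h1 h2 - h2)"
proof -
  define c where "c = ((fst h2)\<^sup>2 + (snd h2)\<^sup>2 - (fst h1)\<^sup>2 - (snd h1)\<^sup>2) / (2 * (fst h2 - fst h1))"
  have "snd p = 0 \<and> norm (p - h1) = norm (p - h2) \<longleftrightarrow> p = (c, 0)" for p :: point
  proof -
    obtain x y where p: "p = (x, y)" by (cases p)
    have "norm (p - h1) = norm (p - h2) \<longleftrightarrow> x = c" if "y = 0"
    proof -
      have "norm (p - h1) = norm (p - h2) \<longleftrightarrow> (x - fst h1)\<^sup>2 + (snd h1)\<^sup>2 = (x - fst h2)\<^sup>2 + (snd h2)\<^sup>2"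
        using that by (simp add: p norm_prod_def)
      also have "\<dots> \<longleftrightarrow> x * (2 * (fst h2 - fst h1)) = (fst h2)\<^sup>2 + (snd h2)\<^sup>2 - (fst h1)\<^sup>2 - (snd h1)\<^sup>2"
        by (auto simp: power2_eq_square algebra_simps)
      also have "\<dots> \<longleftrightarrow> x = c" using assms by (auto simp: c_def eq_divide_eq)
      finally show ?thesis .
    qed
    then show ?thesis by (auto simp: p)
  qed
  then have "\<exists>!p. snd p = 0 \<and> norm (p - h1) = norm (p - h2)" by simp
  from theI'[OF this] show "snd (equidistant_point h1 h2) = 0"
    "norm (equidistant_point h1 h2 - h1) = norm (equidistant_point h1 h2 - h2)"
    unfolding equidistant_point_def by blast+
qed

definition sqdist :: "point \<Rightarrow> real \<Rightarrow> real" where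
  "sqdist h x = (fst h - x)\<^sup>2 + (snd h)\<^sup>2"

lemma sqdist_less_iff: "sqdist h x < sqdist h' x \<longleftrightarrow> norm (h - (x, 0)) < norm (h' - (x, 0))"
  by (simp add: sqdist_def norm_prod_def)

lemma sqdist_equidistant_point:
  assumes "fst h1 \<noteq> fst h2"
  shows "sqdist h1 (fst (equidistant_point h1 h2)) = sqdist h2 (fst (equidistant_point h1 h2))"
proof -
  obtain c where "equidistant_point h1 h2 = (c, 0)"
    using equidistant_point(1)[OF assms] by (cases "equidistant_point h1 h2") auto
  then show ?thesis
    using equidistant_point(2)[OF assms] by (simp add: sqdist_def norm_prod_def power2_commute[of c])
qed

text \<open>The quadratic terms cancel: the difference is affine in \<open>x\<close>, so two
  pursuers with different abscissae change their order at exactly one point.\<close>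

lemma sqdist_diff: "sqdist h x - sqdist h' x = sqdist h y - sqdist h' y + 2 * (fst h' - fst h) * (x - y)"
  by (simp add: sqdist_def power2_eq_square algebra_simps)

lemma sqdist_order:
  assumes "fst h < fst h'" "sqdist h c = sqdist h' c"
  shows "sqdist h x \<le> sqdist h' x \<longleftrightarrow> x \<le> c" "sqdist h' x \<le> sqdist h x \<longleftrightarrow> c \<le> x"
    "sqdist h x < sqdist h' x \<longleftrightarrow> x < c" "sqdist h' x < sqdist h x \<longleftrightarrow> c < x"
proof -
  have *: "sqdist h x - sqdist h' x = 2 * (fst h' - fst h) * (x - c)"
    using sqdist_diff[of h x h' c] assms by simp
  have p: "0 < 2 * (fst h' - fst h)" using assms by simp
  have "sqdist h x - sqdist h' x \<le> 0 \<longleftrightarrow> x \<le> c" "0 \<le> sqdist h x - sqdist h' x \<longleftrightarrow> c \<le> x"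
    unfolding * using p by (simp_all add: mult_le_0_iff zero_le_mult_iff)
  then show "sqdist h x \<le> sqdist h' x \<longleftrightarrow> x \<le> c" "sqdist h' x \<le> sqdist h x \<longleftrightarrow> c \<le> x"
    "sqdist h x < sqdist h' x \<longleftrightarrow> x < c" "sqdist h' x < sqdist h x \<longleftrightarrow> c < x"
    by auto
qed

lemma apollonius_sqdist: "apollonius a z h x = (fst z - x)\<^sup>2 + (snd z)\<^sup>2 - a\<^sup>2 * sqdist h x"
  by (simp add: apollonius_eq sqdist_def)

lemma apollonius_zero_iff:
  assumes "0 \<le> a"
  shows "apollonius a z h x = 0 \<longleftrightarrow> norm (z - (x, 0)) = a * norm (h - (x, 0))"
  using apollonius_le_iff[OF assms, of z h x] by linarith

text \<open>The conic in the base curves arises as the set of positions for which the quadratic polynomial has a double root.\<close>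

lemma apollonius_vertex:
  assumes "0 < a" "a < 1" "fst z = (1 - a\<^sup>2) * x + a\<^sup>2 * fst h"
  shows "apollonius a z h x = 0 \<longleftrightarrow>
    (fst z - fst h)\<^sup>2 + (1 - 1 / a\<^sup>2) * (snd z)\<^sup>2 + (1 - a\<^sup>2) * (snd h)\<^sup>2 = 0"
proof -
  define b where "b = 1 - a\<^sup>2"
  have b: "0 < b" using assms by (simp add: b_def power_less_one_iff abs_square_less_1)
  \<comment> \<open>The third assumption says that the vertex of the parabola lies at
    \<open>x\<close>.\<close>
  have zh: "fst z - fst h = b * (x - fst h)" "fst z - x = a\<^sup>2 * (fst h - x)"
    using assms(3) by (simp_all add: b_def algebra_simps)
  have "(fst z - fst h)\<^sup>2 + (1 - 1 / a\<^sup>2) * (snd z)\<^sup>2 + b * (snd h)\<^sup>2 = 0 \<longleftrightarrow>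
      a\<^sup>2 * ((fst z - fst h)\<^sup>2 + (1 - 1 / a\<^sup>2) * (snd z)\<^sup>2 + b * (snd h)\<^sup>2) = 0"
    using assms(1) by simp
  also have "a\<^sup>2 * ((fst z - fst h)\<^sup>2 + (1 - 1 / a\<^sup>2) * (snd z)\<^sup>2 + b * (snd h)\<^sup>2)
      = a\<^sup>2 * (b * (x - fst h))\<^sup>2 + a\<^sup>2 * (1 - 1 / a\<^sup>2) * (snd z)\<^sup>2 + a\<^sup>2 * b * (snd h)\<^sup>2"
    unfolding zh(1) by (simp add: algebra_simps)
  also have "a\<^sup>2 * (1 - 1 / a\<^sup>2) = - b"
    using assms(1) by (simp add: b_def algebra_simps)
  also have "a\<^sup>2 * (b * (x - fst h))\<^sup>2 + - b * (snd z)\<^sup>2 + a\<^sup>2 * b * (snd h)\<^sup>2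
      = - b * ((a\<^sup>2 * (fst h - x))\<^sup>2 + (snd z)\<^sup>2 - a\<^sup>2 * ((fst h - x)\<^sup>2 + (snd h)\<^sup>2))"
    by (simp add: b_def power2_eq_square algebra_simps)
  also have "\<dots> = 0 \<longleftrightarrow> apollonius a z h x = 0"
    unfolding apollonius_eq zh(2) using b by simp
  finally show ?thesis by (simp add: b_def)
qed

section \<open>Minimisation over the cells of nearest pursuers\<close>

lemma quadratic_nonneg_imp:
  fixes A D \<epsilon> :: real
  assumes "0 < \<epsilon>" "\<And>y. 0 < y \<Longrightarrow> y \<le> \<epsilon> \<Longrightarrow> 0 \<le> A * y\<^sup>2 + 2 * D * y"
  shows "0 \<le> D"
proof (rule ccontr)
  assume "\<not> 0 \<le> D"
  then have D: "D < 0" by simp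
  \<comment> \<open>Small enough for \<open>A * y \<le> - D\<close>, so that
    \<open>A * y + 2 * D \<le> D < 0\<close>.\<close>
  define y where "y = min \<epsilon> (- D / (\<bar>A\<bar> + 1))"
  have y: "0 < y" "y \<le> \<epsilon>" "y * (\<bar>A\<bar> + 1) \<le> - D"
  proof -
    show "0 < y" using assms(1) D by (simp add: y_def divide_neg_pos add_nonneg_pos)
    have "y * (\<bar>A\<bar> + 1) \<le> - D / (\<bar>A\<bar> + 1) * (\<bar>A\<bar> + 1)" by (intro mult_right_mono) (auto simp: y_def)
    then show "y * (\<bar>A\<bar> + 1) \<le> - D" by simp
  qed (simp add: y_def)
  have "A * y \<le> \<bar>A\<bar> * y" using y(1) by (intro mult_right_mono) auto
  also have "\<dots> \<le> y * (\<bar>A\<bar> + 1)" using y(1) by (simp add: algebra_simps)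
  finally have "A * y \<le> y * (\<bar>A\<bar> + 1)" .
  then have "A * y + 2 * D < 0" using y(3) D by linarith
  then have "y * (A * y + 2 * D) < 0" using y(1) by (simp add: mult_pos_neg)
  then show False using assms(2)[OF y(1,2)] by (simp add: power2_eq_square algebra_simps)
qed

text \<open>Cell \<open>i\<close> of the Voronoi diagram on the target line will be the interval
  from \<open>breakpoint l n h (i - 1)\<close> to \<open>breakpoint l n h i\<close>; counting both
  ends of the target line as breakpoints makes this uniform in \<open>i\<close>.\<close>

definition breakpoint :: "real \<Rightarrow> nat \<Rightarrow> (nat \<Rightarrow> point) \<Rightarrow> nat \<Rightarrow> real" where
  "breakpoint l n h i = (if i = 0 then 0 else if i < n then fst (equidistant_point (h i) (h (i + 1))) else l)"

text \<open>The point \<open>q i\<close> witnesses that \<open>h i\<close> is active; these points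
  force the breakpoints into increasing order.\<close>

locale active_listing =
  fixes l a :: real and n :: nat and h :: "nat \<Rightarrow> point" and q :: "nat \<Rightarrow> real"
  assumes l: "0 < l" and a: "0 < a" "a < 1" and n: "1 \<le> n"
    and incr: "\<And>i j. 1 \<le> i \<Longrightarrow> i < j \<Longrightarrow> j \<le> n \<Longrightarrow> fst (h i) < fst (h j)"
    and q: "\<And>i. 1 \<le> i \<Longrightarrow> i \<le> n \<Longrightarrow> 0 \<le> q i \<and> q i \<le> l"
    and nearest: "\<And>i j. 1 \<le> i \<Longrightarrow> i \<le> n \<Longrightarrow> 1 \<le> j \<Longrightarrow> j \<le> n \<Longrightarrow> i \<noteq> j \<Longrightarrow> sqdist (h i) (q i) < sqdist (h j) (q i)"
begin

abbreviation "b \<equiv> breakpoint l n h"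
abbreviation "slope z i x \<equiv> a\<^sup>2 * (fst (h i) - x) - (fst z - x)"

lemma b_ends [simp]: "b 0 = 0" "b n = l"
  using n by (auto simp: breakpoint_def)

lemma b_eq: "1 \<le> i \<Longrightarrow> i < n \<Longrightarrow> sqdist (h i) (b i) = sqdist (h (Suc i)) (b i)"
  using sqdist_equidistant_point[of "h i" "h (Suc i)"] incr[of i "Suc i"] by (simp add: breakpoint_def)

lemma sqdist_Suc:
  assumes "1 \<le> i" "i < n"
  shows "sqdist (h i) x \<le> sqdist (h (Suc i)) x \<longleftrightarrow> x \<le> b i" "sqdist (h (Suc i)) x \<le> sqdist (h i) x \<longleftrightarrow> b i \<le> x"
    "sqdist (h i) x < sqdist (h (Suc i)) x \<longleftrightarrow> x < b i" "sqdist (h (Suc i)) x < sqdist (h i) x \<longleftrightarrow> b i < x"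
  using sqdist_order[OF incr[of i "Suc i"] b_eq[OF assms]] assms by auto

text \<open>Comparison with the two neighbours alone puts each witness into its own cell, strictly
  so at inner breakpoints; hence no cell degenerates.\<close>

lemma q_between:
  assumes "1 \<le> i" "i \<le> n"
  shows "b (i - 1) \<le> q i" "q i \<le> b i" "1 < i \<Longrightarrow> b (i - 1) < q i" "i < n \<Longrightarrow> q i < b i"
proof -
  show 1: "b (i - 1) < q i" if "1 < i"
    using nearest[of i "i - 1"] sqdist_Suc(4)[of "i - 1" "q i"] that assms by simp
  show 2: "q i < b i" if "i < n"
    using nearest[of i "Suc i"] sqdist_Suc(3)[of i "q i"] that assms by simp
  show "b (i - 1) \<le> q i" using 1 q[of i] assms by (cases "i = 1") auto
  show "q i \<le> b i" using 2 q[of i] assms by (cases "i = n") auto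
qed

lemma b_less_Suc:
  assumes "i < n" shows "b i < b (Suc i)"
proof -
  have "b i \<le> q (Suc i)" "q (Suc i) \<le> b (Suc i)" "0 < i \<Longrightarrow> b i < q (Suc i)" "Suc i < n \<Longrightarrow> q (Suc i) < b (Suc i)"
    using q_between[of "Suc i"] assms by simp_all
  then show ?thesis
    using l assms b_ends by (metis Suc_lessI le_less_trans less_le_trans neq0_conv)
qed

lemma b_mono: "i \<le> j \<Longrightarrow> j \<le> n \<Longrightarrow> b i \<le> b j"
proof (induction j rule: dec_induct)
  case (step m)
  then show ?case using b_less_Suc[of m] by simp
qed simp

lemma b_range: "i \<le> n \<Longrightarrow> b i \<in> {0..l}"
  using b_mono[of 0 i] b_mono[of i n] by simp

text \<open>Comparisons of neighbours are chained from \<open>i\<close> to \<open>j\<close>, since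
  \<open>x\<close> lies on the same side of all breakpoints in between.\<close>

lemma cell_nearest:
  assumes i: "1 \<le> i" "i \<le> n" and x: "b (i - 1) \<le> x" "x \<le> b i" and j: "1 \<le> j" "j \<le> n"
  shows "sqdist (h i) x \<le> sqdist (h j) x"
proof (cases "i \<le> j")
  case True
  then show ?thesis using j(2)
  proof (induction j rule: dec_induct)
    case (step m)
    have "x \<le> b m" using x(2) b_mono[of i m] step by simp
    then have "sqdist (h m) x \<le> sqdist (h (Suc m)) x" using sqdist_Suc(1)[of m x] step i by simp
    then show ?case using step by simp
  qed simp
next
  case False
  then have "j \<le> i" by simp
  then show ?thesis using j(1)
  proof (induction j rule: inc_induct)
    case (step m)
    have "m \<le> i - 1" "i - 1 \<le> n" using step i by auto
    then have "b m \<le> x" using x(1) b_mono[of m "i - 1"] by simp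
    then have "sqdist (h (Suc m)) x \<le> sqdist (h m) x" using sqdist_Suc(2)[of m x] step i by simp
    then show ?case using step by simp
  qed simp
qed

lemma cell_apollonius:
  assumes "1 \<le> i" "i \<le> n" "b (i - 1) \<le> x" "x \<le> b i" "1 \<le> j" "j \<le> n"
  shows "apollonius a z (h j) x \<le> apollonius a z (h i) x"
  using cell_nearest[OF assms] by (simp add: apollonius_sqdist mult_left_mono)

lemma ex_cell:
  assumes "x \<in> {0..l}"
  obtains i where "1 \<le> i" "i \<le> n" "b (i - 1) \<le> x" "x \<le> b i"
proof -
  define i where "i = (LEAST i. 1 \<le> i \<and> x \<le> b i)"
  have ex: "1 \<le> n \<and> x \<le> b n" using assms n by simp
  have i: "1 \<le> i \<and> x \<le> b i" unfolding i_def by (rule LeastI[where P = "\<lambda>i. 1 \<le> i \<and> x \<le> b i", OF ex])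
  have "i \<le> n" unfolding i_def by (rule Least_le[where P = "\<lambda>i. 1 \<le> i \<and> x \<le> b i", OF ex])
  moreover have "b (i - 1) \<le> x"
  proof (cases "i = 1")
    case False
    have "\<not> (1 \<le> i - 1 \<and> x \<le> b (i - 1))"
    proof
      assume "1 \<le> i - 1 \<and> x \<le> b (i - 1)"
      then have "i \<le> i - 1" unfolding i_def by (rule Least_le[where P = "\<lambda>i. 1 \<le> i \<and> x \<le> b i"])
      then have "i = 0" by linarith
      then show False using i by simp
    qed
    moreover have "1 \<le> i - 1" using i False by linarith
    ultimately show ?thesis by simp
  qed (use assms in simp)
  ultimately show ?thesis using that i by blast
qed

definition neutral :: "point \<Rightarrow> bool" where
  "neutral z \<longleftrightarrow> (\<exists>x\<in>{0..l}. \<forall>i\<in>{1..n}. apollonius a z (h i) x \<le> 0) \<and>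
     (\<forall>x\<in>{0..l}. \<exists>i\<in>{1..n}. 0 \<le> apollonius a z (h i) x)"

text \<open>Double root inside an open cell: the minimum is attained at the vertex of one
  parabola.\<close>

definition on_vertex :: "point \<Rightarrow> nat \<Rightarrow> bool" where
  "on_vertex z i \<longleftrightarrow> (\<exists>x. b (i - 1) < x \<and> x < b i \<and> slope z i x = 0 \<and> apollonius a z (h i) x = 0)"

text \<open>Minimum at a breakpoint: the left parabola does not rise there and the right one does
  not fall. At either end of the target line one condition is void.\<close>

definition on_corner :: "point \<Rightarrow> nat \<Rightarrow> bool" where
  "on_corner z i \<longleftrightarrow> (1 \<le> i \<longrightarrow> slope z i (b i) \<le> 0 \<and> apollonius a z (h i) (b i) = 0) \<and>
     (i < n \<longrightarrow> 0 \<le> slope z (Suc i) (b i) \<and> apollonius a z (h (Suc i)) (b i) = 0)"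

lemma a2: "a\<^sup>2 < 1" using a by (simp add: power_less_one_iff abs_square_less_1)

text \<open>By convexity the parabola lies above its tangent at \<open>x\<close>.\<close>

lemma apollonius_right:
  assumes "apollonius a z (h i) x = 0" "0 \<le> slope z i x * (x' - x)"
  shows "0 \<le> apollonius a z (h i) x'"
proof -
  have "apollonius a z (h i) x' = (1 - a\<^sup>2) * (x' - x)\<^sup>2 + 2 * (slope z i x * (x' - x))"
    using apollonius_shift[of a z "h i" x "x' - x"] assms(1) by (simp add: mult.assoc)
  moreover have "0 \<le> (1 - a\<^sup>2) * (x' - x)\<^sup>2" using a2 by simp
  ultimately show ?thesis using assms(2) by linarith
qed

text \<open>On its own cell the polynomial of \<open>h i\<close> is the maximum of all, hence
  nonnegative there; so \<open>x\<close> is a minimum over the cell and one-sided first order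
  conditions hold.\<close>

lemma neutral_slope:
  assumes z: "neutral z" and i: "1 \<le> i" "i \<le> n" and x: "b (i - 1) \<le> x" "x \<le> b i"
    and le: "\<forall>i\<in>{1..n}. apollonius a z (h i) x \<le> 0"
  shows "apollonius a z (h i) x = 0" "x < b i \<Longrightarrow> 0 \<le> slope z i x" "b (i - 1) < x \<Longrightarrow> slope z i x \<le> 0"
proof -
  have nonneg: "0 \<le> apollonius a z (h i) x'" if x': "b (i - 1) \<le> x'" "x' \<le> b i" for x'
  proof -
    have "i - 1 \<le> n" using i by simp
    then have "x' \<in> {0..l}" using b_range[of "i - 1"] b_range[of i] i x' by auto
    then obtain j where "j \<in> {1..n}" "0 \<le> apollonius a z (h j) x'" using z unfolding neutral_def by blast
    then show ?thesis using cell_apollonius[OF i x', of j z] by auto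
  qed
  show zero: "apollonius a z (h i) x = 0" using nonneg[OF x] le i by (intro antisym) auto
  define D where "D = slope z i x"
  have shift: "apollonius a z (h i) (x + y) = (1 - a\<^sup>2) * y\<^sup>2 + 2 * D * y" for y
    using zero by (simp only: apollonius_shift D_def)
  show "0 \<le> slope z i x" if "x < b i"
    unfolding D_def[symmetric]
  proof (rule quadratic_nonneg_imp)
    show "0 < b i - x" using that by simp
    show "0 \<le> (1 - a\<^sup>2) * y\<^sup>2 + 2 * D * y" if "0 < y" "y \<le> b i - x" for y
      using nonneg[of "x + y"] that x by (simp add: shift)
  qed
  show "slope z i x \<le> 0" if "b (i - 1) < x"
  proof -
    have "0 \<le> - D"
    proof (rule quadratic_nonneg_imp)
      show "0 < x - b (i - 1)" using that by simp
      show "0 \<le> (1 - a\<^sup>2) * y\<^sup>2 + 2 * - D * y" if "0 < y" "y \<le> x - b (i - 1)" for y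
        using nonneg[of "x + - y"] that x shift[of "- y"] by simp
    qed
    then show ?thesis unfolding D_def by simp
  qed
qed

text \<open>A minimum lies inside a cell or at a breakpoint. Conversely the local conditions suffice
  because each parabola is convex, so the bound extends from the cell to the whole side.\<close>

lemma neutral_iff: "neutral z \<longleftrightarrow> (\<exists>i\<in>{1..n}. on_vertex z i) \<or> (\<exists>i\<in>{0..n}. on_corner z i)"
proof
  assume z: "neutral z"
  then obtain x where x: "x \<in> {0..l}" and le: "\<forall>i\<in>{1..n}. apollonius a z (h i) x \<le> 0"
    by (auto simp: neutral_def)
  note ns = neutral_slope[OF z _ _ _ _ le]
  obtain i where i: "1 \<le> i" "i \<le> n" "b (i - 1) \<le> x" "x \<le> b i" using ex_cell[OF x] by blast
  have corner: "on_corner z j" if j: "j \<le> n" "x = b j" for j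
  proof -
    have "slope z j x \<le> 0 \<and> apollonius a z (h j) x = 0" if "1 \<le> j"
    proof -
      have "b (j - 1) < b j" using b_less_Suc[of "j - 1"] that j by simp
      then show ?thesis using ns(1,3)[of j] that j by simp
    qed
    moreover have "0 \<le> slope z (Suc j) x \<and> apollonius a z (h (Suc j)) x = 0" if "j < n"
    proof -
      have "b j < b (Suc j)" using b_less_Suc[of j] that by simp
      then show ?thesis using ns(1,2)[of "Suc j"] that j by simp
    qed
    ultimately show ?thesis using j by (auto simp: on_corner_def)
  qed
  show "(\<exists>i\<in>{1..n}. on_vertex z i) \<or> (\<exists>i\<in>{0..n}. on_corner z i)"
  proof (cases "b (i - 1) < x \<and> x < b i")
    case True
    then have "on_vertex z i"
      unfolding on_vertex_def using ns[OF i] by (intro exI[of _ x]) auto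
    then show ?thesis using i by auto
  next
    case False
    then consider "x = b (i - 1)" | "x = b i" using i by linarith
    then show ?thesis
      using corner[of "i - 1"] corner[of i] i by (metis atLeastAtMost_iff diff_le_self le_trans zero_le)
  qed
next
  assume "(\<exists>i\<in>{1..n}. on_vertex z i) \<or> (\<exists>i\<in>{0..n}. on_corner z i)"
  then show "neutral z"
  proof
    assume "\<exists>i\<in>{1..n}. on_vertex z i"
    then obtain i x where i: "1 \<le> i" "i \<le> n" and x: "b (i - 1) < x" "x < b i" "slope z i x = 0" "apollonius a z (h i) x = 0"
      by (auto simp: on_vertex_def)
    have "i - 1 \<le> n" using i by simp
    then have "x \<in> {0..l}" using b_range[of "i - 1"] b_range[of i] i x by auto
    moreover have "apollonius a z (h j) x \<le> 0" if "j \<in> {1..n}" for j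
      using cell_apollonius[of i x j z] i x that by auto
    moreover have "0 \<le> apollonius a z (h i) x'" for x'
      using apollonius_right[OF x(4)] x(3) by simp
    ultimately show ?thesis using i unfolding neutral_def by (metis atLeastAtMost_iff)
  next
    assume "\<exists>i\<in>{0..n}. on_corner z i"
    then obtain i where i: "i \<le> n" and c: "on_corner z i" by auto
    have le: "apollonius a z (h j) (b i) \<le> 0" if "j \<in> {1..n}" for j
    proof (cases "1 \<le> i")
      case True
      then show ?thesis
        using cell_apollonius[of i "b i" j z] b_mono[of "i - 1" i] i c that by (auto simp: on_corner_def)
    next
      case False
      then have "i = 0" by simp
      then show ?thesis
        using cell_apollonius[of 1 "b 0" j z] b_mono[of 0 1] n c that by (auto simp: on_corner_def)
    qed
    have "\<exists>j\<in>{1..n}. 0 \<le> apollonius a z (h j) x" if x: "x \<in> {0..l}" for x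
    proof (cases "x \<le> b i \<and> 1 \<le> i")
      case True
      then have "0 \<le> apollonius a z (h i) x"
        using c by (intro apollonius_right[of z i "b i"]) (auto simp: on_corner_def mult_nonpos_nonpos)
      then show ?thesis using True i by auto
    next
      case False
      then have "b i \<le> x \<and> i < n" using x n i by (cases "i = 0"; cases "i = n") auto
      then have "0 \<le> apollonius a z (h (Suc i)) x"
        using c by (intro apollonius_right[of z "Suc i" "b i"]) (auto simp: on_corner_def)
      then show ?thesis using \<open>b i \<le> x \<and> i < n\<close> by auto
    qed
    then show ?thesis using le b_range[OF i] unfolding neutral_def by blast
  qed
qed


section \<open>Identification of the base curves\<close>

lemma on_vertex_iff:
  assumes "1 \<le> i" "i \<le> n"
  shows "on_vertex z i \<longleftrightarrow>
    (fst z - fst (h i))\<^sup>2 + (1 - 1 / a\<^sup>2) * (snd z)\<^sup>2 + (1 - a\<^sup>2) * (snd (h i))\<^sup>2 = 0 \<and>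
    (1 - a\<^sup>2) * b (i - 1) + a\<^sup>2 * fst (h i) < fst z \<and> fst z < (1 - a\<^sup>2) * b i + a\<^sup>2 * fst (h i)"
    (is "_ \<longleftrightarrow> ?E \<and> ?R")
proof -
  \<comment> \<open>The only zero of the slope, which is affine in its argument.\<close>
  define x where "x = (fst z - a\<^sup>2 * fst (h i)) / (1 - a\<^sup>2)"
  have z: "fst z = (1 - a\<^sup>2) * x + a\<^sup>2 * fst (h i)" using a2 by (simp add: x_def)
  have "slope z i y = (1 - a\<^sup>2) * (y - x)" for y unfolding z by (simp add: algebra_simps)
  then have "slope z i y = 0 \<longleftrightarrow> y = x" for y using a2 by simp
  then have "on_vertex z i \<longleftrightarrow> b (i - 1) < x \<and> x < b i \<and> apollonius a z (h i) x = 0"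
    by (auto simp: on_vertex_def)
  moreover have "b (i - 1) < x \<and> x < b i \<longleftrightarrow> ?R" using a2 by (simp add: z)
  ultimately show ?thesis using apollonius_vertex[OF a z] by blast
qed

lemma slope_corner_iff:
  "slope z i x \<le> 0 \<longleftrightarrow> (1 - a\<^sup>2) * x + a\<^sup>2 * fst (h i) \<le> fst z"
  "0 \<le> slope z i x \<longleftrightarrow> fst z \<le> (1 - a\<^sup>2) * x + a\<^sup>2 * fst (h i)"
  by (auto simp: algebra_simps)

lemma apollonius_corner_iff: "apollonius a z (h i) x = 0 \<longleftrightarrow> norm (z - (x, 0)) = a * norm (h i - (x, 0))"
  using a by (intro apollonius_zero_iff) simp

lemma equidistant_breakpoint:
  assumes "1 \<le> i" "i < n"
  shows "equidistant_point (h i) (h (i + 1)) = (b i, 0)"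
  using equidistant_point(1)[of "h i" "h (i + 1)"] incr[of i "i + 1"] assms
  by (auto simp: breakpoint_def prod_eq_iff)

lemma F1_1_iff:
  assumes "snd z < 0" shows "z \<in> F1_1 a l (h 1) \<longleftrightarrow> on_corner z 0"
  using n assms apollonius_corner_iff[of z 1 0] slope_corner_iff(2)[where z = z and i = 1 and x = 0]
  by (auto simp: F1_1_def on_corner_def Let_def)

lemma F1_3_iff:
  assumes "snd z < 0" shows "z \<in> F1_3 a l (h n) \<longleftrightarrow> on_corner z n"
  using n assms apollonius_corner_iff[of z n l] slope_corner_iff(1)[where z = z and i = n and x = l]
  by (auto simp: F1_3_def on_corner_def Let_def)

text \<open>At a breakpoint the two neighbouring polynomials agree, so one circle equation expresses
  both zero conditions.\<close>

lemma F2_3_iff: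
  assumes "snd z < 0" "1 \<le> i" "i < n" shows "z \<in> F2_3 a l (h i) (h (i + 1)) \<longleftrightarrow> on_corner z i"
proof -
  have "apollonius a z (h i) (b i) = apollonius a z (h (Suc i)) (b i)"
    using b_eq[OF assms(2,3)] by (simp add: apollonius_sqdist)
  then show ?thesis
    using assms apollonius_corner_iff[of z i "b i"] slope_corner_iff(1)[where z = z and i = i and x = "b i"] slope_corner_iff(2)[where z = z and i = "Suc i" and x = "b i"]
    unfolding F2_3_def on_corner_def equidistant_breakpoint[OF assms(2,3)] by (auto simp: Let_def)
qed

lemma F1_2_iff:
  assumes "snd z < 0" "n = 1" shows "z \<in> F1_2 a l (h 1) \<longleftrightarrow> on_vertex z 1"
  unfolding on_vertex_iff[of 1, OF order_refl n] F1_2_def using assms b_ends by (auto simp: Let_def)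

lemma F2_2_iff:
  assumes "snd z < 0" "1 < n" shows "z \<in> F2_2 a l (h 1) (h 2) \<longleftrightarrow> on_vertex z 1"
  using equidistant_breakpoint[of 1] assms
  unfolding on_vertex_iff[of 1, OF order_refl n] F2_2_def by (auto simp: Let_def numeral_2_eq_2)

lemma F2_4_iff:
  assumes "snd z < 0" "1 < n" shows "z \<in> F2_4 a l (h (n - 1)) (h n) \<longleftrightarrow> on_vertex z n"
  using equidistant_breakpoint[of "n - 1"] assms
  unfolding on_vertex_iff[of n, OF n order_refl] F2_4_def by (auto simp: Let_def)

lemma F3_iff:
  assumes "snd z < 0" "2 \<le> i" "i \<le> n - 1" shows "z \<in> F3 a (h (i - 1)) (h i) (h (i + 1)) \<longleftrightarrow> on_vertex z i"
proof -
  have i: "1 \<le> i" "i \<le> n" "i - 1 + 1 = i" using assms by auto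
  show ?thesis
    using equidistant_breakpoint[of "i - 1"] equidistant_breakpoint[of i] assms i
    unfolding on_vertex_iff[OF i(1,2)] F3_def by (auto simp: Let_def)
qed

text \<open>The pieces match the places of the minimum: \<open>F1_1\<close> and \<open>F1_3\<close>
  the ends, \<open>F2_3\<close> the inner breakpoints, and \<open>F1_2\<close>, \<open>F2_2\<close>,
  \<open>F3\<close>, \<open>F2_4\<close> the vertices.\<close>

theorem Phi_iff_neutral:
  assumes z: "snd z < 0"
  shows "z \<in> Phi a l n h \<longleftrightarrow> neutral z"
proof (cases "n = 1")
  case True
  have "{1..n} = {1}" "{0..n} = {0, n}" using True by auto
  then show ?thesis
    using F1_1_iff[OF z] F1_2_iff[OF z True] F1_3_iff[OF z] True
    unfolding neutral_iff Phi_def by auto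
next
  case False
  then have n1: "1 < n" using n by simp
  have Phi: "z \<in> Phi a l n h \<longleftrightarrow> z \<in> F1_1 a l (h 1) \<or> z \<in> F2_2 a l (h 1) (h 2) \<or>
       (\<exists>i\<in>{1..n-1}. z \<in> F2_3 a l (h i) (h (i + 1))) \<or>
       (\<exists>i\<in>{2..n-1}. z \<in> F3 a (h (i - 1)) (h i) (h (i + 1))) \<or>
       z \<in> F2_4 a l (h (n - 1)) (h n) \<or> z \<in> F1_3 a l (h n)"
  proof (cases "n = 2")
    case True
    then have "{1..n-1} = {1}" "{2..n-1} = {}" by auto
    then show ?thesis
      using True by (simp add: Phi_def F2_1_def F2_5_def numeral_2_eq_2)
  next
    case False
    then show ?thesis using n1 by (auto simp: Phi_def F2_1_def F2_5_def)
  qed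
  have "(\<exists>i\<in>{1..n-1}. z \<in> F2_3 a l (h i) (h (i + 1))) \<longleftrightarrow> (\<exists>i\<in>{1..n-1}. on_corner z i)"
    using F2_3_iff[OF z] by (intro bex_cong) auto
  moreover have "(\<exists>i\<in>{2..n-1}. z \<in> F3 a (h (i - 1)) (h i) (h (i + 1))) \<longleftrightarrow> (\<exists>i\<in>{2..n-1}. on_vertex z i)"
    using F3_iff[OF z] by (intro bex_cong) auto
  moreover have "{1..n} = insert 1 (insert n {2..n-1})" "{0..n} = insert 0 (insert n {1..n-1})" using n1 by auto
  ultimately show ?thesis
    unfolding neutral_iff Phi F1_1_iff[OF z] F1_3_iff[OF z] F2_2_iff[OF z n1] F2_4_iff[OF z n1] by auto
qed

end

section \<open>Active pursuers\<close>

lemma ex_increasing_listing: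
  assumes "finite X" "inj_on fst X"
  shows "\<exists>h. increasing_listing (card X) h X"
proof -
  define xs where "xs = sorted_list_of_set (fst ` X)"
  have len: "length xs = card X" using assms by (simp add: xs_def card_image)
  have srt: "sorted_wrt (<) xs" by (simp add: xs_def)
  have less: "xs ! i < xs ! j" if "i < j" "j < card X" for i j
    using sorted_wrt_nth_less[OF srt] that len by simp
  define g where "g i = xs ! (i - 1)" for i
  have "inj_on g {1..card X}"
  proof (rule inj_onI)
    fix i j assume ij: "i \<in> {1..card X}" "j \<in> {1..card X}" and eq: "g i = g j"
    show "i = j"
    proof (rule ccontr)
      assume "i \<noteq> j"
      then have "i - 1 < j - 1 \<or> j - 1 < i - 1" "i - 1 < card X" "j - 1 < card X" using ij by auto
      then show False using less[of "i - 1" "j - 1"] less[of "j - 1" "i - 1"] eq by (auto simp: g_def)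
    qed
  qed
  moreover have "g ` {1..card X} \<subseteq> fst ` X"
  proof safe
    fix i assume "i \<in> {1..card X}"
    then have "g i \<in> set xs" using len by (auto simp: g_def)
    then show "g i \<in> fst ` X" using assms by (simp add: xs_def)
  qed
  ultimately have "g ` {1..card X} = fst ` X"
    using assms by (intro card_subset_eq) (auto simp: card_image)
  then have g: "bij_betw g {1..card X} (fst ` X)"
    using \<open>inj_on g {1..card X}\<close> by (simp add: bij_betw_def)
  have inv: "bij_betw (inv_into X fst) (fst ` X) X"
    using assms by (intro bij_betw_inv_into) (simp add: bij_betw_def)
  have "fst (inv_into X fst (g i)) = g i" if "i \<in> {1..card X}" for i
    using bij_betwE[OF g] that by (simp add: f_inv_into_f)
  then have "strict_mono_on {1..card X} (\<lambda>i. fst ((inv_into X fst \<circ> g) i))"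
    using less by (auto simp: strict_mono_on_def g_def)
  then show ?thesis
    using bij_betw_trans[OF g inv] unfolding increasing_listing_def by blast
qed

context reach_avoid
begin

lemma active_iff:
  "active l X K i \<longleftrightarrow> i \<in> K \<and> (\<exists>x\<in>{0..l}. \<forall>j\<in>K - {i}. sqdist (X i) x < sqdist (X j) x)"
  unfolding active_def target_line_image sqdist_less_iff by simp

lemma target_part_nonempty_iff: "i \<in> K \<and> target_part l X K i \<noteq> {} \<longleftrightarrow> active l X K i"
  unfolding target_part_def active_def by (auto simp: norm_minus_commute)

text \<open>Several pursuers may be nearest to \<open>x\<close>. A small shift along the target line
  separates them: the one farthest in that direction becomes strictly nearest, hence is active.
  Nearest pursuers of equal abscissa coincide, since all lie in the lower half-plane.\<close>

lemma ex_active_nearest: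
  assumes K: "finite K" and inj: "inj_on X K" and le: "\<And>i. i \<in> K \<Longrightarrow> snd (X i) \<le> 0"
    and x: "x \<in> {0..l}" and i: "i \<in> K"
  shows "\<exists>j. active l X K j \<and> sqdist (X j) x \<le> sqdist (X i) x"
proof -
  \<comment> \<open>The direction of the shift must stay in the target line; it is to the left only
    at the right end.\<close>
  obtain r :: real where r: "r = 1 \<or> r = - 1" "\<And>t. 0 < t \<Longrightarrow> t < l \<Longrightarrow> t < l - x \<or> x = l \<Longrightarrow> x + t * r \<in> {0..l}"
  proof (cases "x = l")
    case True
    show ?thesis by (rule that[of "- 1"]) (use True x in auto)
  next
    case False
    show ?thesis by (rule that[of 1]) (use False x in auto)
  qed
  define M where "M = {k \<in> K. \<forall>k'\<in>K. sqdist (X k) x \<le> sqdist (X k') x}"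
  have "M \<noteq> {}"
  proof -
    have "arg_min_on (\<lambda>k. sqdist (X k) x) K \<in> M"
      using arg_min_if_finite[of K "\<lambda>k. sqdist (X k) x"] K i by (auto simp: M_def not_less)
    then show ?thesis by blast
  qed
  have "finite M" using K by (simp add: M_def)
  obtain j where j: "j \<in> M" "\<And>k. k \<in> M \<Longrightarrow> r * fst (X k) \<le> r * fst (X j)"
  proof -
    show ?thesis
      using that[of "arg_min_on (\<lambda>k. - (r * fst (X k))) M"]
        arg_min_if_finite[of M "\<lambda>k. - (r * fst (X k))"] \<open>finite M\<close> \<open>M \<noteq> {}\<close> by (auto simp: not_less)
  qed
  have jK: "j \<in> K" and near: "\<And>k. k \<in> K \<Longrightarrow> sqdist (X j) x \<le> sqdist (X k) x" using j(1) by (auto simp: M_def)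
  have "eventually (\<lambda>t. \<forall>k\<in>K - {j}. sqdist (X j) (x + t * r) < sqdist (X k) (x + t * r)) (at_right 0)"
  proof (rule eventually_ball_finite, use K in simp, rule ballI)
    fix k assume k: "k \<in> K - {j}"
    have eq: "sqdist (X k) (x + t * r) - sqdist (X j) (x + t * r)
        = sqdist (X k) x - sqdist (X j) x + 2 * (r * fst (X j) - r * fst (X k)) * t" for t
      using sqdist_diff[of "X k" "x + t * r" "X j" x] by (simp add: algebra_simps)
    show "eventually (\<lambda>t. sqdist (X j) (x + t * r) < sqdist (X k) (x + t * r)) (at_right 0)"
    proof (cases "sqdist (X k) x = sqdist (X j) x")
      case True
      then have kM: "k \<in> M" using k near by (auto simp: M_def)
      have "fst (X k) \<noteq> fst (X j)"
      proof
        assume fst: "fst (X k) = fst (X j)"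
        then have "(snd (X k))\<^sup>2 = (snd (X j))\<^sup>2" using True by (simp add: sqdist_def)
        then have "snd (X k) = snd (X j)"
          using le[of k] le[OF jK] k power2_eq_iff_nonneg[of "- snd (X k)" "- snd (X j)"] by simp
        then have "X k = X j" using fst by (simp add: prod_eq_iff)
        then show False using inj k jK by (auto dest: inj_onD)
      qed
      then have "r * fst (X k) < r * fst (X j)" using j(2)[OF kM] r(1) by auto
      then have "0 < 2 * (r * fst (X j) - r * fst (X k)) * t" if "0 < t" for t
        using that by simp
      then have "sqdist (X j) (x + t * r) < sqdist (X k) (x + t * r)" if "0 < t" for t
        using eq[of t] True that by (smt (verit))
      then show ?thesis using eventually_at_right_less[of "0::real"] by (auto elim: eventually_mono)
    next
      case False
      then have pos: "0 < sqdist (X k) x - sqdist (X j) x" using near[of k] k by simp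
      have "((\<lambda>t. sqdist (X k) x - sqdist (X j) x + 2 * (r * fst (X j) - r * fst (X k)) * t)
          \<longlongrightarrow> sqdist (X k) x - sqdist (X j) x + 2 * (r * fst (X j) - r * fst (X k)) * 0) (at_right 0)"
        by (intro tendsto_intros)
      then have "eventually (\<lambda>t. 0 < sqdist (X k) x - sqdist (X j) x + 2 * (r * fst (X j) - r * fst (X k)) * t) (at_right 0)"
        by (rule order_tendstoD(1)) (use pos in simp)
      then show ?thesis unfolding eq[symmetric] by eventually_elim simp
    qed
  qed
  moreover have "eventually (\<lambda>t. 0 < t \<and> t < l \<and> (t < l - x \<or> x = l)) (at_right 0)"
  proof (cases "x = l")
    case True
    then show ?thesis using eventually_at_right_real[OF l_pos] by (auto elim: eventually_mono)
  next
    case False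
    then have "0 < l - x" using x by simp
    then show ?thesis using eventually_at_right_real[of 0 "l - x"] x by (auto elim!: eventually_mono)
  qed
  ultimately have "eventually (\<lambda>t. (\<forall>k\<in>K - {j}. sqdist (X j) (x + t * r) < sqdist (X k) (x + t * r)) \<and>
      0 < t \<and> t < l \<and> (t < l - x \<or> x = l)) (at_right 0)"
    by (rule eventually_conj)
  then obtain t where "\<forall>k\<in>K - {j}. sqdist (X j) (x + t * r) < sqdist (X k) (x + t * r)"
      "0 < t" "t < l" "t < l - x \<or> x = l"
    using eventually_happens trivial_limit_at_right_real by blast
  then have "active l X K j"
    using jK r(2)[of t] unfolding active_iff by blast
  then show ?thesis using near[OF i] by blast
qed

text \<open>Each point of the target line has an active nearest pursuer, hence the inactive ones are irrelevant.\<close>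

lemma dominates_active:
  assumes K: "finite K" and inj: "inj_on X K" and le: "\<And>i. i \<in> K \<Longrightarrow> snd (X i) \<le> 0"
  shows "pursuers_dominate {i. active l X K i} X z \<longleftrightarrow> pursuers_dominate K X z"
    "evader_dominates {i. active l X K i} X z \<longleftrightarrow> evader_dominates K X z"
proof -
  have mono: "\<exists>j. active l X K j \<and> apollonius (vE / vP) z (X i) x \<le> apollonius (vE / vP) z (X j) x"
    if i: "i \<in> K" and x: "x \<in> {0..l}" for i x
  proof -
    obtain j where j: "active l X K j" "sqdist (X j) x \<le> sqdist (X i) x"
      using ex_active_nearest[where X = X, OF K inj le x i] by blast
    have "apollonius (vE / vP) z (X i) x \<le> apollonius (vE / vP) z (X j) x"
      using mult_left_mono[OF j(2), of "(vE / vP)\<^sup>2"] by (simp add: apollonius_sqdist)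
    then show ?thesis using j(1) by blast
  qed
  have sub: "active l X K i \<Longrightarrow> i \<in> K" for i by (simp add: active_iff)
  show "pursuers_dominate {i. active l X K i} X z \<longleftrightarrow> pursuers_dominate K X z"
    unfolding pursuers_dominate_iff using mono sub by (metis less_le_trans mem_Collect_eq)
  show "evader_dominates {i. active l X K i} X z \<longleftrightarrow> evader_dominates K X z"
    unfolding evader_dominates_iff using mono sub by (metis le_less_trans mem_Collect_eq)
qed

end

theorem theorem4:
  fixes \<Omega> :: "point set" and l vP vE \<alpha> :: real
    and Np Ne :: nat and xP xE :: "nat \<Rightarrow> point" and K :: "nat set"
  assumes "reach_avoid_domain \<Omega> l"
    and "0 < vP" and "0 < vE" and "\<alpha> = vE / vP" and "0 < \<alpha>" and "\<alpha> < 1"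
    and "inj_on xP {1..Np}" and "inj_on xE {1..Ne}" and "xP ` {1..Np} \<inter> xE ` {1..Ne} = {}"
    and "\<forall>i\<in>{1..Np}. xP i \<in> play_region \<Omega> \<union> target_line l"
    and "\<forall>j\<in>{1..Ne}. xE j \<in> play_region \<Omega>"
    and "K \<subseteq> {1..Np}" and "K \<noteq> {}"
  shows "let Kbar = {i \<in> K. target_part l xP K i \<noteq> {}};
             Xbar = xP ` Kbar;
             nbar = card Xbar
         in largest_full_active_subcoalition l xP K Kbar \<and>
            barrier \<Omega> vP vE K xP = barrier \<Omega> vP vE Kbar xP \<and>
            (\<exists>h. increasing_listing nbar h Xbar) \<and>
            (\<forall>h. increasing_listing nbar h Xbar \<longrightarrow>
               barrier \<Omega> vP vE Kbar xP = Phi \<alpha> l nbar h \<inter> play_region \<Omega>)"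
proof -
  have "vE < vP" using assms by (simp add: divide_less_eq)
  then interpret reach_avoid \<Omega> l vP vE
    using assms by unfold_locales auto
  have K: "finite K" using assms(12) by (rule finite_subset) simp
  have inj: "inj_on xP K" using assms(7,12) by (rule inj_on_subset)
  have X: "xP i \<in> \<Omega>" "snd (xP i) \<le> 0" if "i \<in> K" for i
    using assms(10,12) that by (force simp: play_iff target_line_iff intro: target_line_subset)+
  let ?A = "{i. active l xP K i}"
  have Kbar: "{i \<in> K. target_part l xP K i \<noteq> {}} = ?A"
    using target_part_nonempty_iff by blast
  have sub: "?A \<subseteq> K" by (auto simp: active_iff)
  then have finA: "finite ?A" using K by (rule finite_subset)
  have neA: "?A \<noteq> {}"
  proof -
    obtain i where "i \<in> K" using assms(13) by blast
    then show ?thesis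
      using ex_active_nearest[where X = xP and x = 0 and i = i, OF K inj X(2)] l_pos by auto
  qed
  have full: "active l xP ?A i" if "i \<in> ?A" for i
    using that sub unfolding active_iff[of xP ?A] by (fastforce simp: active_iff[of xP K])
  have largest: "largest_full_active_subcoalition l xP K ?A"
    using neA sub full by (auto simp: largest_full_active_subcoalition_def full_active_def)
  have barrierA: "barrier \<Omega> vP vE ?A xP = {z \<in> play. \<not> pursuers_dominate ?A xP z \<and> \<not> evader_dominates ?A xP z}"
    using X(1) sub by (intro barrier_eq finA neA) auto
  have barrierK: "barrier \<Omega> vP vE K xP = barrier \<Omega> vP vE ?A xP"
  proof -
    have "barrier \<Omega> vP vE K xP = {z \<in> play. \<not> pursuers_dominate K xP z \<and> \<not> evader_dominates K xP z}"
      by (rule barrier_eq[OF K assms(13)]) (rule X(1))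
    also have "\<dots> = barrier \<Omega> vP vE ?A xP"
      using dominates_active[where X = xP, OF K inj X(2)] unfolding barrierA by blast
    finally show ?thesis .
  qed
  obtain q where q: "\<And>i. i \<in> ?A \<Longrightarrow> q i \<in> {0..l}"
    "\<And>i j. i \<in> ?A \<Longrightarrow> j \<in> ?A \<Longrightarrow> j \<noteq> i \<Longrightarrow> sqdist (xP i) (q i) < sqdist (xP j) (q i)"
  proof -
    have "\<forall>i\<in>?A. \<exists>x\<in>{0..l}. \<forall>j\<in>?A - {i}. sqdist (xP i) x < sqdist (xP j) x"
      using full by (auto simp: active_iff[of xP ?A])
    then obtain q where "\<forall>i\<in>?A. q i \<in> {0..l} \<and> (\<forall>j\<in>?A - {i}. sqdist (xP i) (q i) < sqdist (xP j) (q i))"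
      by metis
    then show ?thesis using that by blast
  qed
  \<comment> \<open>Equal abscissae would make the difference of the squared distances constant
    along the line, so not both pursuers could be active.\<close>
  have injA: "inj_on fst (xP ` ?A)"
  proof (rule inj_onI)
    fix u v assume "u \<in> xP ` ?A" "v \<in> xP ` ?A" and uv: "fst u = fst v"
    then obtain i j where ij: "active l xP K i" "active l xP K j" and [simp]: "u = xP i" "v = xP j" by blast
    have eq: "fst (xP i) = fst (xP j)" using uv by simp
    have "i = j"
    proof (rule ccontr)
      assume "i \<noteq> j"
      then have "sqdist (xP i) (q i) < sqdist (xP j) (q i)" "sqdist (xP j) (q j) < sqdist (xP i) (q j)"
        using q(2)[of i j] q(2)[of j i] ij by auto
      then show False by (simp add: sqdist_def eq)
    qed
    then show "u = v" by simp
  qed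
  have "barrier \<Omega> vP vE ?A xP = Phi \<alpha> l (card (xP ` ?A)) h \<inter> play_region \<Omega>"
    if h: "increasing_listing (card (xP ` ?A)) h (xP ` ?A)" for h
  proof -
    define n where "n = card (xP ` ?A)"
    have bij: "bij_betw h {1..n} (xP ` ?A)" and mono: "strict_mono_on {1..n} (\<lambda>i. fst (h i))"
      using h by (auto simp: increasing_listing_def n_def)
    have "\<forall>k\<in>{1..n}. \<exists>i\<in>?A. h k = xP i" using bij_betwE[OF bij] by blast
    then obtain f where f: "\<And>k. k \<in> {1..n} \<Longrightarrow> f k \<in> ?A" "\<And>k. k \<in> {1..n} \<Longrightarrow> h k = xP (f k)" by metis
    have fne: "f j \<noteq> f k" if "j \<in> {1..n}" "k \<in> {1..n}" "j \<noteq> k" for j k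
      using f(2)[OF that(1)] f(2)[OF that(2)] bij_betw_imp_inj_on[OF bij] that by (metis inj_onD)
    interpret active_listing l \<alpha> n h "q \<circ> f"
    proof
      show "1 \<le> n" using finA neA by (simp add: n_def Suc_le_eq card_gt_0_iff)
      show "fst (h i) < fst (h j)" if "1 \<le> i" "i < j" "j \<le> n" for i j
        using strict_mono_onD[OF mono] that by simp
      show "0 \<le> (q \<circ> f) i \<and> (q \<circ> f) i \<le> l" if "1 \<le> i" "i \<le> n" for i
        using q(1)[OF f(1)[of i]] that by simp
      show "sqdist (h i) ((q \<circ> f) i) < sqdist (h j) ((q \<circ> f) i)" if "1 \<le> i" "i \<le> n" "1 \<le> j" "j \<le> n" "i \<noteq> j" for i j
        using q(2)[OF f(1)[of i] f(1)[of j]] fne[of j i] f(2) that by simp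
    qed (use l_pos assms in auto)
    have img: "h ` {1..n} = xP ` ?A" using bij by (rule bij_betw_imp_surj_on)
    \<comment> \<open>Conditions on the listed points and on the active pursuers agree, whichever
      listing is chosen.\<close>
    have all: "(\<forall>k\<in>{1..n}. P (h k)) \<longleftrightarrow> (\<forall>i\<in>?A. P (xP i))" for P
    proof -
      have "(\<forall>k\<in>{1..n}. P (h k)) \<longleftrightarrow> (\<forall>y\<in>h ` {1..n}. P y)" by blast
      then show ?thesis unfolding img by blast
    qed
    have ex: "(\<exists>k\<in>{1..n}. P (h k)) \<longleftrightarrow> (\<exists>i\<in>?A. P (xP i))" for P
      using all[of "\<lambda>y. \<not> P y"] by blast
    have "neutral z \<longleftrightarrow> \<not> pursuers_dominate ?A xP z \<and> \<not> evader_dominates ?A xP z" for z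
      unfolding neutral_def pursuers_dominate_iff evader_dominates_iff assms(4)[symmetric]
        all[of "\<lambda>y. apollonius \<alpha> z y _ \<le> 0"] ex[of "\<lambda>y. 0 \<le> apollonius \<alpha> z y _"]
      by (simp add: not_less)
    then show ?thesis
      unfolding barrierA n_def[symmetric] using Phi_iff_neutral by (auto simp: play_iff)
  qed
  then show ?thesis
    unfolding Let_def Kbar using largest barrierK ex_increasing_listing[OF finite_imageI[OF finA] injA] by blast
qed

end
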